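(* Let $0<a_3<a_2<a_1$ and let $\mathcal{E}=\{w\in\mathbb{R}^3:\ \sum_{j=1}^3 w_j^2/a_j^2=1\}$ be the triaxial ellipsoid with the Riemannian metric $g$ induced from $\mathbb{R}^3$. Let $P_1(h)=-h^2\Delta_g-1$ and let $(P_1(h),P_2(h))$ be the associated quantum completely integrable system on $\mathcal{E}$. Then there is a constant $C>0$ such that any $L^2$-normalized joint eigenfunction $u_h$ of the system, i.e. $P_1(h)u_h=0$ and $P_2(h)u_h=E_2(h)u_h$ for some $E_2(h)\in\mathbb{R}$, satisfies $$\|u_h\|_{L^\infty(\mathcal{E})}\le C\,h^{-1/2}\,|\log h|^{-1/2}.$$
   Context: The semiclassical parameter $h$ takes values in a sequence tending to $0^+$ (estimates are for small $h$). The QCI system on $\mathcal{E}$: there are $T_1,T_2>0$ and conformal maps from the rectangles $R_+=(0,T_1)\times(0,T_2)$ and $R_-=(T_1,2T_1)\times(0,T_2)$ onto $\mathcal{E}\cap\{w_2>0\}$ and $\mathcal{E}\cap\{w_2<0\}$ respectively, sending the vertices to the four umbilic points of $\mathcal{E}$; these identify $\mathcal{E}$ with the quotient $T/\sigma$ of the torus $T=\mathbb{R}^2/(2T_1\mathbb{Z}\oplus2T_2\mathbb{Z})$ by the involution $\sigma(z)=-z$, the umbilic points corresponding to the four fixed points of $\sigma$. In the resulting coordinates $(x_1,x_2)$, valid locally away from the umbilic points, the metric has Liouville form $$g=\big(a(x_1)+b(x_2)\big)(dx_1^2+dx_2^2),$$ where $a,b$ are real-analytic functions on $\mathbb{R}$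 with $a(kT_1)=a'(kT_1)=0$, $b(kT_2)=b'(kT_2)=0$, $a''(kT_1)\ne0$, $b''(kT_2)\neq0$ for all $k\in\mathbb{Z}$. In these coordinates $$-h^2\Delta_g=-[a(x_1)+b(x_2)]^{-1}\big((h\partial_{x_1})^2+(h\partial_{x_2})^2\big),$$ and the commuting operator is $$P_2(h)=-[a(x_1)+b(x_2)]^{-1}\big(b(x_2)(h\partial_{x_1})^2-a(x_1)(h\partial_{x_2})^2\big),$$ so that $[P_1(h),P_2(h)]=0$. *)

theory Defs
  imports "HOL-Analysis.Analysis"
begin

section \<open>Smoothness and partial derivatives\<close>

primrec Ck_on :: "nat \<Rightarrow> 'a::euclidean_space set \<Rightarrow> ('a \<Rightarrow> 'b::real_normed_vector) \<Rightarrow> bool" where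
  "Ck_on 0 S f \<longleftrightarrow> continuous_on S f"
| "Ck_on (Suc k) S f \<longleftrightarrow> (\<forall>x\<in>S. f differentiable at x) \<and>
     (\<forall>v. Ck_on k S (\<lambda>x. frechet_derivative f (at x) v))"

text \<open>Only meant for open sets.\<close>

definition smooth_on :: "'a::euclidean_space set \<Rightarrow> ('a \<Rightarrow> 'b::real_normed_vector) \<Rightarrow> bool" where
  "smooth_on S f \<longleftrightarrow> (\<forall>k. Ck_on k S f)"

text \<open>Smoothness on a (not necessarily open) subset such as an embedded surface: \<open>f\<close> is locally
  the restriction of a smooth function of the ambient space. Values of \<open>f\<close> outside \<open>S\<close> are
  irrelevant.\<close>

definition smooth_on_subset :: "'a::euclidean_space set \<Rightarrow> ('a \<Rightarrow> 'b::real_normed_vector) \<Rightarrow> bool" where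
  "smooth_on_subset S f \<longleftrightarrow>
     (\<forall>p\<in>S. \<exists>U F. open U \<and> p \<in> U \<and> smooth_on U F \<and> (\<forall>x\<in>S \<inter> U. F x = f x))"

definition real_analytic :: "(real \<Rightarrow> real) \<Rightarrow> bool" where
  "real_analytic f \<longleftrightarrow>
     (\<forall>x0. \<exists>r>0. \<exists>c. \<forall>x. \<bar>x - x0\<bar> < r \<longrightarrow> (\<lambda>n. c n * (x - x0) ^ n) sums f x)"

definition partial :: "'n \<Rightarrow> (real ^ 'n \<Rightarrow> 'b::real_normed_vector) \<Rightarrow> real ^ 'n \<Rightarrow> 'b" where
  "partial i f x = frechet_derivative f (at x) (axis i 1)"

section \<open>Riemannian geometry of surfaces in three-space\<close>

text \<open>All surfaces carry the metric induced from \<open>real ^ 3\<close>; \<open>metric X z\<close> is its matrix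
  in the coordinates given by a parametrization \<open>X\<close>.\<close>

definition metric :: "(real ^ 2 \<Rightarrow> real ^ 3) \<Rightarrow> real ^ 2 \<Rightarrow> real ^ 2 ^ 2" where
  "metric X z = (\<chi> i j. partial i X z \<bullet> partial j X z)"

definition regular_parametrization ::
    "(real ^ 3) set \<Rightarrow> (real ^ 2) set \<Rightarrow> (real ^ 2 \<Rightarrow> real ^ 3) \<Rightarrow> bool" where
  "regular_parametrization S V X \<longleftrightarrow>
     open V \<and> smooth_on V X \<and> inj_on X V \<and> X ` V \<subseteq> S \<and> (\<forall>z\<in>V. det (metric X z) \<noteq> 0)"

definition chart_laplacian ::
    "(real ^ 2 \<Rightarrow> real ^ 3) \<Rightarrow> (real ^ 2 \<Rightarrow> complex) \<Rightarrow> real ^ 2 \<Rightarrow> complex" where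
  "chart_laplacian X f z = (1 / sqrt (det (metric X z))) *\<^sub>R
     (\<Sum>i\<in>UNIV. partial i
        (\<lambda>x. sqrt (det (metric X x)) *\<^sub>R
           (\<Sum>j\<in>UNIV. (matrix_inv (metric X x) $ i $ j) *\<^sub>R partial j f x)) z)"

text \<open>The equation \<open>\<Delta>\<^sub>g u = F\<close> on \<open>S\<close>. The chart expression does not depend on the chart, so
  asking for it in all charts is the same as asking for it in one chart around each point.\<close>

definition laplace_beltrami_eq ::
    "(real ^ 3) set \<Rightarrow> (real ^ 3 \<Rightarrow> complex) \<Rightarrow> (real ^ 3 \<Rightarrow> complex) \<Rightarrow> bool" where
  "laplace_beltrami_eq S u F \<longleftrightarrow>
     (\<forall>V X. regular_parametrization S V X \<longrightarrow>
        (\<forall>z\<in>V. chart_laplacian X (u \<circ> X) z = F (X z)))"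

text \<open>\<open>L\<^sup>2\<close> norm with respect to the Riemannian area, for a parametrization \<open>X\<close> of the
  surface on \<open>V\<close> whose image omits only a set of area zero.\<close>

definition L2_norm_param ::
    "(real ^ 2) set \<Rightarrow> (real ^ 2 \<Rightarrow> real ^ 3) \<Rightarrow> (real ^ 3 \<Rightarrow> complex) \<Rightarrow> real" where
  "L2_norm_param V X u =
     sqrt (LINT z:V|lborel. (cmod (u (X z)))\<^sup>2 * sqrt (det (metric X z)))"

text \<open>Used for continuous functions on a compact surface only, where it is the
  \<open>L\<^sup>\<infinity>\<close> norm.\<close>

definition sup_norm_on :: "(real ^ 3) set \<Rightarrow> (real ^ 3 \<Rightarrow> complex) \<Rightarrow> real" where
  "sup_norm_on S u = (SUP p\<in>S. cmod (u p))"

section \<open>The ellipsoid\<close>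

definition ellipsoid :: "real ^ 3 \<Rightarrow> (real ^ 3) set" where
  "ellipsoid \<alpha> = {w. (\<Sum>j\<in>UNIV. (w $ j)\<^sup>2 / (\<alpha> $ j)\<^sup>2) = 1}"

text \<open>For a level set \<open>G = 1\<close> the second fundamental form is, up to sign, the restriction of
  the Hessian of \<open>G\<close> to the tangent plane divided by the length of the gradient of \<open>G\<close>. For
  \<open>G w = (\<Sum>j. w\<^sub>j\<^sup>2 / \<alpha>\<^sub>j\<^sup>2)\<close> the factors 2 of Hessian and gradient cancel. A point is
  umbilic if the second fundamental form there is a multiple of the metric.\<close>

definition ellipsoid_normal :: "real ^ 3 \<Rightarrow> real ^ 3 \<Rightarrow> real ^ 3" where
  "ellipsoid_normal \<alpha> p = (\<chi> j. p $ j / (\<alpha> $ j)\<^sup>2)"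

definition ellipsoid_second_form :: "real ^ 3 \<Rightarrow> real ^ 3 \<Rightarrow> real ^ 3 \<Rightarrow> real ^ 3 \<Rightarrow> real" where
  "ellipsoid_second_form \<alpha> p v w =
     (\<Sum>j\<in>UNIV. v $ j * w $ j / (\<alpha> $ j)\<^sup>2) / norm (ellipsoid_normal \<alpha> p)"

definition umbilic_points :: "real ^ 3 \<Rightarrow> (real ^ 3) set" where
  "umbilic_points \<alpha> = {p \<in> ellipsoid \<alpha>. \<exists>k. \<forall>v w.
     v \<bullet> ellipsoid_normal \<alpha> p = 0 \<longrightarrow> w \<bullet> ellipsoid_normal \<alpha> p = 0 \<longrightarrow>
     ellipsoid_second_form \<alpha> p v w = k * (v \<bullet> w)}"

section \<open>Liouville coordinates and the quantum integrable system\<close>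

definition rect_pos :: "real \<Rightarrow> real \<Rightarrow> (real ^ 2) set" where
  "rect_pos T1 T2 = {z. 0 < z $ 1 \<and> z $ 1 < T1 \<and> 0 < z $ 2 \<and> z $ 2 < T2}"

definition rect_neg :: "real \<Rightarrow> real \<Rightarrow> (real ^ 2) set" where
  "rect_neg T1 T2 = {z. T1 < z $ 1 \<and> z $ 1 < 2 * T1 \<and> 0 < z $ 2 \<and> z $ 2 < T2}"

definition lattice :: "real \<Rightarrow> real \<Rightarrow> (real ^ 2) set" where
  "lattice L1 L2 = {z. \<exists>k l :: int. z = vector [of_int k * L1, of_int l * L2]}"

text \<open>\<open>\<Phi>\<close> is the lift to the plane of the branched double covering
  \<open>T \<rightarrow> T/\<sigma> \<cong> ellipsoid \<alpha>\<close>, where \<open>T\<close> is the torus with period lattice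
  \<open>lattice (2 * T1) (2 * T2)\<close> and \<open>\<sigma> z = - z\<close>. The fixed points of \<open>\<sigma>\<close> lift to
  \<open>lattice T1 T2\<close>; the metric vanishes there in these coordinates. Elsewhere \<open>\<Phi>\<close> is a local
  conformal diffeomorphism by \<open>liouville_metric\<close> and \<open>liouville_pos\<close>; on the two
  rectangles it is injective by \<open>fibres\<close>.

  Such data exist: writing \<open>\<alpha> $ i = \<alpha>\<^sub>i\<close>, put
  \<open>\<lambda> = \<alpha>\<^sub>2\<^sup>2 cos\<^sup>2 s + \<alpha>\<^sub>1\<^sup>2 sin\<^sup>2 s\<close>,
  \<open>\<mu> = \<alpha>\<^sub>2\<^sup>2 cos\<^sup>2 t + \<alpha>\<^sub>3\<^sup>2 sin\<^sup>2 t\<close> and \<open>d = \<alpha>\<^sub>1\<^sup>2 - \<alpha>\<^sub>3\<^sup>2\<close>. Then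
  \<open>(\<alpha>\<^sub>1 cos s sqrt ((\<alpha>\<^sub>1\<^sup>2 - \<mu>) / d), \<alpha>\<^sub>2 sin s sin t, \<alpha>\<^sub>3 cos t sqrt ((\<lambda> - \<alpha>\<^sub>3\<^sup>2) / d))\<close>
  parametrizes the ellipsoid, and the coordinates with
  \<open>dx\<^sub>1 = sqrt (\<lambda> / (\<lambda> - \<alpha>\<^sub>3\<^sup>2)) ds\<close>, \<open>dx\<^sub>2 = sqrt (\<mu> / (\<alpha>\<^sub>1\<^sup>2 - \<mu>)) dt\<close>
  vanishing at \<open>s = 0\<close> and \<open>t = 0\<close> satisfy the axioms with \<open>a = \<lambda> - \<alpha>\<^sub>2\<^sup>2\<close>, \<open>b = \<alpha>\<^sub>2\<^sup>2 - \<mu>\<close>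
  and \<open>T1\<close>, \<open>T2\<close> the values of \<open>x\<^sub>1\<close>, \<open>x\<^sub>2\<close> at \<open>s = pi\<close>, \<open>t = pi\<close>.\<close>

locale liouville_coordinates =
  fixes \<alpha> :: "real ^ 3"
    and T1 T2 :: real
    and \<Phi> :: "real ^ 2 \<Rightarrow> real ^ 3"
    and a b :: "real \<Rightarrow> real"
  assumes T1_pos: "0 < T1" and T2_pos: "0 < T2"
    and smooth: "smooth_on UNIV \<Phi>"
    and surj: "range \<Phi> = ellipsoid \<alpha>"
    and fibres: "\<And>z z'. \<Phi> z = \<Phi> z' \<longleftrightarrow>
      z' - z \<in> lattice (2 * T1) (2 * T2) \<or> z' + z \<in> lattice (2 * T1) (2 * T2)"
    and image_rect_pos: "\<Phi> ` rect_pos T1 T2 = ellipsoid \<alpha> \<inter> {w. w $ 2 > 0}"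
    and image_rect_neg: "\<Phi> ` rect_neg T1 T2 = ellipsoid \<alpha> \<inter> {w. w $ 2 < 0}"
    and image_lattice: "\<Phi> ` lattice T1 T2 = umbilic_points \<alpha>"
    and liouville_metric: "\<And>z. metric \<Phi> z = mat (a (z $ 1) + b (z $ 2))"
    and liouville_pos: "\<And>z. z \<notin> lattice T1 T2 \<Longrightarrow> 0 < a (z $ 1) + b (z $ 2)"
    and a_analytic: "real_analytic a" and b_analytic: "real_analytic b"
    and a_zero: "\<And>k::int. a (of_int k * T1) = 0"
    and a_deriv: "\<And>k::int. deriv a (of_int k * T1) = 0"
    and a_deriv2: "\<And>k::int. deriv (deriv a) (of_int k * T1) \<noteq> 0"
    and b_zero: "\<And>k::int. b (of_int k * T2) = 0"
    and b_deriv: "\<And>k::int. deriv b (of_int k * T2) = 0"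
    and b_deriv2: "\<And>k::int. deriv (deriv b) (of_int k * T2) \<noteq> 0"

text \<open>\<open>P\<^sub>1(h) u = 0\<close> for \<open>P\<^sub>1(h) = - h\<^sup>2 \<Delta>\<^sub>g - 1\<close>: the function \<open>w = \<Delta>\<^sub>g u\<close> satisfies
  \<open>- h\<^sup>2 w - u = 0\<close>.\<close>

definition P1_eq_zero :: "real ^ 3 \<Rightarrow> real \<Rightarrow> (real ^ 3 \<Rightarrow> complex) \<Rightarrow> bool" where
  "P1_eq_zero \<alpha> h u \<longleftrightarrow>
     (\<exists>w. laplace_beltrami_eq (ellipsoid \<alpha>) u w \<and>
          (\<forall>p\<in>ellipsoid \<alpha>. - (h\<^sup>2 *\<^sub>R w p) - u p = 0))"

text \<open>\<open>P\<^sub>2(h)\<close> in the Liouville coordinates, away from \<open>lattice T1 T2\<close>.\<close>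

definition P2 ::
    "(real \<Rightarrow> real) \<Rightarrow> (real \<Rightarrow> real) \<Rightarrow> real \<Rightarrow> (real ^ 2 \<Rightarrow> complex) \<Rightarrow> real ^ 2 \<Rightarrow> complex" where
  "P2 a b h f z = - (inverse (a (z $ 1) + b (z $ 2)) *\<^sub>R
     (b (z $ 2) *\<^sub>R (h\<^sup>2 *\<^sub>R partial 1 (partial 1 f) z)
      - a (z $ 1) *\<^sub>R (h\<^sup>2 *\<^sub>R partial 2 (partial 2 f) z)))"

definition joint_eigenfunction ::
    "real ^ 3 \<Rightarrow> real \<Rightarrow> real \<Rightarrow> (real ^ 2 \<Rightarrow> real ^ 3) \<Rightarrow> (real \<Rightarrow> real) \<Rightarrow> (real \<Rightarrow> real) \<Rightarrow>
     real \<Rightarrow> real \<Rightarrow> (real ^ 3 \<Rightarrow> complex) \<Rightarrow> bool" where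
  "joint_eigenfunction \<alpha> T1 T2 \<Phi> a b h E u \<longleftrightarrow>
     smooth_on_subset (ellipsoid \<alpha>) u \<and>
     P1_eq_zero \<alpha> h u \<and>
     (\<forall>z. z \<notin> lattice T1 T2 \<longrightarrow> P2 a b h (u \<circ> \<Phi>) z = E *\<^sub>R u (\<Phi> z))"

text \<open>\<open>\<Phi>\<close> maps the union of the two rectangles bijectively onto the ellipsoid minus the
  curve \<open>w $ 2 = 0\<close>.\<close>

definition L2_normalized ::
    "real \<Rightarrow> real \<Rightarrow> (real ^ 2 \<Rightarrow> real ^ 3) \<Rightarrow> (real ^ 3 \<Rightarrow> complex) \<Rightarrow> bool" where
  "L2_normalized T1 T2 \<Phi> u \<longleftrightarrow> L2_norm_param (rect_pos T1 T2 \<union> rect_neg T1 T2) \<Phi> u = 1"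

end

theory Submission
  imports Defs "HOL-Real_Asymp.Real_Asymp"
begin

text \<open>In the Liouville coordinates the two eigenvalue equations decouple: on the torus,
  \<open>f = u \<circ> \<Phi>\<close> solves \<open>- h\<^sup>2 \<partial>\<^sub>1\<^sup>2 f = (a + E) f\<close> and \<open>- h\<^sup>2 \<partial>\<^sub>2\<^sup>2 f = (b - E) f\<close>. By symmetry
  let \<open>E \<ge> 0\<close>. If \<open>E \<ge> h powr (1/8)\<close>, elementary energy estimates for the two ordinary
  differential equations give more than is needed. If \<open>E \<le> h powr (1/8)\<close>, the action
  \<open>(h\<^sup>2 w'\<^sup>2 + q w\<^sup>2) / sqrt q\<close> of a solution of \<open>h\<^sup>2 w'' + q w = 0\<close> is an adiabatic invariant outside
  a neighbourhood of the zeros of the potential. For \<open>q = a + E\<close> it bounds \<open>w\<^sup>2\<close> by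
  \<open>h powr (-1/2)\<close> times the action, while the action times \<open>log (1/h)\<close> is bounded by \<open>\<integral> w\<^sup>2\<close>, because
  \<open>w\<^sup>2\<close> averages to the action over \<open>x\<close> at distance \<open>x \<ge> h powr (1/16)\<close> from a zero: this is
  where the logarithm comes from. For \<open>q = b - E\<close> one gets \<open>w\<^sup>2 \<le> C h powr (-1/2) \<integral> b w\<^sup>2\<close>. The product
  of the two estimates is the bound on \<open>f\<^sup>2\<close> by \<open>\<integral>\<integral> (a + b) f\<^sup>2\<close>.\<close>

section \<open>The adiabatic invariant\<close>

text \<open>The action is adiabatic only where \<open>h q'\<close> is small against
  \<open>q sqrt q\<close>. This fails near a zero of \<open>a\<close> once \<open>E\<close> is below
  the order of \<open>h\<close>, and near every turning point of \<open>b - E\<close>. On the short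
  interval that is left the energy \<open>h\<^sup>2 w'\<^sup>2 + q w\<^sup>2\<close> takes over: it
  is monotone because \<open>q\<close> grows away from the zero. At the edge of that interval
  \<open>q\<close> is still at least of order \<open>h\<close>, and dividing the action by
  \<open>sqrt q\<close> there is what costs \<open>h powr (-1/2)\<close>. No Airy or Hermite
  functions and no WKB asymptotics enter. The function \<open>f\<close> need not be a product. The
  estimate in the second variable is applied to the section \<open>f x\<close> with \<open>x\<close>
  fixed; it produces an integral over \<open>y\<close>, and the estimate in the first variable is
  applied for each \<open>y\<close> under that integral. The bound \<open>h powr (1/8)\<close> on
  small energies is a compromise: a positive exponent leaves a range of \<open>x\<close> over which
  \<open>1 / x\<close> integrates to a multiple of \<open>log (1/h)\<close>, and a small one keeps
  the cruder losses for larger energies below \<open>1 / h\<close>.\<close>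

definition schroedinger :: "real \<Rightarrow> (real \<Rightarrow> real) \<Rightarrow> (real \<Rightarrow> real) \<Rightarrow> (real \<Rightarrow> real) \<Rightarrow> bool" where
  "schroedinger h q w w1 \<longleftrightarrow>
     (\<forall>x. (w has_real_derivative w1 x) (at x)) \<and>
     (\<forall>x. (w1 has_real_derivative - (q x / h\<^sup>2) * w x) (at x))"

lemma schroedingerD:
  assumes "schroedinger h q w w1"
  shows "(w has_real_derivative w1 x) (at x)"
    and "(w1 has_real_derivative - (q x / h\<^sup>2) * w x) (at x)"
  using assms by (auto simp: schroedinger_def)

lemma schroedinger_continuous:
  assumes "schroedinger h q w w1"
  shows "continuous_on A w" "continuous_on A w1"
  using schroedingerD[OF assms] by (meson DERIV_isCont continuous_at_imp_continuous_on)+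

definition energy :: "real \<Rightarrow> (real \<Rightarrow> real) \<Rightarrow> (real \<Rightarrow> real) \<Rightarrow> (real \<Rightarrow> real) \<Rightarrow> real \<Rightarrow> real" where
  "energy h q w w1 x = h\<^sup>2 * (w1 x)\<^sup>2 + q x * (w x)\<^sup>2"

text \<open>The terms in \<open>w * w1\<close> cancel by the equation. What is left has the sign of
  \<open>q1\<close>, so the energy is monotone wherever \<open>q\<close> is, even across points
  where \<open>q\<close> vanishes and the action is undefined.\<close>

lemma energy_deriv:
  assumes "schroedinger h q w w1" "h > 0" "(q has_real_derivative q1) (at x)"
  shows "(energy h q w w1 has_real_derivative q1 * (w x)\<^sup>2) (at x)"
  unfolding energy_def[abs_def]
  by (rule derivative_eq_intros schroedingerD[OF assms(1)] assms refl)+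
     (use assms(2) in \<open>simp add: field_simps power2_eq_square\<close>)

lemma energy_mono:
  assumes "schroedinger h q w w1" "h > 0" "\<And>x. (q has_real_derivative q1 x) (at x)"
    and "x \<le> y" "\<And>t. x \<le> t \<Longrightarrow> t \<le> y \<Longrightarrow> q1 t \<ge> 0"
  shows "energy h q w w1 x \<le> energy h q w w1 y"
  by (rule DERIV_nonneg_imp_nondecreasing[OF assms(4)])
     (use energy_deriv[OF assms(1,2,3)] assms(5) in \<open>auto intro!: exI\<close>)

text \<open>\<open>g + f\<close> and \<open>g - f\<close> both decrease, so the variation of
  \<open>f\<close> is bounded by that of the majorant without an integral.\<close>

lemma monotone_of_le_deriv:
  fixes f g :: "real \<Rightarrow> real"
  assumes "s \<le> y" "y \<le> H"
    and "\<And>x. s \<le> x \<Longrightarrow> x \<le> H \<Longrightarrow> (f has_real_derivative f' x) (at x)"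
    and "\<And>x. s \<le> x \<Longrightarrow> x \<le> H \<Longrightarrow> (g has_real_derivative g' x) (at x)"
    and "\<And>x. s \<le> x \<Longrightarrow> x \<le> H \<Longrightarrow> \<bar>f' x\<bar> \<le> - g' x"
  shows "\<bar>f y - f H\<bar> \<le> g y - g H"
proof -
  have "f y + g y \<ge> f H + g H"
  proof (rule DERIV_nonpos_imp_nonincreasing[OF assms(2)])
    fix x assume x: "y \<le> x" "x \<le> H"
    with assms(1) have "s \<le> x" by simp
    then show "\<exists>d. ((\<lambda>x. f x + g x) has_real_derivative d) (at x) \<and> d \<le> 0"
      using assms(3,4)[of x] assms(5)[of x] x
      by (intro exI[of _ "f' x + g' x"]) (auto intro!: derivative_eq_intros)
  qed
  moreover have "g y - f y \<ge> g H - f H"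
  proof (rule DERIV_nonpos_imp_nonincreasing[OF assms(2)])
    fix x assume x: "y \<le> x" "x \<le> H"
    with assms(1) have "s \<le> x" by simp
    then show "\<exists>d. ((\<lambda>x. g x - f x) has_real_derivative d) (at x) \<and> d \<le> 0"
      using assms(3,4)[of x] assms(5)[of x] x
      by (intro exI[of _ "g' x - f' x"]) (auto intro!: derivative_eq_intros)
  qed
  ultimately show ?thesis by linarith
qed

text \<open>The differentiated function, called the phase function below, is
  \<open>- (1 / sqrt q)'\<close>. Times \<open>h\<close> it is the relative change of the frequency
  \<open>sqrt q / h\<close> per radian of oscillation, the quantity that must be small for
  adiabaticity.\<close>

lemma phase_deriv:
  fixes q :: "real \<Rightarrow> real"
  assumes q1: "(q has_real_derivative q1 x) (at x)" and q2: "(q1 has_real_derivative q2) (at x)"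
    and pos: "q x > 0"
  shows "((\<lambda>x. q1 x / (2 * (q x * sqrt (q x)))) has_real_derivative
    q2 / (2 * (q x * sqrt (q x))) - 3 * (q1 x)\<^sup>2 / (4 * ((q x)\<^sup>2 * sqrt (q x)))) (at x)"
proof -
  define r where "r = sqrt (q x)"
  have r: "r > 0" "q x = r * r" using pos by (auto simp: r_def)
  have dsq: "((\<lambda>x. sqrt (q x)) has_real_derivative q1 x / (2 * sqrt (q x))) (at x)"
    using pos by (auto intro!: derivative_eq_intros q1 simp: field_simps)
  have "((\<lambda>x. q1 x / (2 * (q x * sqrt (q x)))) has_real_derivative
    (q2 * (2 * (q x * sqrt (q x))) - q1 x * (2 * (q1 x * sqrt (q x) + (q1 x / (2 * sqrt (q x))) * q x)))
      / ((2 * (q x * sqrt (q x))) * (2 * (q x * sqrt (q x))))) (at x)"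
    by (rule DERIV_divide[OF q2 DERIV_cmult[OF DERIV_mult[OF q1 dsq]]]) (use pos in auto)
  moreover have "(q2 * (2 * (q x * sqrt (q x))) - q1 x * (2 * (q1 x * sqrt (q x) + (q1 x / (2 * sqrt (q x))) * q x)))
      / ((2 * (q x * sqrt (q x))) * (2 * (q x * sqrt (q x)))) =
      q2 / (2 * (q x * sqrt (q x))) - 3 * (q1 x)\<^sup>2 / (4 * ((q x)\<^sup>2 * sqrt (q x)))"
    unfolding r_def[symmetric] using r by (simp add: field_simps power2_eq_square)
  ultimately show ?thesis by (simp only:)
qed

definition action :: "real \<Rightarrow> (real \<Rightarrow> real) \<Rightarrow> (real \<Rightarrow> real) \<Rightarrow> (real \<Rightarrow> real) \<Rightarrow> real \<Rightarrow> real" where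
  "action h q w w1 x = energy h q w w1 x / sqrt (q x)"

abbreviation comparable_actions where
  "comparable_actions h q w w1 x y \<equiv>
     action h q w w1 x \<le> 2 * action h q w w1 y \<and> action h q w w1 y \<le> 2 * action h q w w1 x"

text \<open>Arithmetic-geometric mean for \<open>h * w1\<close> and \<open>sqrt q * w\<close>. It
  makes the oscillating correction to the action, a small multiple of this product, small against
  the action itself.\<close>

lemma action_bound_product:
  assumes "q x > 0"
  shows "\<bar>h * (w x * w1 x)\<bar> \<le> action h q w w1 x / 2"
proof -
  define r where "r = sqrt (q x)"
  have r: "r > 0" "q x = r\<^sup>2" using assms by (auto simp: r_def)
  have "2 * (r * \<bar>h * (w x * w1 x)\<bar>) \<le> h\<^sup>2 * (w1 x)\<^sup>2 + r\<^sup>2 * (w x)\<^sup>2"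
    using sum_squares_bound[of "\<bar>h * w1 x\<bar>" "\<bar>r * w x\<bar>"] r
    by (simp add: abs_mult power_mult_distrib mult_ac)
  then show ?thesis using r
    by (simp add: action_def energy_def r_def[symmetric] field_simps)
qed

lemma action_nonneg:
  assumes "q x > 0" shows "0 \<le> action h q w w1 x"
  using assms by (simp add: action_def energy_def)

lemma square_le_action:
  assumes "q x > 0" shows "(w x)\<^sup>2 \<le> action h q w w1 x / sqrt (q x)"
  using assms by (simp add: action_def energy_def field_simps)

text \<open>All errors are bounded by multiples of the maximum \<open>S\<close> of the action on
  \<open>{s..H}\<close>, which replaces a Gronwall argument. \<open>G\<close> is a decreasing
  majorant for the variation of the phase function. It is left open because above the barrier an
  explicit power serves, while below it the phase function itself, plus a linear term, is
  used.\<close>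

lemma action_adiabatic:
  assumes ode: "schroedinger h q w w1" and h: "h > 0" and sH: "s \<le> H"
    and q1: "\<And>x. (q has_real_derivative q1 x) (at x)"
    and q2: "\<And>x. (q1 has_real_derivative q2 x) (at x)"
    and pos: "\<And>x. s \<le> x \<Longrightarrow> x \<le> H \<Longrightarrow> q x > 0"
    and g: "\<And>x. s \<le> x \<Longrightarrow> x \<le> H \<Longrightarrow> h * \<bar>q1 x / (2 * (q x * sqrt (q x)))\<bar> \<le> 1/6"
    and G: "\<And>x. s \<le> x \<Longrightarrow> x \<le> H \<Longrightarrow> (G has_real_derivative G' x) (at x)"
    and g1: "\<And>x. s \<le> x \<Longrightarrow> x \<le> H \<Longrightarrow>
       \<bar>q2 x / (2 * (q x * sqrt (q x))) - 3 * (q1 x)\<^sup>2 / (4 * ((q x)\<^sup>2 * sqrt (q x)))\<bar> \<le> - G' x"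
    and var: "h * (G s - G H) \<le> 1/6"
    and y: "s \<le> y" "y \<le> H"
  shows "comparable_actions h q w w1 y H"
proof -
  define Q where "Q = action h q w w1"
  define g where "g = (\<lambda>x. q1 x / (2 * (q x * sqrt (q x))))"
  define g1 where "g1 = (\<lambda>x. q2 x / (2 * (q x * sqrt (q x))) - 3 * (q1 x)\<^sup>2 / (4 * ((q x)\<^sup>2 * sqrt (q x))))"
  \<comment> \<open>\<open>Q' = - h\<^sup>2 g (w w1)'\<close> oscillates; adding \<open>h\<^sup>2 g w w1\<close> leaves the small derivative \<open>h\<^sup>2 g' w w1\<close>.\<close>
  define Z where "Z = (\<lambda>x. Q x + h\<^sup>2 * g x * (w x * w1 x))"
  have dsq: "((\<lambda>x. sqrt (q x)) has_real_derivative q1 x / (2 * sqrt (q x))) (at x)"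
    if "s \<le> x" "x \<le> H" for x
    using pos[OF that] by (auto intro!: derivative_eq_intros q1 simp: field_simps)
  have dQ: "(Q has_real_derivative
       (q1 x * (w x)\<^sup>2) / sqrt (q x) - energy h q w w1 x * q1 x / (2 * (q x * sqrt (q x)))) (at x)"
    if "s \<le> x" "x \<le> H" for x
  proof -
    have "(Q has_real_derivative
       ((q1 x * (w x)\<^sup>2) * sqrt (q x) - energy h q w w1 x * (q1 x / (2 * sqrt (q x)))) / (sqrt (q x) * sqrt (q x))) (at x)"
      unfolding Q_def action_def[abs_def]
      by (rule DERIV_divide[OF energy_deriv[OF ode h q1] dsq[OF that]]) (use pos[OF that] in auto)
    moreover have "((q1 x * (w x)\<^sup>2) * sqrt (q x) - energy h q w w1 x * (q1 x / (2 * sqrt (q x)))) / (sqrt (q x) * sqrt (q x))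
      = (q1 x * (w x)\<^sup>2) / sqrt (q x) - energy h q w w1 x * q1 x / (2 * (q x * sqrt (q x)))"
    proof -
      define r where "r = sqrt (q x)"
      have "r > 0" "q x = r * r" using pos[OF that] by (auto simp: r_def)
      then show ?thesis unfolding r_def[symmetric] by (simp add: field_simps)
    qed
    ultimately show ?thesis by simp
  qed
  have dg: "(g has_real_derivative g1 x) (at x)" if "s \<le> x" "x \<le> H" for x
    unfolding g_def g1_def by (rule phase_deriv[OF q1 q2 pos[OF that]])
  have dZ: "(Z has_real_derivative h\<^sup>2 * g1 x * (w x * w1 x)) (at x)" if "s \<le> x" "x \<le> H" for x
  proof -
    define r where "r = sqrt (q x)"
    have r: "r > 0" "q x = r * r" using pos[OF that] by (auto simp: r_def)
    have "(Z has_real_derivative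
        ((q1 x * (w x)\<^sup>2) / sqrt (q x) - energy h q w w1 x * q1 x / (2 * (q x * sqrt (q x))))
        + (h\<^sup>2 * g1 x * (w x * w1 x) + (w1 x * w1 x + (- (q x / h\<^sup>2) * w x) * w x) * (h\<^sup>2 * g x))) (at x)"
      unfolding Z_def
      by (rule DERIV_add[OF dQ[OF that] DERIV_mult[OF DERIV_cmult[OF dg[OF that]]
            DERIV_mult[OF schroedingerD[OF ode]]]])
    moreover have "((q1 x * (w x)\<^sup>2) / sqrt (q x) - energy h q w w1 x * q1 x / (2 * (q x * sqrt (q x))))
        + (h\<^sup>2 * g1 x * (w x * w1 x) + (w1 x * w1 x + (- (q x / h\<^sup>2) * w x) * w x) * (h\<^sup>2 * g x))
        = h\<^sup>2 * g1 x * (w x * w1 x)"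
      unfolding g_def r_def[symmetric] energy_def using r h
      by (simp add: field_simps power2_eq_square)
    ultimately show ?thesis by (simp only:)
  qed
  have "continuous_on {s..H} Q"
    using dQ by (auto intro!: continuous_at_imp_continuous_on DERIV_isCont)
  then obtain m where m: "s \<le> m" "m \<le> H" "\<And>x. s \<le> x \<Longrightarrow> x \<le> H \<Longrightarrow> Q x \<le> Q m"
    using continuous_attains_sup[of "{s..H}" Q] sH by auto
  define S where "S = Q m"
  have Qpos: "0 \<le> Q x" if "s \<le> x" "x \<le> H" for x
    using action_nonneg[of q x h w w1, OF pos[OF that]] by (simp add: Q_def)
  have S0: "S \<ge> 0" using Qpos m by (simp add: S_def)
  have rho: "\<bar>h * (w x * w1 x)\<bar> \<le> S / 2" if "s \<le> x" "x \<le> H" for x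
    using action_bound_product[of q x h w w1, OF pos[OF that]] m(3)[OF that] by (simp add: Q_def S_def)
  have QZ: "\<bar>Q x - Z x\<bar> \<le> S / 12" if "s \<le> x" "x \<le> H" for x
  proof -
    have "\<bar>Q x - Z x\<bar> = (h * \<bar>g x\<bar>) * \<bar>h * (w x * w1 x)\<bar>"
      using h by (simp add: Z_def abs_mult power2_eq_square)
    also have "\<dots> \<le> (1/6) * (S/2)"
      using g[OF that] rho[OF that] h by (intro mult_mono) (auto simp: g_def)
    finally show ?thesis by simp
  qed
  have ZZ: "\<bar>Z x - Z H\<bar> \<le> S / 12" if "s \<le> x" "x \<le> H" for x
  proof -
    have G': "((\<lambda>x. (h * S / 2) * G x) has_real_derivative (h * S / 2) * G' x) (at x)"
      if "s \<le> x" "x \<le> H" for x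
      using G[OF that] by (auto intro!: derivative_eq_intros)
    have bd: "\<bar>h\<^sup>2 * g1 x * (w x * w1 x)\<bar> \<le> - ((h * S / 2) * G' x)" if "s \<le> x" "x \<le> H" for x
    proof -
      have "\<bar>h\<^sup>2 * g1 x * (w x * w1 x)\<bar> = h * (\<bar>g1 x\<bar> * \<bar>h * (w x * w1 x)\<bar>)"
        using h by (simp add: abs_mult power2_eq_square)
      also have "\<dots> \<le> h * ((- G' x) * (S / 2))"
        using g1[OF that] rho[OF that] h by (intro mult_left_mono mult_mono) (auto simp: g1_def)
      finally show ?thesis by (simp add: mult_ac)
    qed
    have *: "\<bar>Z z - Z H\<bar> \<le> (h * S / 2) * G z - (h * S / 2) * G H" if "s \<le> z" "z \<le> H" for z
      by (rule monotone_of_le_deriv[OF that dZ G' bd])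
    have "G x \<le> G s"
    proof (rule DERIV_nonpos_imp_nonincreasing[OF \<open>s \<le> x\<close>])
      fix t assume "s \<le> t" "t \<le> x"
      then show "\<exists>d. (G has_real_derivative d) (at t) \<and> d \<le> 0"
        using G[of t] g1[of t] that by (intro exI[of _ "G' t"]) auto
    qed
    then have "h * (G x - G H) \<le> 1/6" using var h
      by (smt (verit) mult_left_mono)
    then have "(S / 2) * (h * (G x - G H)) \<le> (S / 2) * (1/6)" using S0 by (intro mult_left_mono) auto
    then show ?thesis using *[OF that] by (simp add: algebra_simps)
  qed
  \<comment> \<open>Replacing \<open>Q\<close> by \<open>Z\<close> at both ends and the variation of
    \<open>Z\<close> cost \<open>S / 12\<close> each, which is what the two bounds by 1/6 are made
    for. The total \<open>S / 4\<close> gives \<open>S \<le> 4/3 * Q H\<close>, well within the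
    factor 2.\<close>
  have QQ: "\<bar>Q x - Q H\<bar> \<le> S / 4" if "s \<le> x" "x \<le> H" for x
    using QZ[OF that] QZ[of H] ZZ[OF that] sH by linarith
  have "S \<le> 4 / 3 * Q H" using QQ[OF m(1,2)] unfolding S_def by linarith
  then have "\<bar>Q y - Q H\<bar> \<le> Q H / 3" using QQ[OF y] by linarith
  then show ?thesis
    using Qpos[of H] sH unfolding Q_def by linarith+
qed

section \<open>Solutions near a nondegenerate zero of the potential\<close>

text \<open>Squared, because energies bound the square of the derivative. It carries a bound for a
  solution over a short interval on which the action gives none.\<close>

lemma mvt_square_bound:
  fixes v v1 :: "real \<Rightarrow> real"
  assumes "\<And>x. (v has_real_derivative v1 x) (at x)" "x \<le> y"
    and "\<And>t. x \<le> t \<Longrightarrow> t \<le> y \<Longrightarrow> (v1 t)\<^sup>2 \<le> B"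
  shows "(v x - v y)\<^sup>2 \<le> (y - x)\<^sup>2 * B"
proof (cases "x = y")
  case False
  with assms(2) have "x < y" by simp
  from MVT2[OF this assms(1)] obtain z where z: "x < z" "z < y" "v y - v x = (y - x) * v1 z" by blast
  have "(v x - v y)\<^sup>2 = (v y - v x)\<^sup>2" by (rule power2_commute)
  also have "\<dots> = (y - x)\<^sup>2 * (v1 z)\<^sup>2" by (simp add: z(3) power_mult_distrib)
  also have "\<dots> \<le> (y - x)\<^sup>2 * B" using z assms(3)[of z] by (intro mult_left_mono) auto
  finally show ?thesis .
qed simp

lemma square_le_twice: "(x::real)\<^sup>2 \<le> 2 * (x - y)\<^sup>2 + 2 * y\<^sup>2"
  using sum_squares_bound[of "x - y" y] by (simp add: power2_eq_square algebra_simps)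

lemma inverse_square_deriv:
  fixes x e K :: real
  assumes "x + e > 0"
  shows "((\<lambda>x. K / (2 * (x + e)\<^sup>2)) has_real_derivative - (K / (x + e)^3)) (at x)"
proof -
  have "((\<lambda>x. K / (2 * (x + e)\<^sup>2)) has_real_derivative
      (0 * (2 * (x + e)\<^sup>2) - K * (2 * (2 * (x + e)))) / ((2 * (x + e)\<^sup>2) * (2 * (x + e)\<^sup>2))) (at x)"
    by (rule DERIV_divide) (use assms in \<open>auto intro!: derivative_eq_intros\<close>)
  moreover have "(0 * (2 * y\<^sup>2) - K * (2 * (2 * y))) / ((2 * y\<^sup>2) * (2 * y\<^sup>2)) = - (K / y^3)"
    if "y > 0" for y :: real
    using that by (simp add: field_simps eval_nat_numeral)
  ultimately show ?thesis using assms by (simp only:)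
qed

text \<open>Everything except \<open>C\<close> and \<open>h\<close> is quantified inside, so that an
  eventual statement in \<open>h\<close> gives a threshold that is uniform in \<open>E\<close>, the
  point and the solution.\<close>

abbreviation log_sup_bound where
  "log_sup_bound a L C h \<equiv>
     \<forall>E x w w1. 0 \<le> E \<longrightarrow> E \<le> h powr (1/8) \<longrightarrow> 0 \<le> x \<longrightarrow> x \<le> L \<longrightarrow> schroedinger h (\<lambda>x. a x + E) w w1 \<longrightarrow>
     (w x)\<^sup>2 * (sqrt h * ln (1/h)) \<le> C * integral {0..L} (\<lambda>x. (w x)\<^sup>2)"

text \<open>A half well has no boundary condition that would turn kinetic into potential mass, so
  the right side keeps \<open>h\<^sup>2 * (w1 x)\<^sup>2\<close>, and only classically allowed
  points are covered. Periodicity removes both restrictions later.\<close>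

abbreviation half_sup_bound where
  "half_sup_bound a L C h \<equiv>
     \<forall>E x w w1. 0 \<le> E \<longrightarrow> E \<le> h powr (1/8) \<longrightarrow> 0 \<le> x \<longrightarrow> x \<le> L \<longrightarrow> E \<le> a x \<longrightarrow>
     schroedinger h (\<lambda>x. a x - E) w w1 \<longrightarrow>
     (w x)\<^sup>2 * sqrt h \<le> C * integral {0..L} (\<lambda>x. a x * (w x)\<^sup>2 + h\<^sup>2 * (w1 x)\<^sup>2)"

abbreviation periodic_sup_bound where
  "periodic_sup_bound a L C h \<equiv>
     \<forall>E x w w1. 0 \<le> E \<longrightarrow> E \<le> h powr (1/8) \<longrightarrow> 0 \<le> x \<longrightarrow> x \<le> L \<longrightarrow> schroedinger h (\<lambda>x. a x - E) w w1 \<longrightarrow>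
     (\<forall>x. w (x + L) = w x) \<longrightarrow> (w x)\<^sup>2 * sqrt h \<le> C * integral {0..L} (\<lambda>x. a x * (w x)\<^sup>2)"

text \<open>The last assumption makes \<open>q' / (q sqrt q)\<close> decreasing on \<open>{0..d}\<close> for \<open>q = a - E\<close>, \<open>E \<ge> 0\<close>,
  so that its variation is controlled by its initial value, however close to the turning point.\<close>

locale half_well =
  fixes a a1 a2 :: "real \<Rightarrow> real" and H c C d :: real
  assumes d: "0 < d" "d \<le> H / 2" and c: "0 < c" "c \<le> 1" and C: "1 \<le> C"
    and a_deriv: "\<And>x. (a has_real_derivative a1 x) (at x)"
    and a1_deriv: "\<And>x. (a1 has_real_derivative a2 x) (at x)"
    and a_lower: "\<And>x. 0 \<le> x \<Longrightarrow> x \<le> H \<Longrightarrow> c * x\<^sup>2 \<le> a x"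
    and a_upper: "\<And>x. 0 \<le> x \<Longrightarrow> x \<le> H \<Longrightarrow> a x \<le> C * x\<^sup>2"
    and a1_upper: "\<And>x. 0 \<le> x \<Longrightarrow> x \<le> H \<Longrightarrow> \<bar>a1 x\<bar> \<le> C * x"
    and a2_upper: "\<And>x. 0 \<le> x \<Longrightarrow> x \<le> H \<Longrightarrow> \<bar>a2 x\<bar> \<le> C"
    and a1_lower: "\<And>x. 0 \<le> x \<Longrightarrow> x \<le> d \<Longrightarrow> c * x \<le> a1 x"
    and convexity: "\<And>x. 0 \<le> x \<Longrightarrow> x \<le> d \<Longrightarrow> 2 * a x * a2 x \<le> 3 * (a1 x)\<^sup>2"
begin

section \<open>Energies above the barrier: the potential \<open>a + E\<close> on a half well\<close>

lemma H_pos: "0 < H" using d by simp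

lemma add_deriv: "((\<lambda>x. a x + E) has_real_derivative a1 x) (at x)"
  using a_deriv by (auto intro!: derivative_eq_intros)

text \<open>A single length, \<open>x + sqrt E\<close>, describes the size of \<open>a + E\<close>
  uniformly in \<open>E\<close>; \<open>c \<le> 1\<close> allows the same factor in front of
  \<open>E\<close>.\<close>

lemma add_lower:
  assumes "0 \<le> x" "x \<le> H" "0 \<le> E"
  shows "(sqrt (c/2) * (x + sqrt E))\<^sup>2 \<le> a x + E"
proof -
  have "(sqrt (c/2) * (x + sqrt E))\<^sup>2 = c / 2 * (x + sqrt E)\<^sup>2"
    using c by (simp add: power_mult_distrib)
  also have "\<dots> \<le> c / 2 * (2 * (x\<^sup>2 + E))"
    using sum_squares_bound[of x "sqrt E"] c assms
    by (intro mult_left_mono) (auto simp: power2_sum)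
  also have "\<dots> = c * x\<^sup>2 + c * E" by (simp add: algebra_simps)
  also have "\<dots> \<le> a x + E" using a_lower[OF assms(1,2)] c assms(3)
    by (intro add_mono) (auto intro: mult_left_le_one_le)
  finally show ?thesis .
qed

abbreviation adiabatic_above where
  "adiabatic_above K \<equiv>
     \<forall>h E s y w w1. h > 0 \<longrightarrow> 0 \<le> E \<longrightarrow> 0 \<le> s \<longrightarrow> s \<le> y \<longrightarrow> y \<le> H \<longrightarrow> K * h \<le> (s + sqrt E)\<^sup>2 \<longrightarrow>
     schroedinger h (\<lambda>x. a x + E) w w1 \<longrightarrow> comparable_actions h (\<lambda>x. a x + E) w w1 y H"

text \<open>With \<open>X = x + sqrt E\<close> the phase function is of order \<open>X^-2\<close>
  and its derivative of order \<open>X^-3\<close>, so size and variation from \<open>s\<close> on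
  are both governed by \<open>h / (X s)^2\<close>. If \<open>E \<ge> K * h\<close>, one may start at
  the zero of the potential itself.\<close>

lemma above_barrier_adiabatic:
  "\<exists>K>0. adiabatic_above K"
proof -
  define \<sigma> where "\<sigma> = sqrt (c/2)"
  have \<sigma>: "\<sigma> > 0" using c by (simp add: \<sigma>_def)
  \<comment> \<open>The coefficient of \<open>X^-3\<close> in the bound for the derivative of the
    phase function; its first summand is the coefficient of \<open>X^-2\<close> for the phase
    function itself. Requiring \<open>6 * K1 * h \<le> (X s)^2\<close> then yields both bounds by
    1/6.\<close>
  define K1 where "K1 = C / (2 * \<sigma>^3) + 3 * C\<^sup>2 / (4 * \<sigma>^5)"
  have K1: "K1 > 0" "C / (2 * \<sigma>^3) \<le> K1" using \<sigma> C by (auto simp: K1_def add_pos_nonneg)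
  show ?thesis
  proof (intro exI[of _ "6 * K1"] conjI allI impI)
    show "6 * K1 > 0" using K1 by simp
    fix h E s y :: real and w w1
    assume h: "h > 0" and E: "0 \<le> E" and s: "0 \<le> s" "s \<le> y" "y \<le> H"
      and Kh: "6 * K1 * h \<le> (s + sqrt E)\<^sup>2"
      and ode: "schroedinger h (\<lambda>x. a x + E) w w1"
    define X where "X = (\<lambda>x. x + sqrt E)"
    have Xs: "X s > 0" 
    proof -
      have "0 < (X s)\<^sup>2" using Kh K1 h by (smt (verit) X_def mult_pos_pos)
      moreover have "X s \<ge> 0" using s E by (simp add: X_def)
      ultimately show ?thesis by (cases "X s = 0") auto
    qed
    have X: "X x > 0" "X s \<le> X x" if "s \<le> x" for x
      using Xs that by (auto simp: X_def)
    have low: "\<sigma> * X x \<le> sqrt (a x + E)" "(\<sigma> * X x)\<^sup>2 \<le> a x + E" if "s \<le> x" "x \<le> H" for x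
      using add_lower[of x E] E s that real_le_rsqrt
      by (auto simp: \<sigma>_def X_def)
    have pos: "0 < a x + E" if "s \<le> x" "x \<le> H" for x
    proof -
      have "0 < (\<sigma> * X x)\<^sup>2" using X(1)[OF that(1)] \<sigma> by simp
      then show ?thesis using low(2)[OF that] by linarith
    qed
    have l3: "(\<sigma> * X x)^3 \<le> (a x + E) * sqrt (a x + E)" if "s \<le> x" "x \<le> H" for x
    proof -
      have "(\<sigma> * X x)^3 = (\<sigma> * X x)\<^sup>2 * (\<sigma> * X x)" by (simp add: power2_eq_square power3_eq_cube)
      also have "\<dots> \<le> (a x + E) * sqrt (a x + E)"
        using low[OF that] X(1)[OF that(1)] \<sigma> pos[OF that] by (intro mult_mono) auto
      finally show ?thesis .
    qed
    have l5: "(\<sigma> * X x)^5 \<le> (a x + E)\<^sup>2 * sqrt (a x + E)" if "s \<le> x" "x \<le> H" for x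
    proof -
      have "(\<sigma> * X x)^5 = ((\<sigma> * X x)\<^sup>2)\<^sup>2 * (\<sigma> * X x)" by (simp add: eval_nat_numeral)
      also have "\<dots> \<le> (a x + E)\<^sup>2 * sqrt (a x + E)"
        using low[OF that] X(1)[OF that(1)] \<sigma> pos[OF that] by (intro mult_mono power_mono) auto
      finally show ?thesis .
    qed
    have a1X: "\<bar>a1 x\<bar> \<le> C * X x" if "s \<le> x" "x \<le> H" for x
    proof -
      have "\<bar>a1 x\<bar> \<le> C * x" using a1_upper[of x] that s by simp
      also have "\<dots> \<le> C * X x" using C E by (intro mult_left_mono) (auto simp: X_def)
      finally show ?thesis .
    qed
    have b1: "\<bar>a1 x / (2 * ((a x + E) * sqrt (a x + E)))\<bar> \<le> C / (2 * \<sigma>^3) / (X x)\<^sup>2"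
      if "s \<le> x" "x \<le> H" for x
    proof -
      have "\<bar>a1 x / (2 * ((a x + E) * sqrt (a x + E)))\<bar> = \<bar>a1 x\<bar> / (2 * ((a x + E) * sqrt (a x + E)))"
        using pos[OF that] by (simp add: abs_mult)
      also have "\<dots> \<le> (C * X x) / (2 * (\<sigma> * X x)^3)"
        using a1X[OF that] l3[OF that] X(1)[OF that(1)] \<sigma> C by (intro frac_le) auto
      also have "\<dots> = C / (2 * \<sigma>^3) / (X x)\<^sup>2"
        using X(1)[OF that(1)] \<sigma> by (simp add: field_simps eval_nat_numeral)
      finally show ?thesis .
    qed
    have b2: "\<bar>a2 x / (2 * ((a x + E) * sqrt (a x + E))) - 3 * (a1 x)\<^sup>2 / (4 * ((a x + E)\<^sup>2 * sqrt (a x + E)))\<bar>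
       \<le> K1 / (X x)^3" if "s \<le> x" "x \<le> H" for x
    proof -
      have "\<bar>a2 x / (2 * ((a x + E) * sqrt (a x + E)))\<bar> = \<bar>a2 x\<bar> / (2 * ((a x + E) * sqrt (a x + E)))"
        using pos[OF that] by (simp add: abs_mult)
      also have "\<dots> \<le> C / (2 * (\<sigma> * X x)^3)"
        using a2_upper[of x] s that l3[OF that] X(1)[OF that(1)] \<sigma> C by (intro frac_le) auto
      also have "\<dots> = C / (2 * \<sigma>^3) / (X x)^3"
        using X(1)[OF that(1)] \<sigma> by (simp add: field_simps)
      finally have 1: "\<bar>a2 x / (2 * ((a x + E) * sqrt (a x + E)))\<bar> \<le> C / (2 * \<sigma>^3) / (X x)^3" .
      have "(a1 x)\<^sup>2 \<le> (C * X x)\<^sup>2" using a1X[OF that] by (rule abs_le_square_iff[THEN iffD1, OF order_trans]) simp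
      then have "3 * (a1 x)\<^sup>2 / (4 * ((a x + E)\<^sup>2 * sqrt (a x + E))) \<le> 3 * (C * X x)\<^sup>2 / (4 * (\<sigma> * X x)^5)"
        using l5[OF that] X(1)[OF that(1)] \<sigma> C by (intro frac_le) auto
      also have "\<dots> = 3 * C\<^sup>2 / (4 * \<sigma>^5) / (X x)^3"
        using X(1)[OF that(1)] \<sigma> by (simp add: field_simps eval_nat_numeral)
      finally have 2: "3 * (a1 x)\<^sup>2 / (4 * ((a x + E)\<^sup>2 * sqrt (a x + E))) \<le> 3 * C\<^sup>2 / (4 * \<sigma>^5) / (X x)^3" .
      have 3: "0 \<le> 3 * (a1 x)\<^sup>2 / (4 * ((a x + E)\<^sup>2 * sqrt (a x + E)))" using pos[OF that] by simp
      show ?thesis using 1 2 3 unfolding K1_def add_divide_distrib by linarith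
    qed
    define G where "G = (\<lambda>x. K1 / (2 * (X x)\<^sup>2))"
    have dG: "(G has_real_derivative - (K1 / (X x)^3)) (at x)" if "s \<le> x" for x
      unfolding G_def X_def using inverse_square_deriv[of x "sqrt E" K1] X(1)[OF that]
      by (simp add: X_def)
    have hX: "h * (K1 / (X x)\<^sup>2) \<le> 1/6" if "s \<le> x" for x
    proof -
      have "6 * K1 * h \<le> (X x)\<^sup>2"
        using Kh power_mono[OF X(2)[OF that], of 2] Xs by (simp add: X_def)
      then show ?thesis using X(1)[OF that] by (simp add: field_simps)
    qed
    have "comparable_actions h (\<lambda>x. a x + E) w w1 y H"
    proof (rule action_adiabatic[OF ode h _ add_deriv a1_deriv pos _ dG])
      show "s \<le> H" using s by simp
      show "h * \<bar>a1 x / (2 * ((a x + E) * sqrt (a x + E)))\<bar> \<le> 1 / 6" if "s \<le> x" "x \<le> H" for x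
      proof -
        have "h * \<bar>a1 x / (2 * ((a x + E) * sqrt (a x + E)))\<bar> \<le> h * (K1 / (X x)\<^sup>2)"
          by (intro mult_left_mono order_trans[OF b1[OF that] divide_right_mono[OF K1(2)]])
            (use h in auto)
        then show ?thesis using hX[OF that(1)] by linarith
      qed
      show "h * (G s - G H) \<le> 1 / 6"
      proof -
        have "G s - G H \<le> K1 / (X s)\<^sup>2" using K1 Xs by (simp add: G_def field_simps add_pos_nonneg)
        then have "h * (G s - G H) \<le> h * (K1 / (X s)\<^sup>2)" using h by (intro mult_left_mono) auto
        from order_trans[OF this hX[OF order_refl]] show ?thesis .
      qed
    qed (use s b2 in auto)
    then show "action h (\<lambda>x. a x + E) w w1 y \<le> 2 * action h (\<lambda>x. a x + E) w w1 H"
      "action h (\<lambda>x. a x + E) w w1 H \<le> 2 * action h (\<lambda>x. a x + E) w w1 y" by auto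
  qed
qed

text \<open>Beyond \<open>s\<close>, which is at most of order \<open>sqrt h\<close>, the action
  bounds \<open>w^2\<close>. Before it, the energy is at most its value at \<open>s\<close>, of
  order \<open>sqrt h\<close> times the action. So \<open>w1^2\<close> is at most of order
  \<open>sqrt h / h^2\<close> times the action, and over a distance whose square is of order
  \<open>h\<close> the squared change of \<open>w\<close> is again of order action over
  \<open>sqrt h\<close>.\<close>

lemma above_barrier_sup:
  "\<exists>K\<^sub>1 C\<^sub>1. C\<^sub>1 > 0 \<and> (\<forall>h E x w w1. h > 0 \<longrightarrow> sqrt (K\<^sub>1 * h) \<le> d \<longrightarrow> 0 \<le> E \<longrightarrow> 0 \<le> x \<longrightarrow> x \<le> H \<longrightarrow>
     schroedinger h (\<lambda>x. a x + E) w w1 \<longrightarrow>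
     (w x)\<^sup>2 * sqrt h \<le> C\<^sub>1 * action h (\<lambda>x. a x + E) w w1 H)"
proof -
  obtain K where K: "K > 0" and "adiabatic_above K"
    using above_barrier_adiabatic by blast
  note ad = this(2)[rule_format]
  define \<sigma> where "\<sigma> = sqrt (c/2)"
  have \<sigma>: "\<sigma> > 0" using c by (simp add: \<sigma>_def)
  define A where "A = 2 / (\<sigma> * sqrt K)"
  define B where "B = 2 * K * sqrt (C * K)"
  have AB: "A > 0" "B > 0" using \<sigma> K C by (auto simp: A_def B_def)
  show ?thesis
  proof (rule exI[of _ K], rule exI[of _ "2 * A + 2 * B"], intro conjI allI impI)
    show "2 * A + 2 * B > 0" using AB by simp
    fix h E x :: real and w w1
    assume h: "h > 0" and Kd: "sqrt (K * h) \<le> d" and E: "0 \<le> E" and x: "0 \<le> x" "x \<le> H"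
      and ode: "schroedinger h (\<lambda>x. a x + E) w w1"
    define QH where "QH = action h (\<lambda>x. a x + E) w w1 H"
    have QH: "0 \<le> QH" unfolding QH_def using a_lower[of H] H_pos c E
      by (intro action_nonneg) (smt (verit) mult_pos_pos zero_less_power)
    define r where "r = sqrt (K * h)"
    have r: "r > 0" "r\<^sup>2 = K * h" using K h by (auto simp: r_def)
    \<comment> \<open>The first point of the half well at which the adiabatic condition
      \<open>K * h \<le> (s + sqrt E)^2\<close> holds; it is 0 if
      \<open>E \<ge> K * h\<close>.\<close>
    define s where "s = max 0 (r - sqrt E)"
    have s: "0 \<le> s" "s \<le> d" "s \<le> H" "r \<le> s + sqrt E"
      using Kd[folded r_def] real_sqrt_ge_zero[OF E] d unfolding s_def by linarith+
    have Ks: "K * h \<le> (s + sqrt E)\<^sup>2" using power_mono[OF s(4), of 2] r by simp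
    have far: "(w y)\<^sup>2 * sqrt h \<le> A * QH" if y: "s \<le> y" "y \<le> H" for y
    proof -
      have "\<sigma> * r \<le> \<sigma> * (y + sqrt E)" using s y \<sigma> by (intro mult_left_mono) auto
      also have "\<dots> \<le> sqrt (a y + E)"
        using add_lower[of y E] E s y real_le_rsqrt by (auto simp: \<sigma>_def)
      finally have q: "\<sigma> * r \<le> sqrt (a y + E)" .
      moreover have "0 < \<sigma> * r" using \<sigma> r by simp
      ultimately have qpos: "0 < a y + E" by (smt (verit) real_sqrt_gt_0_iff)
      have "(w y)\<^sup>2 \<le> action h (\<lambda>x. a x + E) w w1 y / sqrt (a y + E)"
        using square_le_action[of "\<lambda>x. a x + E" y w h w1, OF qpos] by simp
      also have "\<dots> \<le> (2 * QH) / (\<sigma> * r)"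
        using ad[OF h E s(1) y Ks ode] q QH \<sigma> r by (intro frac_le) (auto simp: QH_def)
      also have "\<dots> = A * QH / sqrt h"
        by (simp add: A_def r_def real_sqrt_mult field_simps)
      finally show ?thesis using h by (simp add: field_simps)
    qed
    show "(w x)\<^sup>2 * sqrt h \<le> (2 * A + 2 * B) * action h (\<lambda>x. a x + E) w w1 H"
    proof (cases "s \<le> x")
      case True
      have "A * QH \<le> (2 * A + 2 * B) * QH" using AB QH by (intro mult_right_mono) auto
      then show ?thesis using far[OF True x(2)] by (simp add: QH_def)
    next
      case False
      then have sr: "s + sqrt E = r" "s > 0" using x by (auto simp: s_def)
      have qs: "0 < a s + E" using add_lower[of s E] s E r \<sigma> sr
        by (smt (verit) \<sigma>_def mult_pos_pos zero_less_power)
      define e where "e = energy h (\<lambda>x. a x + E) w w1 s"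
      have "a s + E \<le> C * (s\<^sup>2 + E)" using a_upper[of s] s E C mult_right_mono[of 1 C E]
        by (simp add: algebra_simps)
      also have "\<dots> \<le> C * (s + sqrt E)\<^sup>2" using C s E by (intro mult_left_mono) (auto simp: power2_sum)
      finally have "a s + E \<le> C * K * h" using sr r by simp
      then have sq: "sqrt (a s + E) \<le> sqrt (C * K) * sqrt h"
        by (simp add: real_sqrt_mult[symmetric])
      have "e = action h (\<lambda>x. a x + E) w w1 s * sqrt (a s + E)" using qs by (simp add: action_def e_def)
      also have "\<dots> \<le> (2 * QH) * (sqrt (C * K) * sqrt h)"
        using ad[OF h E s(1) order_refl s(3) Ks ode] sq QH qs by (intro mult_mono) (auto simp: QH_def)
      finally have e: "e \<le> 2 * QH * sqrt (C * K) * sqrt h" by simp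
      have "(w x - w s)\<^sup>2 \<le> (s - x)\<^sup>2 * (e / h\<^sup>2)"
      proof (rule mvt_square_bound[OF schroedingerD(1)[OF ode]])
        show "x \<le> s" using False by simp
        fix t assume t: "x \<le> t" "t \<le> s"
        have "energy h (\<lambda>x. a x + E) w w1 t \<le> e" unfolding e_def
        proof (rule energy_mono[OF ode h add_deriv t(2)])
          fix t' assume "t \<le> t'" "t' \<le> s"
          then show "0 \<le> a1 t'" using a1_lower[of t'] x t s c
            by (smt (verit) mult_nonneg_nonneg)
        qed
        moreover have "0 \<le> a t + E" using a_lower[of t] t x s c E
          by (smt (verit) mult_nonneg_nonneg zero_le_power2)
        ultimately have "h\<^sup>2 * (w1 t)\<^sup>2 \<le> e" unfolding energy_def
          by (smt (verit) mult_nonneg_nonneg zero_le_power2)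
        then show "(w1 t)\<^sup>2 \<le> e / h\<^sup>2" using h by (simp add: field_simps)
      qed
      also have "\<dots> \<le> r\<^sup>2 * ((2 * QH * sqrt (C * K) * sqrt h) / h\<^sup>2)"
      proof (intro mult_mono power_mono divide_right_mono e)
        show "s - x \<le> r" using sr x E by (smt (verit) real_sqrt_ge_zero)
        show "0 \<le> e / h\<^sup>2" unfolding e_def energy_def using qs by simp
      qed (use False in auto)
      also have "\<dots> = B * QH * (sqrt h / h)"
        unfolding r B_def using h by (simp add: field_simps power2_eq_square)
      finally have "(w x - w s)\<^sup>2 * sqrt h \<le> B * QH * (sqrt h / h) * sqrt h"
        using h by (intro mult_right_mono) auto
      also have "\<dots> = B * QH" using h by (simp add: field_simps)
      finally have 1: "(w x - w s)\<^sup>2 * sqrt h \<le> B * QH" .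
      have "(w x)\<^sup>2 * sqrt h \<le> (2 * (w x - w s)\<^sup>2 + 2 * (w s)\<^sup>2) * sqrt h"
        using h by (intro mult_right_mono square_le_twice) auto
      also have "\<dots> = 2 * ((w x - w s)\<^sup>2 * sqrt h) + 2 * ((w s)\<^sup>2 * sqrt h)" by (simp add: algebra_simps)
      also have "\<dots> \<le> 2 * (B * QH) + 2 * (A * QH)" using 1 far[OF order_refl s(3)] by simp
      finally show ?thesis by (simp add: QH_def algebra_simps)
    qed
  qed
qed


abbreviation action_log_bound where
  "action_log_bound C' h \<equiv>
     \<forall>E w w1. 0 \<le> E \<longrightarrow> E \<le> h powr (1/8) \<longrightarrow> schroedinger h (\<lambda>x. a x + E) w w1 \<longrightarrow>
     action h (\<lambda>x. a x + E) w w1 H * ln (1/h) \<le> C' * integral {0..H} (\<lambda>x. (w x)\<^sup>2)"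

text \<open>\<open>E \<le> h powr (1/8)\<close> gives \<open>sqrt q \<le> D * x\<close> from
  \<open>x = h powr (1/16)\<close> on. Hence the local mean of \<open>w^2\<close>, the action over
  \<open>2 * sqrt q\<close>, is at least a multiple of action over \<open>x\<close>, and
  \<open>1 / x\<close> integrates to \<open>ln H + ln (1/h) / 16\<close>.\<close>

lemma above_barrier_mass:
  "\<exists>C\<^sub>1>0. \<forall>\<^sub>F h in at_right 0. action_log_bound C\<^sub>1 h" (is "\<exists>C>0. \<forall>\<^sub>F h in at_right 0. ?P C h")
proof -
  obtain K where K: "K > 0" and "adiabatic_above K"
    using above_barrier_adiabatic by blast
  note ad = this(2)[rule_format]
  define D where "D = sqrt (2 * C)"
  have D: "D > 0" using C by (simp add: D_def)
  \<comment> \<open>Action over \<open>sqrt q\<close> is at least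
    \<open>2 * \<kappa> * Q H / x\<close>, where the comparability of the actions costs a factor 2.
    One \<open>\<kappa>\<close> is sacrificed to the error from the derivative of
    \<open>1 / q\<close>.\<close>
  define \<kappa> where "\<kappa> = 1 / (4 * D)"
  have \<kappa>: "\<kappa> > 0" using D by (simp add: \<kappa>_def)
  \<comment> \<open>Normalized so that \<open>K2 * h \<le> x^2\<close> bounds this error by
    \<open>\<kappa> * Q H / x\<close>.\<close>
  define K2 where "K2 = 4 * D * C / c\<^sup>2"
  \<comment> \<open>The \<open>- 2\<close> pays for the boundary terms of \<open>\<Psi>\<close> at
    the two ends, at most \<open>Q H\<close> each. Half of the coefficient
    \<open>\<kappa> / 16\<close> absorbs it together with \<open>ln H\<close>.\<close>
  have ev: "\<forall>\<^sub>F h in at_right 0. 0 < h \<and> h < 1 \<and> K * h \<le> h powr (1/8) \<and> K2 * h \<le> h powr (1/8)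
      \<and> h \<le> c * h powr (1/8) \<and> h powr (1/16) \<le> H
      \<and> \<kappa> / 32 * ln (1/h) \<le> \<kappa> * (ln H + ln (1/h) / 16) - 2"
  proof (intro eventually_conj)
    show "\<forall>\<^sub>F h in at_right (0::real). 0 < h" "\<forall>\<^sub>F h in at_right (0::real). h < 1" by real_asymp+
    show "\<forall>\<^sub>F h in at_right 0. K * h \<le> h powr (1/8)" using K by real_asymp
    have "K2 > 0" using D C c by (simp add: K2_def)
    then show "\<forall>\<^sub>F h in at_right 0. K2 * h \<le> h powr (1/8)" by real_asymp
    show "\<forall>\<^sub>F h in at_right 0. h \<le> c * h powr (1/8)" using c(1) by real_asymp
    show "\<forall>\<^sub>F h in at_right 0. h powr (1/16) \<le> H" using H_pos by real_asymp
    show "\<forall>\<^sub>F h in at_right 0. \<kappa> / 32 * ln (1/h) \<le> \<kappa> * (ln H + ln (1/h) / 16) - 2"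
      using \<kappa> by real_asymp
  qed
  show ?thesis
  proof (rule exI[of _ "64 / \<kappa>"], intro conjI)
    show "64 / \<kappa> > 0" using \<kappa> by simp
    show "\<forall>\<^sub>F h in at_right 0. ?P (64 / \<kappa>) h"
      using ev
    proof (eventually_elim, intro allI impI, elim conjE)
      fix h E :: real and w w1
      assume h: "0 < h" "h < 1" and h1: "K * h \<le> h powr (1/8)" and h2: "K2 * h \<le> h powr (1/8)"
        and h3: "h \<le> c * h powr (1/8)" and h4: "h powr (1/16) \<le> H"
        and h5: "\<kappa> / 32 * ln (1/h) \<le> \<kappa> * (ln H + ln (1/h) / 16) - 2"
        and E: "0 \<le> E" "E \<le> h powr (1/8)"
        and ode: "schroedinger h (\<lambda>x. a x + E) w w1"
      define q where "q = (\<lambda>x. a x + E)"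
      note ode' = ode[folded q_def]
      define Q where "Q = action h q w w1"
      define z where "z = h powr (1/16)"
      have z: "0 < z" "z \<le> H" "z\<^sup>2 = h powr (1/8)"
        using h h4 by (auto simp: z_def power2_eq_square powr_add[symmetric])
      have zx: "h powr (1/8) \<le> x\<^sup>2" if "z \<le> x" for x
        using power_mono[OF that, of 2] z by simp
      have ql: "c * x\<^sup>2 \<le> q x" if "z \<le> x" "x \<le> H" for x
        using a_lower[of x] that z E by (simp add: q_def)
      have qpos: "0 < q x" if "z \<le> x" "x \<le> H" for x
        using ql[OF that] that z c by (smt (verit) mult_pos_pos zero_less_power)
      have qu: "sqrt (q x) \<le> D * x" if "z \<le> x" "x \<le> H" for x
      proof -
        have "q x \<le> C * x\<^sup>2 + 1 * x\<^sup>2"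
          using a_upper[of x] that z E zx[OF that(1)] by (simp add: q_def)
        also have "\<dots> \<le> C * x\<^sup>2 + C * x\<^sup>2" using C by (intro add_mono mult_right_mono) auto
        also have "\<dots> = (D * x)\<^sup>2" using C by (simp add: D_def power_mult_distrib)
        finally show ?thesis using D that z by (intro real_le_lsqrt) auto
      qed
      have Qc: "Q x \<le> 2 * Q H" "Q H \<le> 2 * Q x" if "z \<le> x" "x \<le> H" for x
      proof -
        have "z\<^sup>2 \<le> (z + sqrt E)\<^sup>2" using z E by (intro power_mono) auto
        then have "K * h \<le> (z + sqrt E)\<^sup>2" using h1 z by simp
        from ad[OF h(1) E(1) _ that this ode] z show "Q x \<le> 2 * Q H" "Q H \<le> 2 * Q x"
          by (auto simp: Q_def q_def)
      qed
      have QH: "0 \<le> Q H" unfolding Q_def using qpos z by (intro action_nonneg) auto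
      have rho: "\<bar>h * (w x * w1 x)\<bar> \<le> Q H" if "z \<le> x" "x \<le> H" for x
        using action_bound_product[of q x h w w1, OF qpos[OF that]] Qc[OF that] by (simp add: Q_def)
      define I where "I = (\<lambda>x. integral {0..x} (\<lambda>t. (w t)\<^sup>2))"
      have cw: "continuous_on A (\<lambda>t. (w t)\<^sup>2)" for A
        by (intro continuous_intros schroedinger_continuous[OF ode])
      have I: "(I has_real_derivative (w x)\<^sup>2) (at x)" if "z \<le> x" "x \<le> H" for x
      proof -
        have "(I has_real_derivative (w x)\<^sup>2) (at x within {0..H+1})"
          unfolding I_def by (rule integral_has_real_derivative[OF cw]) (use that z in auto)
        moreover have "at x within {0..H+1} = at x" using that z by (intro at_within_interior) auto
        ultimately show ?thesis by simp
      qed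
      \<comment> \<open>The boundary term turns the kinetic part of the energy into \<open>w\<^sup>2\<close>: \<open>\<Psi>' \<ge> 0\<close> compares
        \<open>2 w\<^sup>2\<close> with \<open>Q / sqrt q\<close>, which is at least a multiple of \<open>Q H / x\<close>.\<close>
      define \<Psi> where "\<Psi> = (\<lambda>x. 2 * I x + h\<^sup>2 * (w x * w1 x) / q x - \<kappa> * Q H * ln x)"
      have \<Psi>_mono: "\<Psi> z \<le> \<Psi> H"
      proof (rule DERIV_nonneg_imp_nondecreasing[OF z(2)])
        fix x assume x: "z \<le> x" "x \<le> H"
        then have x0: "x > 0" using z by simp
        have qp: "q x > 0" using qpos x by simp
        define \<Psi>' where "\<Psi>' = 2 * (w x)\<^sup>2 + ((h\<^sup>2 * (w1 x * w1 x + (- (q x / h\<^sup>2) * w x) * w x)) * q x - h\<^sup>2 * (w x * w1 x) * a1 x) / (q x * q x)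
            - \<kappa> * Q H * (1 / x)"
        have "(\<Psi> has_real_derivative \<Psi>') (at x)"
          unfolding \<Psi>_def \<Psi>'_def
          by (intro DERIV_diff DERIV_add DERIV_cmult DERIV_divide DERIV_mult I[OF x] schroedingerD[OF ode'] DERIV_ln_divide x0)
            (use qp add_deriv in \<open>auto simp: q_def\<close>)
        moreover have "\<Psi>' \<ge> 0"
        proof -
          define r where "r = sqrt (q x)"
          have r: "r > 0" "q x = r * r" using qp by (auto simp: r_def)
          have "\<Psi>' = Q x / sqrt (q x) - h * (h * (w x * w1 x)) * a1 x / (q x * q x) - \<kappa> * Q H / x"
            unfolding \<Psi>'_def Q_def action_def energy_def r_def[symmetric] unfolding r(2)
            using r(1) h by (simp add: field_simps power2_eq_square)
          moreover have "2 * \<kappa> * Q H / x \<le> Q x / sqrt (q x)"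
          proof -
            have "2 * \<kappa> * Q H / x = (Q H / 2) / (D * x)" using x0 D by (simp add: \<kappa>_def field_simps)
            also have "\<dots> \<le> Q x / sqrt (q x)" using Qc[OF x] QH qu[OF x] qp by (intro frac_le) auto
            finally show ?thesis .
          qed
          moreover have "\<bar>h * (h * (w x * w1 x)) * a1 x / (q x * q x)\<bar> \<le> \<kappa> * Q H / x"
          proof -
            have "\<bar>h * (h * (w x * w1 x)) * a1 x / (q x * q x)\<bar> = h * \<bar>h * (w x * w1 x)\<bar> * \<bar>a1 x\<bar> / (q x * q x)"
              using h by (simp add: abs_mult)
            also have "\<dots> \<le> h * Q H * (C * x) / ((c * x\<^sup>2) * (c * x\<^sup>2))"
              using rho[OF x] a1_upper[of x] x x0 ql[OF x] c QH C h qp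
              by (intro frac_le mult_mono) auto
            also have "\<dots> = (K2 * h) * (\<kappa> * Q H / (x\<^sup>2 * x))"
              using x0 c D by (simp add: K2_def \<kappa>_def field_simps power2_eq_square)
            also have "\<dots> \<le> x\<^sup>2 * (\<kappa> * Q H / (x\<^sup>2 * x))"
              using h2 zx[OF x(1)] \<kappa> QH x0 by (intro mult_right_mono) auto
            also have "\<dots> = \<kappa> * Q H / x" using x0 by simp
            finally show ?thesis .
          qed
          ultimately show ?thesis by linarith
        qed
        ultimately show "\<exists>d. (\<Psi> has_real_derivative d) (at x) \<and> d \<ge> 0" by blast
      qed
      have bd: "\<bar>h\<^sup>2 * (w x * w1 x) / q x\<bar> \<le> Q H" if "z \<le> x" "x \<le> H" for x
      proof -
        have "h \<le> q x" using h3 zx[OF that(1)] ql[OF that] c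
          by (smt (verit) mult_left_mono)
        have "\<bar>h\<^sup>2 * (w x * w1 x) / q x\<bar> = h * \<bar>h * (w x * w1 x)\<bar> / q x"
          using h qpos[OF that] by (simp add: abs_mult power2_eq_square)
        also have "\<dots> \<le> q x * Q H / q x"
          using \<open>h \<le> q x\<close> rho[OF that] qpos[OF that] h QH by (intro divide_right_mono mult_mono) auto
        finally show ?thesis using qpos[OF that] by simp
      qed
      have Iz: "I z \<ge> 0" unfolding I_def by (intro integral_nonneg integrable_continuous_real cw) auto
      have "ln z = - (ln (1/h) / 16)" using h by (simp add: z_def ln_div)
      then have "\<kappa> * Q H * (ln H + ln (1/h) / 16) = \<kappa> * Q H * ln H - \<kappa> * Q H * ln z"
        by (simp add: algebra_simps)
      then have "\<kappa> * Q H * (ln H + ln (1/h) / 16) \<le> 2 * I H + 2 * Q H"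
        using abs_le_D2[OF bd[OF order_refl z(2)]] abs_le_D1[OF bd[OF z(2) order_refl]] \<Psi>_mono Iz
        unfolding \<Psi>_def by linarith
      moreover have "Q H * (\<kappa> / 32 * ln (1/h)) \<le> Q H * (\<kappa> * (ln H + ln (1/h) / 16) - 2)"
        using QH h5 by (intro mult_left_mono) auto
      ultimately have "Q H * (\<kappa> / 32 * ln (1/h)) \<le> 2 * I H" by (simp add: algebra_simps)
      then show "action h (\<lambda>x. a x + E) w w1 H * ln (1/h) \<le> 64 / \<kappa> * integral {0..H} (\<lambda>x. (w x)\<^sup>2)"
        using \<kappa> by (simp add: Q_def q_def I_def field_simps)
    qed
  qed
qed


section \<open>Energies below the barrier: the potential \<open>a - E\<close> and its turning
  point\<close>

lemma diff_deriv: "((\<lambda>x. a x - E) has_real_derivative a1 x) (at x)"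
  using a_deriv by (auto intro!: derivative_eq_intros)

lemma a1_nonneg: "0 \<le> x \<Longrightarrow> x \<le> d \<Longrightarrow> 0 \<le> a1 x"
  using a1_lower[of x] c by (smt (verit) mult_nonneg_nonneg)

lemma a_mono:
  assumes "0 \<le> x" "x \<le> y" "y \<le> d" shows "a x \<le> a y"
  by (rule DERIV_nonneg_imp_nondecreasing[OF assms(2)])
     (use a_deriv a1_nonneg assms in \<open>meson order_trans\<close>)

lemma a_lower_outside:
  assumes "d \<le> x" "x \<le> H" shows "c * d\<^sup>2 \<le> a x"
proof -
  have "c * d\<^sup>2 \<le> c * x\<^sup>2" using assms d c by (intro mult_left_mono power_mono) auto
  then show ?thesis using a_lower[of x] assms d by simp
qed

abbreviation adiabatic_below where
  "adiabatic_below h0 \<equiv>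
     \<forall>h E s y w w1. 0 < h \<longrightarrow> h < h0 \<longrightarrow> 0 \<le> E \<longrightarrow> E \<le> c * d\<^sup>2 / 2 \<longrightarrow> 0 \<le> s \<longrightarrow> s \<le> y \<longrightarrow> y \<le> H \<longrightarrow>
     0 < a s - E \<longrightarrow> 6 * h * a1 s \<le> (a s - E) * sqrt (a s - E) \<longrightarrow>
     schroedinger h (\<lambda>x. a x - E) w w1 \<longrightarrow> comparable_actions h (\<lambda>x. a x - E) w w1 y H"

text \<open>\<open>E \<le> c * d\<^sup>2 / 2\<close> puts the turning point before \<open>d\<close>
  and keeps \<open>q \<ge> m\<close> beyond \<open>d\<close>, where the phase function and its
  derivative are bounded outright. The condition at \<open>s\<close> says that \<open>h\<close>
  times the phase function is at most 1/12 there; \<open>h0\<close> leaves the other 1/12 for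
  \<open>{d..H}\<close>.\<close>

lemma below_barrier_adiabatic:
  "\<exists>h0>0. adiabatic_below h0"
proof -
  define m where "m = c * d\<^sup>2 / 2"
  have m: "m > 0" using c d by (simp add: m_def)
  define M where "M = m * sqrt m"
  have M: "M > 0" using m by (simp add: M_def)
  define Cg where "Cg = C * H / (2 * M)"
  define C2 where "C2 = C / (2 * M)"
  have Cp: "Cg > 0" "C2 > 0" using C H_pos M by (auto simp: Cg_def C2_def)
  define h0 where "h0 = 1 / (12 * (Cg + 2 * C2 * H))"
  have h0: "h0 > 0" using Cp H_pos by (simp add: h0_def add_pos_pos)
  show ?thesis
  proof (rule exI[of _ h0], intro conjI h0 allI impI)
    fix h E s y :: real and w w1
    assume h: "0 < h" "h < h0" and E: "0 \<le> E" "E \<le> c * d\<^sup>2 / 2" and s: "0 \<le> s" "s \<le> y" "y \<le> H"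
      and qs: "0 < a s - E" and gs: "6 * h * a1 s \<le> (a s - E) * sqrt (a s - E)"
      and ode: "schroedinger h (\<lambda>x. a x - E) w w1"
    define q where "q = (\<lambda>x. a x - E)"
    note ode' = ode[folded q_def]
    have hC: "h * (Cg + 2 * C2 * H) \<le> 1 / 12"
    proof -
      have "h * (Cg + 2 * C2 * H) \<le> h0 * (Cg + 2 * C2 * H)"
        using h Cp H_pos by (intro mult_right_mono) auto
      also have "\<dots> = 1 / 12"
      proof -
        have "Cg + 2 * C2 * H > 0" using Cp H_pos by (simp add: add_pos_pos)
        then show ?thesis by (simp add: h0_def)
      qed
      finally show ?thesis .
    qed
    have qout: "m \<le> q x" if "d \<le> x" "x \<le> H" for x
      using a_lower_outside[OF that] E m by (simp add: q_def m_def)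
    have pos: "0 < q x" if "s \<le> x" "x \<le> H" for x
    proof (cases "x \<le> d")
      case True
      then show ?thesis using a_mono[of s x] s qs that by (simp add: q_def)
    qed (use qout[of x] m that in auto)
    define g where "g = (\<lambda>x. a1 x / (2 * (q x * sqrt (q x))))"
    define g1 where "g1 = (\<lambda>x. a2 x / (2 * (q x * sqrt (q x))) - 3 * (a1 x)\<^sup>2 / (4 * ((q x)\<^sup>2 * sqrt (q x))))"
    have dq: "(q has_real_derivative a1 x) (at x)" for x unfolding q_def by (rule diff_deriv)
    have dg: "(g has_real_derivative g1 x) (at x)" if "s \<le> x" "x \<le> H" for x
      unfolding g_def g1_def by (rule phase_deriv[OF dq a1_deriv pos[OF that]])
    have Mq: "M \<le> q x * sqrt (q x)" if "d \<le> x" "x \<le> H" for x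
      unfolding M_def using qout[OF that] m by (intro mult_mono) auto
    have g1C: "g1 x \<le> C2" if x: "s \<le> x" "x \<le> H" for x
    proof (cases "x \<le> d")
      case True
      have qp: "q x > 0" using pos x by simp
      \<comment> \<open>\<open>convexity\<close> speaks of \<open>a\<close>. It passes to
        \<open>q \<le> a\<close> if \<open>a2 x\<close> is nonnegative and is trivial otherwise, so
        it holds uniformly in \<open>E\<close>.\<close>
      have "2 * q x * a2 x \<le> 3 * (a1 x)\<^sup>2"
      proof (cases "a2 x \<ge> 0")
        case True
        then have "2 * q x * a2 x \<le> 2 * a x * a2 x" using E
          by (intro mult_right_mono) (auto simp: q_def)
        then show ?thesis using convexity[of x] \<open>x \<le> d\<close> s x by linarith
      next
        case False
        then have "2 * q x * a2 x \<le> 0" using qp by (simp add: mult_nonneg_nonpos)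
        then show ?thesis by (smt (verit) zero_le_power2)
      qed
      then have "(2 * q x * a2 x - 3 * (a1 x)\<^sup>2) / (4 * ((q x)\<^sup>2 * sqrt (q x))) \<le> 0"
        using qp by (simp add: divide_nonpos_pos)
      moreover have "g1 x = (2 * q x * a2 x - 3 * (a1 x)\<^sup>2) / (4 * ((q x)\<^sup>2 * sqrt (q x)))"
        unfolding g1_def using qp by (simp add: field_simps power2_eq_square)
      ultimately show ?thesis using Cp by linarith
    next
      case False
      have "a2 x / (2 * (q x * sqrt (q x))) \<le> C / (2 * M)"
        using a2_upper[of x] s x False Mq[of x] M C pos[OF x] by (intro frac_le) auto
      moreover have "0 \<le> 3 * (a1 x)\<^sup>2 / (4 * ((q x)\<^sup>2 * sqrt (q x)))" using pos[OF x] by simp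
      ultimately show ?thesis by (simp add: g1_def C2_def)
    qed
    have glow: "- Cg \<le> g x" if x: "s \<le> x" "x \<le> H" for x
    proof (cases "x \<le> d")
      case True
      then have "0 \<le> g x" using a1_nonneg[of x] pos[OF x] s x by (simp add: g_def)
      then show ?thesis using Cp by simp
    next
      case False
      have "C * x \<le> C * H" using x C by (intro mult_left_mono) auto
      then have "\<bar>a1 x\<bar> \<le> C * H" using a1_upper[of x] s x by simp
      then have "\<bar>a1 x\<bar> / (2 * (q x * sqrt (q x))) \<le> C * H / (2 * M)"
        using False Mq[of x] x M C H_pos pos[OF x] by (intro frac_le) auto
      then have "\<bar>g x\<bar> \<le> Cg" using pos[OF x] by (simp add: g_def Cg_def)
      then show ?thesis by linarith
    qed
    have gup: "g x \<le> g s + C2 * H" if x: "s \<le> x" "x \<le> H" for x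
    proof -
      have "g x - C2 * x \<le> g s - C2 * s"
      proof (rule DERIV_nonpos_imp_nonincreasing[OF x(1)])
        fix t assume t: "s \<le> t" "t \<le> x"
        then show "\<exists>e. ((\<lambda>x. g x - C2 * x) has_real_derivative e) (at t) \<and> e \<le> 0"
          using dg[of t] g1C[of t] x
          by (intro exI[of _ "g1 t - C2"]) (auto intro!: derivative_eq_intros)
      qed
      moreover have "C2 * x \<le> C2 * H" "0 \<le> C2 * s" using x s Cp by auto
      ultimately show ?thesis by linarith
    qed
    have hgs: "h * g s \<le> 1 / 12"
      using gs qs by (simp add: g_def q_def field_simps)
    \<comment> \<open>The one-sided bound \<open>g1 \<le> C2\<close> suffices: it gives
      \<open>\<bar>g1\<bar> \<le> 2 * C2 - g1\<close>, and the right side has an explicit primitive,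
      \<open>- G\<close>.\<close>
    define G where "G = (\<lambda>x. g x + 2 * C2 * (H - x))"
    have "comparable_actions h q w w1 y H"
    proof (rule action_adiabatic[OF ode' h(1) _ dq a1_deriv pos, where G = G and G' = "\<lambda>x. g1 x - 2 * C2"])
      show "s \<le> H" using s by simp
      show "(G has_real_derivative g1 x - 2 * C2) (at x)" if "s \<le> x" "x \<le> H" for x
        unfolding G_def using dg[OF that] by (auto intro!: derivative_eq_intros)
      show "\<bar>a2 x / (2 * (q x * sqrt (q x))) - 3 * (a1 x)\<^sup>2 / (4 * ((q x)\<^sup>2 * sqrt (q x)))\<bar> \<le> - (g1 x - 2 * C2)"
        if "s \<le> x" "x \<le> H" for x
      proof -
        have "\<bar>g1 x\<bar> \<le> - (g1 x - 2 * C2)" using g1C[OF that] Cp by linarith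
        then show ?thesis by (simp only: g1_def)
      qed
      have "h * (G s - G H) = h * g s + h * (- g H + 2 * C2 * (H - s))" by (simp add: G_def algebra_simps)
      also have "\<dots> \<le> 1 / 12 + h * (Cg + 2 * C2 * H)"
      proof (intro add_mono hgs mult_left_mono)
        show "- g H \<le> Cg" using glow[of H] s by simp
      qed (use Cp s h in auto)
      also have "\<dots> \<le> 1 / 6" using hC by simp
      finally show "h * (G s - G H) \<le> 1 / 6" .
      show "h * \<bar>a1 x / (2 * (q x * sqrt (q x)))\<bar> \<le> 1 / 6" if x: "s \<le> x" "x \<le> H" for x
      proof -
        have "h * g x \<le> h * g s + h * (C2 * H)" using gup[OF x] h by (simp add: distrib_left[symmetric])
        moreover have "h * (- Cg) \<le> h * g x" using glow[OF x] h by (intro mult_left_mono) auto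
        moreover have "0 \<le> h * Cg" "0 \<le> h * (C2 * H)" using h Cp H_pos by auto
        moreover have "h * Cg + 2 * (h * (C2 * H)) \<le> 1 / 12" using hC by (simp add: algebra_simps)
        ultimately have "\<bar>h * g x\<bar> \<le> 1 / 6" using hgs unfolding abs_le_iff by simp
        then show ?thesis using h by (simp add: g_def abs_mult)
      qed
    qed (use s in auto)
    then show "action h (\<lambda>x. a x - E) w w1 y \<le> 2 * action h (\<lambda>x. a x - E) w w1 H"
      "action h (\<lambda>x. a x - E) w w1 H \<le> 2 * action h (\<lambda>x. a x - E) w w1 y" by (auto simp: q_def)
  qed
qed

abbreviation sup_action_bound where
  "sup_action_bound C' h \<equiv>
     \<forall>E x w w1. 0 \<le> E \<longrightarrow> E \<le> c * d\<^sup>2 / 2 \<longrightarrow> 0 \<le> x \<longrightarrow> x \<le> H \<longrightarrow> E \<le> a x \<longrightarrow>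
     schroedinger h (\<lambda>x. a x - E) w w1 \<longrightarrow> (w x)\<^sup>2 * sqrt h \<le> C' * action h (\<lambda>x. a x - E) w w1 H"

text \<open>A point with \<open>6 * h * a1 \<le> q * sqrt q\<close> has
  \<open>q \<ge> k * h\<close>, so there the action bound costs at most
  \<open>h powr (-1/2)\<close>. An allowed point closer to the turning point is joined to a point
  \<open>s\<close> with equality, at a distance of the order of the local wave length
  \<open>h / sqrt (q s)\<close>; the squared change of \<open>w\<close> on the way is of the order
  of the bound at \<open>s\<close>.\<close>

lemma below_barrier_sup:
  "\<exists>C\<^sub>1>0. \<forall>\<^sub>F h in at_right 0. sup_action_bound C\<^sub>1 h" (is "\<exists>C>0. \<forall>\<^sub>F h in at_right 0. ?P C h")
proof -
  obtain h0 where h0: "h0 > 0" and "adiabatic_below h0"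
    using below_barrier_adiabatic by blast
  note ad = this(2)[rule_format]
  define m where "m = c * d\<^sup>2 / 2"
  have m: "m > 0" using c d by (simp add: m_def)
  \<comment> \<open>From \<open>6 * h * c * t \<le> 6 * h * a1 t \<le> q t * sqrt (q t)\<close> and
    \<open>sqrt (q t) \<le> sqrt C * t\<close> by eliminating \<open>t\<close>.\<close>
  define k where "k = 6 * c / sqrt C"
  have k: "k > 0" using c C by (simp add: k_def)
  \<comment> \<open>\<open>A\<close> is the constant of the length estimate \<open>len\<close>. In
    \<open>B\<close>, twice the squared change \<open>2 * A\<^sup>2\<close> is added to twice the
    constant 2 of the bound at \<open>s\<close>.\<close>
  define A where "A = 12 * C / c"
  define B where "B = (4 + 4 * A\<^sup>2) / sqrt k"
  have AB: "A > 0" "B > 0" using c C k by (auto simp: A_def B_def intro!: divide_pos_pos add_pos_nonneg)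
  have ev: "\<forall>\<^sub>F h in at_right 0. 0 < h \<and> h < h0 \<and> k * h \<le> m \<and> 6 * h * (C * H) \<le> m * sqrt m"
  proof (intro eventually_conj)
    show "\<forall>\<^sub>F h in at_right (0::real). 0 < h" by real_asymp
    show "\<forall>\<^sub>F h in at_right (0::real). h < h0" using h0 by real_asymp
    show "\<forall>\<^sub>F h in at_right 0. k * h \<le> m" using k m by real_asymp
    have "\<forall>\<^sub>F h in at_right 0. 6 * h * A \<le> B" if "A > 0" "B > 0" for A B :: real
      using that by real_asymp
    then show "\<forall>\<^sub>F h in at_right 0. 6 * h * (C * H) \<le> m * sqrt m"
      using m C H_pos by simp
  qed
  show ?thesis
  proof (rule exI[of _ B], intro conjI AB)
    show "\<forall>\<^sub>F h in at_right 0. ?P B h"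
      using ev
    proof (eventually_elim, intro allI impI, elim conjE)
      fix h E x :: real and w w1
      assume h: "0 < h" "h < h0" and hm: "k * h \<le> m" and h6: "6 * h * (C * H) \<le> m * sqrt m"
        and E: "0 \<le> E" "E \<le> c * d\<^sup>2 / 2" and x: "0 \<le> x" "x \<le> H" and Ex: "E \<le> a x"
        and ode: "schroedinger h (\<lambda>x. a x - E) w w1"
      define q where "q = (\<lambda>x. a x - E)"
      note ode' = ode[folded q_def]
      define Q where "Q = action h q w w1"
      have dq: "(q has_real_derivative a1 x) (at x)" for x unfolding q_def by (rule diff_deriv)
      have qout: "m \<le> q x" if "d \<le> x" "x \<le> H" for x
        using a_lower_outside[OF that] E m by (simp add: q_def m_def)
      have QH: "0 \<le> Q H" unfolding Q_def using qout[of H] d m by (intro action_nonneg) auto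
      have out: "6 * h * a1 t \<le> q t * sqrt (q t)" if "d \<le> t" "t \<le> H" for t
      proof -
        have "C * t \<le> C * H" using that C by (intro mult_left_mono) auto
        then have "a1 t \<le> C * H" using a1_upper[of t] that d by simp
        then have "6 * h * a1 t \<le> 6 * h * (C * H)" using h by (intro mult_left_mono) auto
        also have "\<dots> \<le> m * sqrt m" by (rule h6)
        also have "\<dots> \<le> q t * sqrt (q t)" using qout[OF that] m by (intro mult_mono) auto
        finally show ?thesis .
      qed
      have kh: "k * h \<le> q t" if t: "0 \<le> t" "t \<le> H" and gt: "6 * h * a1 t \<le> q t * sqrt (q t)" and qt: "0 < q t" for t
      proof (cases "t \<le> d")
        case True
        have "q t \<le> C * t\<^sup>2" using a_upper[OF t] E by (simp add: q_def)
        then have "sqrt (q t) \<le> sqrt (C * t\<^sup>2)" by simp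
        also have "\<dots> = sqrt C * t" using t by (simp add: real_sqrt_mult)
        finally have st: "sqrt (q t) \<le> sqrt C * t" .
        have "k * h * sqrt (q t) \<le> k * h * (sqrt C * t)" using st k h by (intro mult_left_mono) auto
        also have "\<dots> = 6 * h * (c * t)" using C by (simp add: k_def)
        also have "\<dots> \<le> 6 * h * a1 t" using a1_lower[OF t(1) True] h by (intro mult_left_mono) auto
        also have "\<dots> \<le> q t * sqrt (q t)" by (rule gt)
        finally show ?thesis using qt by simp
      qed (use hm qout[of t] t in auto)
      have far: "(w t)\<^sup>2 \<le> 2 * Q H / sqrt (q t)" and far2: "Q t \<le> 2 * Q H"
        if t: "0 \<le> t" "t \<le> H" and gt: "6 * h * a1 t \<le> q t * sqrt (q t)" and qt: "0 < q t" for t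
      proof -
        show "Q t \<le> 2 * Q H"
          using ad[OF h E t(1) order_refl t(2) _ _ ode] gt qt by (simp add: Q_def q_def)
        then have "Q t / sqrt (q t) \<le> 2 * Q H / sqrt (q t)" using qt by (intro divide_right_mono) auto
        then show "(w t)\<^sup>2 \<le> 2 * Q H / sqrt (q t)"
          using square_le_action[of q t w h w1, OF qt] by (simp add: Q_def)
      qed
      have conv: "(4 + 4 * A\<^sup>2) * Q H / sqrt (q t) * sqrt h \<le> B * Q H" if "k * h \<le> q t" "0 < q t" for t
      proof -
        have "sqrt k * sqrt h \<le> sqrt (q t)" using that by (simp add: real_sqrt_mult[symmetric])
        then have "(4 + 4 * A\<^sup>2) * Q H / sqrt (q t) \<le> (4 + 4 * A\<^sup>2) * Q H / (sqrt k * sqrt h)"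
          using QH k h that by (intro divide_left_mono) auto
        then have "(4 + 4 * A\<^sup>2) * Q H / sqrt (q t) * sqrt h \<le> (4 + 4 * A\<^sup>2) * Q H / (sqrt k * sqrt h) * sqrt h"
          using h by (intro mult_right_mono) auto
        also have "\<dots> = B * Q H" using h by (simp add: B_def)
        finally show ?thesis .
      qed
      have main: "(w x)\<^sup>2 * sqrt h \<le> B * Q H" if x0: "0 < x" and x: "x \<le> H" and Ex: "E \<le> a x" for x
      proof (cases "0 < q x \<and> 6 * h * a1 x \<le> q x * sqrt (q x)")
        case True
        have "(w x)\<^sup>2 \<le> 2 * Q H / sqrt (q x)" using far[of x] x0 x True by simp
        also have "\<dots> \<le> (4 + 4 * A\<^sup>2) * Q H / sqrt (q x)"
          using QH True by (intro divide_right_mono mult_right_mono) auto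
        finally have "(w x)\<^sup>2 * sqrt h \<le> (4 + 4 * A\<^sup>2) * Q H / sqrt (q x) * sqrt h"
          using h by (intro mult_right_mono) auto
        then show ?thesis using conv[of x] kh[of x] x0 x True by simp
      next
        case False
        have xd: "x < d"
        proof (rule ccontr)
          assume "\<not> x < d"
          then show False using out[of x] qout[of x] x0 x m False by auto
        qed
        have qx: "0 \<le> q x" using Ex by (simp add: q_def)
        have lt: "q x * sqrt (q x) \<le> 6 * h * a1 x"
        proof (cases "0 < q x")
          case False
          then have "q x = 0" using qx by simp
          then show ?thesis using a1_nonneg[of x] x0 x xd h by simp
        qed (use False in auto)
        \<comment> \<open>Up to \<open>s\<close>, at the scale of the Airy function, only the monotonicity of the energy is used.\<close>
        have "\<exists>s. x \<le> s \<and> s \<le> d \<and> q s * sqrt (q s) - 6 * h * a1 s = 0"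
        proof (rule IVT')
          show "q x * sqrt (q x) - 6 * h * a1 x \<le> 0" using lt by simp
          show "0 \<le> q d * sqrt (q d) - 6 * h * a1 d" using out[of d] d by simp
          have "continuous_on {x..d} q" "continuous_on {x..d} a1"
            using dq a1_deriv by (meson DERIV_isCont continuous_at_imp_continuous_on)+
          then show "continuous_on {x..d} (\<lambda>s. q s * sqrt (q s) - 6 * h * a1 s)"
            by (intro continuous_intros)
        qed (use xd in simp)
        then obtain s where s: "x \<le> s" "s \<le> d" and s1: "q s * sqrt (q s) = 6 * h * a1 s" by auto
        have s0: "0 < s" "s \<le> H" using s x0 d by auto
        have a1s: "0 < a1 s" using a1_lower[of s] s s0 c by (smt (verit) mult_pos_pos)
        have qs: "0 < q s"
        proof -
          have "0 < q s * sqrt (q s)" using s1 a1s h by simp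
          then have "q s \<noteq> 0" by auto
          moreover have "0 \<le> q s" using a_mono[of x s] s x0 qx by (simp add: q_def)
          ultimately show ?thesis by simp
        qed
        \<comment> \<open>\<open>a x - c / 2 * x\<^sup>2\<close> increases, so \<open>q s\<close> is
          at least \<open>c / 2 * (s - x) * s\<close>. The equation that defines \<open>s\<close>
          has \<open>a1 s \<le> C * s\<close> on its right side, and \<open>s\<close> can be
          eliminated between the two.\<close>
        have len: "s - x \<le> A * (h / sqrt (q s))"
        proof -
          have "(a x - c / 2 * x\<^sup>2) \<le> (a s - c / 2 * s\<^sup>2)"
          proof (rule DERIV_nonneg_imp_nondecreasing[OF s(1)])
            fix t assume "x \<le> t" "t \<le> s"
            then show "\<exists>e. ((\<lambda>x. a x - c / 2 * x\<^sup>2) has_real_derivative e) (at t) \<and> 0 \<le> e"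
              using a1_lower[of t] s x x0 a_deriv[of t]
              by (intro exI[of _ "a1 t - c * t"]) (auto intro!: derivative_eq_intros)
          qed
          then have "c / 2 * (s\<^sup>2 - x\<^sup>2) \<le> q s" using qx by (simp add: q_def algebra_simps)
          moreover have "(s - x) * s \<le> s\<^sup>2 - x\<^sup>2" using s x0 by (simp add: power2_eq_square algebra_simps)
          then have "c / 2 * ((s - x) * s) \<le> c / 2 * (s\<^sup>2 - x\<^sup>2)" using c by (intro mult_left_mono) auto
          ultimately have 1: "c / 2 * ((s - x) * s) \<le> q s" by linarith
          have "c / 2 * (s - x) * (q s * sqrt (q s)) = 6 * h * (c / 2 * (s - x)) * a1 s" by (simp add: s1)
          also have "\<dots> \<le> 6 * h * (c / 2 * (s - x)) * (C * s)"
            using a1_upper[of s] s0 c s h by (intro mult_left_mono) auto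
          also have "\<dots> = 6 * h * C * (c / 2 * ((s - x) * s))" by simp
          also have "\<dots> \<le> 6 * h * C * q s" using 1 h C by (intro mult_left_mono) auto
          finally have "(c / 2 * (s - x) * sqrt (q s)) * q s \<le> (6 * h * C) * q s" by (simp add: mult_ac)
          then have "c / 2 * (s - x) * sqrt (q s) \<le> 6 * h * C" using qs by simp
          then show ?thesis using c qs by (simp add: A_def field_simps)
        qed
        have e: "energy h q w w1 s \<le> 2 * Q H * sqrt (q s)"
        proof -
          have "energy h q w w1 s = Q s * sqrt (q s)" using qs by (simp add: Q_def action_def)
          also have "\<dots> \<le> 2 * Q H * sqrt (q s)" using far2[of s] s0 s1 qs by (intro mult_right_mono) auto
          finally show ?thesis .
        qed
        have "(w x - w s)\<^sup>2 \<le> (s - x)\<^sup>2 * (energy h q w w1 s / h\<^sup>2)"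
        proof (rule mvt_square_bound[OF schroedingerD(1)[OF ode'] s(1)])
          fix t assume t: "x \<le> t" "t \<le> s"
          have "energy h q w w1 t \<le> energy h q w w1 s"
            by (rule energy_mono[OF ode' h(1) dq t(2)]) (use a1_nonneg t s x0 in auto)
          moreover have "q x \<le> q t" using a_mono[of x t] t s x0 by (simp add: q_def)
          then have "0 \<le> q t * (w t)\<^sup>2" using qx by simp
          ultimately have "h\<^sup>2 * (w1 t)\<^sup>2 \<le> energy h q w w1 s" unfolding energy_def by linarith
          then show "(w1 t)\<^sup>2 \<le> energy h q w w1 s / h\<^sup>2" using h by (simp add: field_simps)
        qed
        also have "\<dots> \<le> (A * (h / sqrt (q s)))\<^sup>2 * ((2 * Q H * sqrt (q s)) / h\<^sup>2)"
        proof (intro mult_mono power_mono divide_right_mono e len)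
          show "0 \<le> energy h q w w1 s / h\<^sup>2" using qs by (simp add: energy_def)
        qed (use s in auto)
        also have "\<dots> = 2 * A\<^sup>2 * Q H / sqrt (q s)"
          using h qs by (simp add: power_mult_distrib power_divide field_simps)
        finally have 1: "(w x - w s)\<^sup>2 \<le> 2 * A\<^sup>2 * Q H / sqrt (q s)" .
        have "(w x)\<^sup>2 \<le> 2 * (w x - w s)\<^sup>2 + 2 * (w s)\<^sup>2" by (rule square_le_twice)
        also have "\<dots> \<le> 2 * (2 * A\<^sup>2 * Q H / sqrt (q s)) + 2 * (2 * Q H / sqrt (q s))"
          using 1 far[of s] s0 s1 qs by (intro add_mono mult_left_mono) auto
        also have "\<dots> = (4 + 4 * A\<^sup>2) * Q H / sqrt (q s)" by (simp add: add_divide_distrib distrib_right)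
        finally have "(w x)\<^sup>2 * sqrt h \<le> (4 + 4 * A\<^sup>2) * Q H / sqrt (q s) * sqrt h"
          using h by (intro mult_right_mono) auto
        then show ?thesis using conv[of s] kh[of s] s0 s1 qs by linarith
      qed
      \<comment> \<open>At \<open>x = 0\<close> the intermediate value argument could return
        \<open>s = 0\<close>, where \<open>q\<close> and \<open>a1\<close> vanish. But there
        \<open>E \<le> a 0\<close> forces \<open>E = 0\<close>; then all points to the right are
        allowed, and their bound passes to the limit.\<close>
      have "(w x)\<^sup>2 * sqrt h \<le> B * Q H"
      proof (cases "x = 0")
        case True
        then have E0: "E \<le> 0" using a_upper[of 0] H_pos Ex by simp
        have "((\<lambda>t. (w t)\<^sup>2 * sqrt h) \<longlongrightarrow> (w 0)\<^sup>2 * sqrt h) (at_right 0)"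
          by (intro tendsto_intros isContD[THEN tendsto_within_subset] DERIV_isCont[OF schroedingerD(1)[OF ode]])
            auto
        moreover have "\<forall>\<^sub>F t in at_right 0. (w t)\<^sup>2 * sqrt h \<le> B * Q H"
          using eventually_at_right_real[OF H_pos]
        proof eventually_elim
          case (elim t)
          have "0 \<le> a t" using a_lower[of t] c elim by (smt (verit) greaterThanLessThan_iff mult_nonneg_nonneg zero_le_power2)
          then show ?case using main[of t] elim E0 by simp
        qed
        ultimately show ?thesis using True by (intro tendsto_upperbound) auto
      qed (use main x Ex in auto)
      then show "(w x)\<^sup>2 * sqrt h \<le> B * action h (\<lambda>x. a x - E) w w1 H" by (simp add: Q_def q_def)
    qed
  qed
qed

abbreviation action_mass_bound where
  "action_mass_bound C' h \<equiv>
     \<forall>E w w1. 0 \<le> E \<longrightarrow> E \<le> c * d\<^sup>2 / 2 \<longrightarrow> schroedinger h (\<lambda>x. a x - E) w w1 \<longrightarrow>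
     action h (\<lambda>x. a x - E) w w1 H \<le> C' * integral {0..H} (\<lambda>x. a x * (w x)\<^sup>2 + h\<^sup>2 * (w1 x)\<^sup>2)"

text \<open>No logarithm is sought here, so it is enough to average over \<open>{H/2..H}\<close>:
  \<open>q\<close> is at least \<open>m\<close> there, and the energy is at most the integrand
  because \<open>E \<ge> 0\<close>.\<close>

lemma below_barrier_mass:
  "\<exists>C\<^sub>1>0. \<forall>\<^sub>F h in at_right 0. action_mass_bound C\<^sub>1 h" (is "\<exists>C>0. \<forall>\<^sub>F h in at_right 0. ?P C h")
proof -
  obtain h0 where h0: "h0 > 0" and "adiabatic_below h0"
    using below_barrier_adiabatic by blast
  note ad = this(2)[rule_format]
  define m where "m = c * d\<^sup>2 / 2"
  have m: "m > 0" using c d by (simp add: m_def)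
  have ev: "\<forall>\<^sub>F h in at_right 0. 0 < h \<and> h < h0 \<and> 6 * h * (\<bar>a1 d\<bar> + 1) \<le> m * sqrt m"
  proof (intro eventually_conj)
    show "\<forall>\<^sub>F h in at_right (0::real). 0 < h" by real_asymp
    show "\<forall>\<^sub>F h in at_right (0::real). h < h0" using h0 by real_asymp
    have "\<forall>\<^sub>F h in at_right 0. 6 * h * A \<le> B" if "A > 0" "B > 0" for A B :: real
      using that by real_asymp
    then show "\<forall>\<^sub>F h in at_right 0. 6 * h * (\<bar>a1 d\<bar> + 1) \<le> m * sqrt m"
      using m by (simp add: add_nonneg_pos)
  qed
  define B where "B = 4 / (sqrt m * H)"
  have B: "B > 0" using m H_pos by (simp add: B_def)
  show ?thesis
  proof (rule exI[of _ B], intro conjI B)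
    show "\<forall>\<^sub>F h in at_right 0. ?P B h"
      using ev
    proof (eventually_elim, intro allI impI, elim conjE)
      fix h E :: real and w w1
      assume h: "0 < h" "h < h0" and h6: "6 * h * (\<bar>a1 d\<bar> + 1) \<le> m * sqrt m"
        and E: "0 \<le> E" "E \<le> c * d\<^sup>2 / 2"
        and ode: "schroedinger h (\<lambda>x. a x - E) w w1"
      define q where "q = (\<lambda>x. a x - E)"
      define Q where "Q = action h q w w1"
      define F where "F = (\<lambda>x. a x * (w x)\<^sup>2 + h\<^sup>2 * (w1 x)\<^sup>2)"
      have qout: "m \<le> q x" if "d \<le> x" "x \<le> H" for x
        using a_lower_outside[OF that] E m by (simp add: q_def m_def)
      have qd: "6 * h * a1 d \<le> q d * sqrt (q d)"
      proof -
        have "6 * h * a1 d \<le> 6 * h * (\<bar>a1 d\<bar> + 1)" using h by (intro mult_left_mono) auto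
        also have "\<dots> \<le> m * sqrt m" by (rule h6)
        also have "\<dots> \<le> q d * sqrt (q d)" using qout[of d] d m by (intro mult_mono) auto
        finally show ?thesis .
      qed
      have cF: "continuous_on A F" for A
        unfolding F_def using a_deriv
        by (intro continuous_intros schroedinger_continuous[OF ode])
          (meson DERIV_isCont continuous_at_imp_continuous_on)
      have F0: "0 \<le> F x" if "0 \<le> x" "x \<le> H" for x
        using a_lower[OF that] c unfolding F_def
        by (smt (verit) mult_nonneg_nonneg zero_le_power2)
      have pt: "Q H \<le> 2 / sqrt m * F y" if y: "H / 2 \<le> y" "y \<le> H" for y
      proof -
        have dy: "d \<le> y" using d y by simp
        have "Q H \<le> 2 * Q y"
          using ad[OF h E _ dy y(2) _ _ ode] qout[of d] qd d m by (simp add: q_def Q_def)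
        also have "Q y \<le> F y / sqrt m" unfolding Q_def action_def
        proof (intro frac_le)
          show "energy h q w w1 y \<le> F y" using E by (simp add: energy_def q_def F_def algebra_simps)
        qed (use F0[of y] y H_pos m qout[of y] dy in auto)
        finally show ?thesis by simp
      qed
      have "H / 2 * Q H = integral {H/2..H} (\<lambda>_. Q H)" using H_pos by simp
      also have "\<dots> \<le> integral {H/2..H} (\<lambda>y. 2 / sqrt m * F y)"
        by (intro integral_le integrable_continuous_real continuous_intros cF) (use pt in auto)
      also have "\<dots> = 2 / sqrt m * integral {H/2..H} F" by simp
      also have "\<dots> \<le> 2 / sqrt m * integral {0..H} F"
        using H_pos m F0 by (intro mult_left_mono integral_subset_le integrable_continuous_real cF) auto
      finally have "Q H \<le> B * integral {0..H} F" using H_pos m by (simp add: B_def field_simps)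
      then show "action h (\<lambda>x. a x - E) w w1 H \<le> B * integral {0..H} (\<lambda>x. a x * (w x)\<^sup>2 + h\<^sup>2 * (w1 x)\<^sup>2)"
        by (simp add: Q_def q_def F_def)
    qed
  qed
qed

section \<open>Sup bounds by the mass on a half well\<close>

lemma above_barrier_log_bound:
  "\<exists>C\<^sub>1>0. \<forall>\<^sub>F h in at_right 0. log_sup_bound a H C\<^sub>1 h" (is "\<exists>C>0. \<forall>\<^sub>F h in at_right 0. ?P C h")
proof -
  obtain K1 C1 where C1: "C1 > 0" and sup: "\<And>h E x w w1. h > 0 \<Longrightarrow> sqrt (K1 * h) \<le> d \<Longrightarrow> 0 \<le> E \<Longrightarrow>
     0 \<le> x \<Longrightarrow> x \<le> H \<Longrightarrow> schroedinger h (\<lambda>x. a x + E) w w1 \<Longrightarrow>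
     (w x)\<^sup>2 * sqrt h \<le> C1 * action h (\<lambda>x. a x + E) w w1 H"
    using above_barrier_sup by metis
  obtain C2 where C2: "C2 > 0" and mass: "\<forall>\<^sub>F h in at_right 0. action_log_bound C2 h"
    using above_barrier_mass by blast
  have ev: "\<forall>\<^sub>F h in at_right 0. 0 < h \<and> h < 1 \<and> sqrt (K1 * h) \<le> d"
  proof (intro eventually_conj)
    show "\<forall>\<^sub>F h in at_right (0::real). 0 < h" "\<forall>\<^sub>F h in at_right (0::real). h < 1" by real_asymp+
    have "((\<lambda>h. sqrt (K1 * h)) \<longlongrightarrow> sqrt (K1 * 0)) (at_right 0)"
      by (intro tendsto_intros)
    then have "\<forall>\<^sub>F h in at_right 0. sqrt (K1 * h) < d" using d by (intro order_tendstoD) auto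
    then show "\<forall>\<^sub>F h in at_right 0. sqrt (K1 * h) \<le> d" by eventually_elim simp
  qed
  show ?thesis
  proof (rule exI[of _ "C1 * C2"], intro conjI)
    show "C1 * C2 > 0" using C1 C2 by simp
    show "\<forall>\<^sub>F h in at_right 0. ?P (C1 * C2) h"
      using ev mass
    proof (eventually_elim, intro allI impI, elim conjE)
      fix h E x w w1
      assume m: "action_log_bound C2 h"
        and h: "0 < h" "h < 1" "sqrt (K1 * h) \<le> d" and E: "0 \<le> E" "E \<le> h powr (1/8)"
        and x: "0 \<le> x" "x \<le> H" and ode: "schroedinger h (\<lambda>x. a x + E) w w1"
      have "((w x)\<^sup>2 * sqrt h) * ln (1/h) \<le> (C1 * action h (\<lambda>x. a x + E) w w1 H) * ln (1/h)"
        using h by (intro mult_right_mono sup[OF h(1,3) E(1) x ode]) auto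
      also have "\<dots> = C1 * (action h (\<lambda>x. a x + E) w w1 H * ln (1/h))" by simp
      also have "\<dots> \<le> C1 * (C2 * integral {0..H} (\<lambda>x. (w x)\<^sup>2))"
        using m E ode C1 by (intro mult_left_mono) auto
      finally show "(w x)\<^sup>2 * (sqrt h * ln (1/h)) \<le> C1 * C2 * integral {0..H} (\<lambda>x. (w x)\<^sup>2)"
        by (simp add: mult_ac)
    qed
  qed
qed

lemma below_barrier_bound:
  "\<exists>C\<^sub>1>0. \<forall>\<^sub>F h in at_right 0. half_sup_bound a H C\<^sub>1 h" (is "\<exists>C>0. \<forall>\<^sub>F h in at_right 0. ?P C h")
proof -
  obtain C1 where C1: "C1 > 0" and sup: "\<forall>\<^sub>F h in at_right 0. sup_action_bound C1 h"
    using below_barrier_sup by blast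
  obtain C2 where C2: "C2 > 0" and mass: "\<forall>\<^sub>F h in at_right 0. action_mass_bound C2 h"
    using below_barrier_mass by blast
  have "0 < c * d\<^sup>2 / 2" using c d by simp
  then have ev: "\<forall>\<^sub>F h in at_right 0. h powr (1/8) \<le> c * d\<^sup>2 / 2"
  proof (rule rev_mp)
    have "\<forall>\<^sub>F h in at_right 0. h powr (1/8) \<le> m" if "m > 0" for m :: real using that by real_asymp
    then show "0 < c * d\<^sup>2 / 2 \<longrightarrow> (\<forall>\<^sub>F h in at_right 0. h powr (1/8) \<le> c * d\<^sup>2 / 2)" by blast
  qed
  show ?thesis
  proof (rule exI[of _ "C1 * C2"], intro conjI)
    show "C1 * C2 > 0" using C1 C2 by simp
    show "\<forall>\<^sub>F h in at_right 0. ?P (C1 * C2) h"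
      using ev sup mass
    proof (eventually_elim, intro allI impI)
      fix h E x w w1
      assume hm: "h powr (1/8) \<le> c * d\<^sup>2 / 2"
        and s: "sup_action_bound C1 h"
        and m: "action_mass_bound C2 h"
        and E: "0 \<le> E" "E \<le> h powr (1/8)"
        and x: "0 \<le> x" "x \<le> H" "E \<le> a x" and ode: "schroedinger h (\<lambda>x. a x - E) w w1"
      have Em: "E \<le> c * d\<^sup>2 / 2" using E hm by simp
      have "(w x)\<^sup>2 * sqrt h \<le> C1 * action h (\<lambda>x. a x - E) w w1 H" using s E Em x ode by blast
      also have "\<dots> \<le> C1 * (C2 * integral {0..H} (\<lambda>x. a x * (w x)\<^sup>2 + h\<^sup>2 * (w1 x)\<^sup>2))"
        using m E Em ode C1 by (intro mult_left_mono) auto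
      finally show "(w x)\<^sup>2 * sqrt h \<le> C1 * C2 * integral {0..H} (\<lambda>x. a x * (w x)\<^sup>2 + h\<^sup>2 * (w1 x)\<^sup>2)"
        by simp
    qed
  qed
qed

end

section \<open>Periodic potentials\<close>

lemma le_of_deriv_le:
  fixes f g :: "real \<Rightarrow> real"
  assumes "x \<le> y" "f x \<le> g x"
    and "\<And>t. (f has_real_derivative f' t) (at t)" "\<And>t. (g has_real_derivative g' t) (at t)"
    and "\<And>t. x \<le> t \<Longrightarrow> t \<le> y \<Longrightarrow> f' t \<le> g' t"
  shows "f y \<le> g y"
proof -
  have "g x - f x \<le> g y - f y"
  proof (rule DERIV_nonneg_imp_nondecreasing[OF assms(1)])
    fix t assume "x \<le> t" "t \<le> y"
    then show "\<exists>e. ((\<lambda>t. g t - f t) has_real_derivative e) (at t) \<and> 0 \<le> e"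
      using assms(3)[of t] assms(4)[of t] assms(5)[of t]
      by (intro exI[of _ "g' t - f' t"]) (auto intro!: derivative_eq_intros)
  qed
  with assms(2) show ?thesis by simp
qed

lemma quadratic_bounds:
  fixes a a1 a2 :: "real \<Rightarrow> real"
  assumes a: "\<And>x. (a has_real_derivative a1 x) (at x)" "\<And>x. (a1 has_real_derivative a2 x) (at x)"
    and zero: "a 0 = 0" "a1 0 = 0"
    and bounds: "\<And>x. 0 \<le> x \<Longrightarrow> x \<le> r \<Longrightarrow> l \<le> a2 x" "\<And>x. 0 \<le> x \<Longrightarrow> x \<le> r \<Longrightarrow> a2 x \<le> u"
    and x: "0 \<le> x" "x \<le> r"
  shows "l * x \<le> a1 x" "a1 x \<le> u * x" "l * x\<^sup>2 / 2 \<le> a x" "a x \<le> u * x\<^sup>2 / 2"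
proof -
  have lin: "((\<lambda>x. k * x) has_real_derivative k) (at t)" for k t :: real
    by (auto intro!: derivative_eq_intros)
  have quad: "((\<lambda>x. k * x\<^sup>2 / 2) has_real_derivative k * t) (at t)" for k t :: real
    by (auto intro!: derivative_eq_intros)
  have 1: "l * y \<le> a1 y" if "0 \<le> y" "y \<le> r" for y
    by (rule le_of_deriv_le[OF that(1) _ lin a(2)]) (use bounds zero that in auto)
  have 2: "a1 y \<le> u * y" if "0 \<le> y" "y \<le> r" for y
    by (rule le_of_deriv_le[OF that(1) _ a(2) lin]) (use bounds zero that in auto)
  show "l * x \<le> a1 x" "a1 x \<le> u * x" using 1 2 x by auto
  show "l * x\<^sup>2 / 2 \<le> a x"
    by (rule le_of_deriv_le[OF x(1) _ quad a(1)]) (use 1 zero x in auto)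
  show "a x \<le> u * x\<^sup>2 / 2"
    by (rule le_of_deriv_le[OF x(1) _ a(1) quad]) (use 2 zero x in auto)
qed

lemma half_well_exists:
  fixes a a1 a2 :: "real \<Rightarrow> real"
  assumes a: "\<And>x. (a has_real_derivative a1 x) (at x)" "\<And>x. (a1 has_real_derivative a2 x) (at x)"
    and cont: "continuous_on UNIV a2"
    and zero: "a 0 = 0" "a1 0 = 0" and nondeg: "a2 0 \<noteq> 0" and H: "0 < H"
    and pos: "\<And>x. 0 < x \<Longrightarrow> x \<le> H \<Longrightarrow> 0 < a x"
  shows "\<exists>c C d. half_well a a1 a2 H c C d"
proof -
  define k where "k = a2 0"
  \<comment> \<open>Why a quarter: with \<open>3/4 * k \<le> a2 \<le> 5/4 * k\<close> the left side
    of \<open>convexity\<close> is at most \<open>25/16\<close> and the right side at least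
    \<open>27/16\<close> times \<open>k^2 * x^2\<close>.\<close>
  obtain r where r: "r > 0" "\<And>x. \<bar>x\<bar> < r \<Longrightarrow> \<bar>a2 x - k\<bar> < \<bar>k\<bar> / 4"
  proof -
    have "isCont a2 0" using cont by (simp add: continuous_on_eq_continuous_at)
    then show ?thesis using that nondeg unfolding continuous_at_eps_delta
      by (metis abs_0_eq diff_zero dist_real_def divide_pos_pos k_def zero_less_abs_iff zero_less_numeral)
  qed
  define d where "d = min (r/2) (H/2)"
  have d: "0 < d" "d < r" "d \<le> H / 2" using r H by (auto simp: d_def)
  have near: "\<bar>a2 x - k\<bar> < \<bar>k\<bar> / 4" if "0 \<le> x" "x \<le> d" for x
    using r(2)[of x] that d by simp
  have k: "k > 0"
  proof (rule ccontr)
    assume "\<not> k > 0"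
    then have k: "k < 0" using nondeg by (simp add: k_def)
    have "a d \<le> (3/4 * k) * d\<^sup>2 / 2"
      by (rule quadratic_bounds(4)[OF a zero, where r = d and l = "5/4*k"]) (use near k d in \<open>fastforce simp: abs_if split: if_splits\<close>)+
    moreover have "(3/4 * k) * d\<^sup>2 / 2 < 0" using k d by (simp add: mult_neg_pos)
    ultimately show False using pos[of d] d H by simp
  qed
  have near': "3/4 * k \<le> a2 x" "a2 x \<le> 5/4 * k" if "0 \<le> x" "x \<le> d" for x
    using near[OF that] k by (auto simp: abs_if split: if_splits)
  have loc: "3/4 * k * x \<le> a1 x" "3/4 * k * x\<^sup>2 / 2 \<le> a x" "a x \<le> 5/4 * k * x\<^sup>2 / 2"
    if "0 \<le> x" "x \<le> d" for x
    using quadratic_bounds[where r = d and x = x, OF a zero _ _ that] near' by blast+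
  obtain B where B: "\<And>x. 0 \<le> x \<Longrightarrow> x \<le> H \<Longrightarrow> \<bar>a2 x\<bar> \<le> B"
  proof -
    have "compact (a2 ` {0..H})" by (intro compact_continuous_image continuous_on_subset[OF cont]) auto
    then obtain B where "\<forall>y\<in>a2 ` {0..H}. \<bar>y\<bar> \<le> B" using compact_imp_bounded bounded_real by metis
    then show ?thesis by (intro that[of B]) auto
  qed
  define C where "C = max 1 B"
  have C: "1 \<le> C" by (simp add: C_def)
  have BC: "- C \<le> a2 x" "a2 x \<le> C" if "0 \<le> x" "x \<le> H" for x
    using B[OF that] by (auto simp: C_def abs_le_iff)
  have glob: "- C * x \<le> a1 x" "a1 x \<le> C * x" "a x \<le> C * x\<^sup>2 / 2"
    if "0 \<le> x" "x \<le> H" for x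
    using quadratic_bounds[where r = H and x = x, OF a zero _ _ that] BC by blast+
  have "continuous_on {d..H} a" using a(1) by (meson DERIV_isCont continuous_at_imp_continuous_on)
  then obtain x0 where x0: "d \<le> x0" "x0 \<le> H" "\<And>x. d \<le> x \<Longrightarrow> x \<le> H \<Longrightarrow> a x0 \<le> a x"
    using continuous_attains_inf[of "{d..H}" a] d H by auto
  have m: "0 < a x0" using pos x0 d by simp
  \<comment> \<open>\<open>3/8 * k\<close> serves on \<open>{0..d}\<close>, the minimum
    \<open>a x0\<close> of \<open>a\<close> on \<open>{d..H}\<close> for the rest.\<close>
  define c where "c = min 1 (min (3/8 * k) (a x0 / H\<^sup>2))"
  have c: "0 < c" "c \<le> 1" "c \<le> 3/8 * k" "c \<le> a x0 / H\<^sup>2"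
    using k m H by (simp add: c_def, simp add: c_def, unfold c_def, linarith+)
  have "half_well a a1 a2 H c C d"
  proof
    show "0 < d" "d \<le> H / 2" "0 < c" "c \<le> 1" "1 \<le> C" by fact+
    show "(a has_real_derivative a1 x) (at x)" "(a1 has_real_derivative a2 x) (at x)" for x by (rule a)+
    fix x :: real assume x: "0 \<le> x"
    { assume xH: "x \<le> H"
      show "c * x\<^sup>2 \<le> a x"
      proof (cases "x \<le> d")
        case True
        have "c * x\<^sup>2 \<le> 3/8 * k * x\<^sup>2" using c by (intro mult_right_mono) auto
        then show ?thesis using loc(2)[OF x True] by simp
      next
        case False
        have "c * x\<^sup>2 \<le> a x0 / H\<^sup>2 * H\<^sup>2" using c x xH m H by (intro mult_mono power_mono) auto
        then show ?thesis using x0(3)[of x] False xH H by simp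
      qed
      show "a x \<le> C * x\<^sup>2"
      proof -
        have "a x \<le> C * x\<^sup>2 / 2" using glob(3)[OF x xH] by simp
        also have "\<dots> \<le> C * x\<^sup>2" using C by simp
        finally show ?thesis .
      qed
      show "\<bar>a1 x\<bar> \<le> C * x" using glob(1,2)[OF x xH] by simp
      show "\<bar>a2 x\<bar> \<le> C" using BC[OF x xH] by simp }
    { assume xd: "x \<le> d"
      have "c * x \<le> 3/4 * k * x" using c k x by (intro mult_right_mono) auto
      then show "c * x \<le> a1 x" using loc(1)[OF x xd] by simp
      have "a x * a2 x \<le> (5/4 * k * x\<^sup>2 / 2) * (5/4 * k)"
        using loc(3)[OF x xd] near'[OF x xd] k by (intro mult_mono) auto
      moreover have "(3/4 * k * x)\<^sup>2 \<le> (a1 x)\<^sup>2" using loc(1)[OF x xd] k x by (intro power_mono) auto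
      moreover have "25/16 * (k\<^sup>2 * x\<^sup>2) \<le> 27/16 * (k\<^sup>2 * x\<^sup>2)" by (intro mult_right_mono) auto
      ultimately show "2 * a x * a2 x \<le> 3 * (a1 x)\<^sup>2"
        by (simp add: power2_eq_square algebra_simps) }
  qed
  then show ?thesis by blast
qed

text \<open>\<open>\<sigma>\<close> is 1 or -1. The reflection is what lets the left side of a zero
  be read as a half well; a second derivative does not see the sign.\<close>

lemma schroedinger_affine:
  assumes "schroedinger h q w w1" "\<sigma> * \<sigma> = 1"
  shows "schroedinger h (\<lambda>t. q (z + \<sigma> * t)) (\<lambda>t. w (z + \<sigma> * t)) (\<lambda>t. \<sigma> * w1 (z + \<sigma> * t))"
proof -
  have lin: "((\<lambda>t. z + \<sigma> * t) has_real_derivative \<sigma>) (at x)" for x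
    by (auto intro!: derivative_eq_intros)
  have 1: "((\<lambda>t. w (z + \<sigma> * t)) has_real_derivative w1 (z + \<sigma> * x) * \<sigma>) (at x)" for x
    using DERIV_chain2[OF schroedingerD(1)[OF assms(1)] lin] .
  have "((\<lambda>t. w1 (z + \<sigma> * t)) has_real_derivative (- (q (z + \<sigma> * x) / h\<^sup>2) * w (z + \<sigma> * x)) * \<sigma>) (at x)" for x
    using DERIV_chain2[OF schroedingerD(2)[OF assms(1)] lin] .
  then have 2: "((\<lambda>t. \<sigma> * w1 (z + \<sigma> * t)) has_real_derivative (\<sigma> * \<sigma>) * (- (q (z + \<sigma> * x) / h\<^sup>2) * w (z + \<sigma> * x))) (at x)" for x
    by (rule DERIV_cong[OF DERIV_cmult]) (simp add: mult_ac)
  show ?thesis unfolding schroedinger_def using 1 2 assms(2) by (simp add: mult.commute)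
qed

lemma integral_affine_le:
  fixes F :: "real \<Rightarrow> real"
  assumes F: "continuous_on UNIV F" "\<And>x. 0 \<le> F x" and \<sigma>: "\<sigma> = 1 \<or> \<sigma> = -1"
    and H: "0 \<le> H" and z: "0 \<le> z" "z \<le> L" "0 \<le> z + \<sigma> * H" "z + \<sigma> * H \<le> L"
  shows "integral {0..H} (\<lambda>t. F (z + \<sigma> * t)) \<le> integral {0..L} F"
proof -
  have int: "F integrable_on {u..v}" for u v
    by (intro integrable_continuous_real continuous_on_subset[OF F(1)]) auto
  have sub: "integral {u..v} F \<le> integral {0..L} F" if "0 \<le> u" "v \<le> L" for u v
    using that F int by (intro integral_subset_le) auto
  show ?thesis
  proof (cases "\<sigma> = 1")
    case True
    have "integral {0..H} (F \<circ> (\<lambda>x. x + z)) = integral {0 + z..H + z} F"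
      by (rule integral_shift) (intro continuous_on_subset[OF F(1)], auto)
    then show ?thesis using sub[of z "H + z"] True z by (simp add: o_def add.commute)
  next
    case False
    then have s: "\<sigma> = -1" using \<sigma> by simp
    have "integral {0..H} (\<lambda>t. F (z - t)) = integral {-H..0} (\<lambda>t. F (z + t))"
      using Henstock_Kurzweil_Integration.integral_reflect_real[of H 0 "\<lambda>t. F (z - t)"] by simp
    also have "\<dots> = integral {-H..0} (F \<circ> (\<lambda>x. x + z))" by (simp add: o_def add.commute)
    also have "\<dots> = integral {-H + z..0 + z} F"
      by (rule integral_shift) (intro continuous_on_subset[OF F(1)], auto)
    finally show ?thesis using sub[of "z - H" z] s z by simp
  qed
qed

lemma finite_uniform_constant:
  fixes R :: "real \<Rightarrow> 'p \<Rightarrow> 'h \<Rightarrow> bool"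
  assumes "finite P" "\<And>p. p \<in> P \<Longrightarrow> \<exists>C>0. \<forall>\<^sub>F h in F. R C p h"
    and mono: "\<And>C C' p h. 0 < C \<Longrightarrow> C \<le> C' \<Longrightarrow> R C p h \<Longrightarrow> R C' p h"
  shows "\<exists>C>0. \<forall>\<^sub>F h in F. \<forall>p\<in>P. R C p h"
proof -
  from assms(2) obtain f where f: "\<And>p. p \<in> P \<Longrightarrow> f p > 0" "\<And>p. p \<in> P \<Longrightarrow> \<forall>\<^sub>F h in F. R (f p) p h"
    by metis
  \<comment> \<open>The 1 keeps the constant positive if \<open>P\<close> is empty.\<close>
  define C where "C = 1 + sum f P"
  have "f p \<le> C" if "p \<in> P" for p
    using member_le_sum[of p P f] assms(1) f(1) that by (fastforce simp: C_def less_imp_le)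
  then have "\<forall>p\<in>P. \<forall>\<^sub>F h in F. R C p h"
    using f mono by (blast intro: eventually_mono)
  then have "\<forall>\<^sub>F h in F. \<forall>p\<in>P. R C p h" using assms(1) by (simp add: eventually_ball_finite)
  moreover have "C > 0" using sum_nonneg[of P f] f(1) by (fastforce simp: C_def less_imp_le)
  ultimately show ?thesis by blast
qed

section \<open>Maximum principle and virial identity for periodic solutions\<close>

lemma deriv_periodic:
  fixes f f' :: "real \<Rightarrow> real"
  assumes "\<And>x. (f has_real_derivative f' x) (at x)" "\<And>x. f (x + L) = f x"
  shows "f' (x + L) = f' x"
proof -
  have "((\<lambda>x. f (x + L)) has_real_derivative f' (x + L)) (at x)"
    using assms(1)[of "x + L"] by (simp add: DERIV_shift)
  moreover have "(\<lambda>x. f (x + L)) = f" using assms(2) by blast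
  ultimately show ?thesis using assms(1)[of x] by (metis DERIV_unique)
qed

text \<open>At a maximum of \<open>w^2\<close> with \<open>w \<noteq> 0\<close> the derivative
  \<open>w1\<close> vanishes and \<open>(w^2)'' = - 2 * q * w^2 / h^2\<close>, so \<open>q\<close>
  cannot be negative. Periodicity makes a maximum at an end of \<open>{0..L}\<close> a local one as
  well.\<close>

lemma schroedinger_max:
  fixes L :: real
  assumes ode: "schroedinger h q w w1" and h: "h > 0" and L: "L > 0" and per: "\<And>x. w (x + L) = w x"
  obtains x where "0 \<le> x" "x \<le> L" "\<And>y. 0 \<le> y \<Longrightarrow> y \<le> L \<Longrightarrow> (w y)\<^sup>2 \<le> (w x)\<^sup>2"
    "w x = 0 \<or> 0 \<le> q x"
proof -
  have "continuous_on {0..L} (\<lambda>x. (w x)\<^sup>2)" by (intro continuous_intros schroedinger_continuous[OF ode])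
  then obtain x where x: "0 \<le> x" "x \<le> L" and mx: "\<And>y. 0 \<le> y \<Longrightarrow> y \<le> L \<Longrightarrow> (w y)\<^sup>2 \<le> (w x)\<^sup>2"
    using continuous_attains_sup[of "{0..L}" "\<lambda>x. (w x)\<^sup>2"] L by auto
  have loc: "(w y)\<^sup>2 \<le> (w x)\<^sup>2" if "\<bar>y - x\<bar> < L" for y
  proof (cases "y < 0")
    case True
    then show ?thesis using mx[of "y + L"] per[of y] that x by auto
  next
    case False
    then show ?thesis using mx[of y] mx[of "y - L"] per[of "y - L"] that x by (cases "y \<le> L") auto
  qed
  define u' where "u' = (\<lambda>y. 2 * (w y * w1 y))"
  have u: "((\<lambda>y. (w y)\<^sup>2) has_real_derivative u' y) (at y)" for y
    unfolding u'_def by (auto intro!: derivative_eq_intros schroedingerD[OF ode])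
  have u0: "u' x = 0"
    by (rule DERIV_local_max[OF u L]) (use loc in \<open>auto simp: abs_minus_commute\<close>)
  have "w x = 0 \<or> 0 \<le> q x"
  proof (rule ccontr)
    assume neg: "\<not> (w x = 0 \<or> 0 \<le> q x)"
    then have w1: "w1 x = 0" using u0 by (simp add: u'_def)
    have "(u' has_real_derivative 2 * (w1 x * w1 x + (- (q x / h\<^sup>2) * w x) * w x)) (at x)"
      unfolding u'_def by (intro DERIV_cmult DERIV_mult schroedingerD[OF ode])
    moreover have "0 < - q x * (w x)\<^sup>2" using neg by (intro mult_pos_pos) auto
    then have "2 * (w1 x * w1 x + (- (q x / h\<^sup>2) * w x) * w x) > 0" using h w1
      by (simp add: power2_eq_square field_simps)
    ultimately obtain e where e: "e > 0" "\<And>t. 0 < t \<Longrightarrow> t < e \<Longrightarrow> u' x < u' (x + t)"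
      using DERIV_pos_inc_right[of u' _ x] by blast
    define t where "t = min e L / 2"
    have t: "0 < t" "t < e" "t < L" using e L by (auto simp: t_def)
    have "x < x + t" using t by simp
    from MVT2[OF this u] obtain y where y: "x < y" "y < x + t"
      "(w (x + t))\<^sup>2 - (w x)\<^sup>2 = (x + t - x) * u' y" by blast
    have "u' y > 0" using e(2)[of "y - x"] y t u0 by simp
    then have "(w (x + t))\<^sup>2 > (w x)\<^sup>2" using y(3) t by (simp add: field_simps)
    then show False using loc[of "x + t"] t by simp
  qed
  with x mx show ?thesis by (intro that)
qed

text \<open>Integrate the derivative of \<open>h\<^sup>2 * (w x * w1 x)\<close> over a period; the
  boundary terms cancel.\<close>

lemma schroedinger_virial:
  assumes ode: "schroedinger h q w w1" and h: "h > 0" and L: "L \<ge> 0" and per: "\<And>x. w (x + L) = w x"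
    and q: "continuous_on {0..L} q"
  shows "integral {0..L} (\<lambda>x. h\<^sup>2 * (w1 x)\<^sup>2) = integral {0..L} (\<lambda>x. q x * (w x)\<^sup>2)"
proof -
  have w1per: "w1 (x + L) = w1 x" for x by (rule deriv_periodic[OF schroedingerD(1)[OF ode] per])
  have c: "continuous_on {0..L} (\<lambda>x. h\<^sup>2 * (w1 x)\<^sup>2)" "continuous_on {0..L} (\<lambda>x. q x * (w x)\<^sup>2)"
    by (intro continuous_intros schroedinger_continuous[OF ode] q)+
  have d: "((\<lambda>x. h\<^sup>2 * (w x * w1 x)) has_real_derivative h\<^sup>2 * (w1 x)\<^sup>2 - q x * (w x)\<^sup>2) (at x)" for x
    by (rule DERIV_cong[OF DERIV_cmult[OF DERIV_mult[OF schroedingerD[OF ode]]]])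
      (use h in \<open>simp add: field_simps power2_eq_square\<close>)
  have "((\<lambda>x. h\<^sup>2 * (w1 x)\<^sup>2 - q x * (w x)\<^sup>2) has_integral h\<^sup>2 * (w L * w1 L) - h\<^sup>2 * (w 0 * w1 0)) {0..L}"
    by (rule fundamental_theorem_of_calculus[OF L])
      (use d in \<open>simp add: has_real_derivative_iff_has_vector_derivative[symmetric] has_field_derivative_at_within\<close>)
  then have "integral {0..L} (\<lambda>x. h\<^sup>2 * (w1 x)\<^sup>2 - q x * (w x)\<^sup>2) = 0"
    using per[of 0] w1per[of 0] by (simp add: integral_unique)
  then show ?thesis using c by (simp add: integral_diff integrable_continuous_real)
qed

text \<open>The derivative \<open>q1 * w^2\<close> limits the oscillation of the energy to
  \<open>A\<close> times the mass, and the mean of the energy is known: by the virial identity it is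
  twice the mean of \<open>q * w^2\<close>.\<close>

lemma periodic_energy_bound:
  fixes L :: real
  assumes ode: "schroedinger h q w w1" and h: "h > 0" and L: "L > 0" and per: "\<And>x. w (x + L) = w x"
    and q: "\<And>x. (q has_real_derivative q1 x) (at x)" and q1: "continuous_on UNIV q1"
    and A: "\<And>x. 0 \<le> x \<Longrightarrow> x \<le> L \<Longrightarrow> \<bar>q1 x\<bar> \<le> A"
    and x: "0 \<le> x" "x \<le> L"
  shows "energy h q w w1 x \<le> 2 / L * integral {0..L} (\<lambda>x. q x * (w x)\<^sup>2) + A * integral {0..L} (\<lambda>x. (w x)\<^sup>2)"
proof -
  define N where "N = integral {0..L} (\<lambda>x. (w x)\<^sup>2)"
  define e where "e = energy h q w w1"
  note cw = schroedinger_continuous[OF ode]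
  have cq: "continuous_on S q" for S using q by (meson DERIV_isCont continuous_at_imp_continuous_on)
  have cq1: "continuous_on S q1" for S using q1 continuous_on_subset by blast
  have A0: "0 \<le> A" using A[OF x] by simp
  have osc: "\<bar>e v - e u\<bar> \<le> A * N" if "0 \<le> u" "u \<le> v" "v \<le> L" for u v
  proof -
    have "((\<lambda>x. q1 x * (w x)\<^sup>2) has_integral e v - e u) {u..v}"
      unfolding e_def using energy_deriv[OF ode h q]
      by (intro fundamental_theorem_of_calculus that)
        (simp add: has_real_derivative_iff_has_vector_derivative[symmetric] has_field_derivative_at_within)
    then have "e v - e u = integral {u..v} (\<lambda>x. q1 x * (w x)\<^sup>2)" by (simp add: integral_unique)
    also have "norm \<dots> \<le> integral {u..v} (\<lambda>x. A * (w x)\<^sup>2)"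
      by (rule integral_norm_bound_integral)
        (use that A in \<open>auto intro!: integrable_continuous_real continuous_intros cw cq1 mult_right_mono simp: abs_mult\<close>)
    also have "\<dots> \<le> integral {0..L} (\<lambda>x. A * (w x)\<^sup>2)"
      using that A0 by (intro integral_subset_le integrable_continuous_real continuous_intros cw) auto
    finally show ?thesis by (simp add: N_def)
  qed
  have osc': "e x \<le> e y + A * N" if "0 \<le> y" "y \<le> L" for y
    using osc[of x y] osc[of y x] x that by (cases "x \<le> y") (auto simp: abs_le_iff)
  have ce: "continuous_on {0..L} e" unfolding e_def energy_def[abs_def]
    by (intro continuous_intros cw cq)
  have "L * e x = integral {0..L} (\<lambda>_. e x)" using L by simp
  also have "\<dots> \<le> integral {0..L} (\<lambda>y. e y + A * N)"
    by (intro integral_le integrable_continuous_real continuous_intros ce) (use osc' in auto)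
  also have "\<dots> = integral {0..L} e + L * (A * N)"
    using L by (subst integral_add) (auto intro!: integrable_continuous_real ce)
  also have "integral {0..L} e = integral {0..L} (\<lambda>x. h\<^sup>2 * (w1 x)\<^sup>2) + integral {0..L} (\<lambda>x. q x * (w x)\<^sup>2)"
    unfolding e_def energy_def[abs_def]
    by (intro integral_add integrable_continuous_real continuous_intros cw cq)
  also have "integral {0..L} (\<lambda>x. h\<^sup>2 * (w1 x)\<^sup>2) = integral {0..L} (\<lambda>x. q x * (w x)\<^sup>2)"
    by (rule schroedinger_virial[OF ode h _ per cq]) (use L in auto)
  finally show ?thesis using L by (simp add: e_def N_def field_simps)
qed

section \<open>Wells with two nondegenerate zeros per period\<close>

locale periodic_well =
  fixes a a1 a2 :: "real \<Rightarrow> real" and T :: real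
  assumes T: "T > 0"
    and a_deriv: "\<And>x. (a has_real_derivative a1 x) (at x)"
    and a1_deriv: "\<And>x. (a1 has_real_derivative a2 x) (at x)"
    and a2_cont: "continuous_on UNIV a2"
    and periodic: "\<And>x. a (x + 2 * T) = a x"
    and zero: "a 0 = 0" "a1 0 = 0" "a2 0 \<noteq> 0" "a T = 0" "a1 T = 0" "a2 T \<noteq> 0"
    and pos: "\<And>x. 0 < x \<Longrightarrow> x < 2 * T \<Longrightarrow> x \<noteq> T \<Longrightarrow> 0 < a x"
    and nonneg: "\<And>x. 0 \<le> a x"
begin

lemma a_cont: "continuous_on A a"
  using a_deriv by (meson DERIV_isCont continuous_at_imp_continuous_on)

lemma a1_cont: "continuous_on A a1"
  using a1_deriv by (meson DERIV_isCont continuous_at_imp_continuous_on)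

text \<open>A pair \<open>(z, \<sigma>)\<close> stands for the quarter period \<open>z + \<sigma> t\<close>, \<open>0 \<le> t \<le> T / 2\<close>, that starts at the zero
  \<open>z\<close> of \<open>a\<close>.\<close>

definition pieces :: "(real \<times> real) set" where
  "pieces = {(0, 1), (T, -1), (T, 1), (2 * T, -1)}"

lemma piece_cases:
  assumes "0 \<le> x" "x \<le> 2 * T"
  obtains z \<sigma> t where "(z, \<sigma>) \<in> pieces" "0 \<le> t" "t \<le> T / 2" "x = z + \<sigma> * t"
proof -
  consider "x \<le> T/2" | "T/2 \<le> x" "x \<le> T" | "T \<le> x" "x \<le> 3/2*T" | "3/2*T \<le> x" by linarith
  then show ?thesis
  proof cases
    case 1 then show ?thesis using assms by (intro that[of 0 1 x]) (auto simp: pieces_def)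
  next
    case 2 then show ?thesis using assms by (intro that[of T "-1" "T - x"]) (auto simp: pieces_def)
  next
    case 3 then show ?thesis using assms by (intro that[of T 1 "x - T"]) (auto simp: pieces_def)
  next
    case 4 then show ?thesis using assms by (intro that[of "2*T" "-1" "2*T - x"]) (auto simp: pieces_def)
  qed
qed

lemma piece_well:
  assumes "(z, \<sigma>) \<in> pieces"
  shows "\<exists>c C d. half_well (\<lambda>t. a (z + \<sigma> * t)) (\<lambda>t. \<sigma> * a1 (z + \<sigma> * t)) (\<lambda>t. a2 (z + \<sigma> * t)) (T / 2) c C d"
proof (rule half_well_exists)
  have \<sigma>: "\<sigma> * \<sigma> = 1" using assms by (auto simp: pieces_def)
  have lin: "((\<lambda>t. z + \<sigma> * t) has_real_derivative \<sigma>) (at x)" for x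
    by (auto intro!: derivative_eq_intros)
  show "((\<lambda>t. a (z + \<sigma> * t)) has_real_derivative \<sigma> * a1 (z + \<sigma> * x)) (at x)" for x
    by (rule DERIV_cong[OF DERIV_chain2[OF a_deriv lin]]) (simp add: mult.commute)
  show "((\<lambda>t. \<sigma> * a1 (z + \<sigma> * t)) has_real_derivative a2 (z + \<sigma> * x)) (at x)" for x
    by (rule DERIV_cong[OF DERIV_cmult[OF DERIV_chain2[OF a1_deriv lin]]]) (use \<sigma> in \<open>simp add: mult_ac\<close>)
  show "continuous_on UNIV (\<lambda>t. a2 (z + \<sigma> * t))"
    by (intro continuous_on_compose2[OF a2_cont] continuous_intros) auto
  have p: "a (2 * T) = a 0" "a1 (2 * T) = a1 0" "a2 (2 * T) = a2 0"
    using periodic[of 0] deriv_periodic[OF a_deriv periodic, of 0]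
      deriv_periodic[OF a1_deriv deriv_periodic[OF a_deriv periodic], of 0] by auto
  show "a (z + \<sigma> * 0) = 0" "\<sigma> * a1 (z + \<sigma> * 0) = 0" "a2 (z + \<sigma> * 0) \<noteq> 0"
    using assms zero p by (auto simp: pieces_def)
  show "0 < T / 2" using T by simp
  show "0 < a (z + \<sigma> * x)" if "0 < x" "x \<le> T / 2" for x
    using assms that T by (auto simp: pieces_def intro!: pos)
qed

lemma piece_integral_le:
  fixes F :: "real \<Rightarrow> real"
  assumes "(z, \<sigma>) \<in> pieces" "continuous_on UNIV F" "\<And>x. 0 \<le> F x"
  shows "integral {0..T/2} (\<lambda>t. F (z + \<sigma> * t)) \<le> integral {0..2*T} F"
  by (rule integral_affine_le) (use assms T in \<open>auto simp: pieces_def\<close>)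

lemma piece_square: "(z, \<sigma>) \<in> pieces \<Longrightarrow> \<sigma> * \<sigma> = 1"
  by (auto simp: pieces_def)

lemma above_barrier:
  "\<exists>C>0. \<forall>\<^sub>F h in at_right 0. log_sup_bound a (2 * T) C h" (is "\<exists>C>0. \<forall>\<^sub>F h in at_right 0. ?P C h")
proof -
  define R where "R = (\<lambda>C (z, \<sigma>) h. log_sup_bound (\<lambda>x. a (z + \<sigma> * x)) (T / 2) C h)"
  have "\<exists>C>0. \<forall>\<^sub>F h in at_right 0. \<forall>p\<in>pieces. R C p h"
  proof (rule finite_uniform_constant)
    show "finite pieces" by (simp add: pieces_def)
    fix p assume p: "p \<in> pieces"
    obtain z \<sigma> where z: "p = (z, \<sigma>)" by fastforce
    obtain c C d where hw: "half_well (\<lambda>t. a (z + \<sigma> * t)) (\<lambda>t. \<sigma> * a1 (z + \<sigma> * t)) (\<lambda>t. a2 (z + \<sigma> * t)) (T / 2) c C d"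
      using piece_well p z by blast
    show "\<exists>C>0. \<forall>\<^sub>F h in at_right 0. R C p h"
      unfolding R_def z using half_well.above_barrier_log_bound[OF hw] by simp
  next
    fix C C' :: real and p h assume C: "0 < C" "C \<le> C'" "R C p h"
    obtain z \<sigma> where z: "p = (z, \<sigma>)" by fastforce
    show "R C' p h" unfolding R_def z
    proof (clarify)
      fix E x w w1 assume *: "0 \<le> E" "E \<le> h powr (1/8)" "0 \<le> x" "x \<le> T/2"
        "schroedinger h (\<lambda>x. a (z + \<sigma> * x) + E) w w1"
      have "(w x)\<^sup>2 * (sqrt h * ln (1/h)) \<le> C * integral {0..T/2} (\<lambda>x. (w x)\<^sup>2)"
        using C(3) * unfolding R_def z by blast
      also have "\<dots> \<le> C' * integral {0..T/2} (\<lambda>x. (w x)\<^sup>2)"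
        using C by (intro mult_right_mono integral_nonneg integrable_continuous_real continuous_intros
            schroedinger_continuous[OF *(5)]) auto
      finally show "(w x)\<^sup>2 * (sqrt h * ln (1/h)) \<le> C' * integral {0..T/2} (\<lambda>x. (w x)\<^sup>2)" .
    qed
  qed
  then obtain C where C: "C > 0" and ev: "\<forall>\<^sub>F h in at_right 0. \<forall>p\<in>pieces. R C p h" by blast
  show ?thesis
  proof (rule exI[of _ C], intro conjI C)
    show "\<forall>\<^sub>F h in at_right 0. ?P C h"
      using ev
    proof (eventually_elim, intro allI impI)
      fix h E x w w1
      assume R: "\<forall>p\<in>pieces. R C p h" and E: "0 \<le> E" "E \<le> h powr (1/8)" and x: "0 \<le> x" "x \<le> 2 * T"
        and ode: "schroedinger h (\<lambda>x. a x + E) w w1"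
      obtain z \<sigma> t where p: "(z, \<sigma>) \<in> pieces" "0 \<le> t" "t \<le> T / 2" "x = z + \<sigma> * t"
        using piece_cases[OF x] by blast
      have "(w x)\<^sup>2 * (sqrt h * ln (1/h)) \<le> C * integral {0..T/2} (\<lambda>t. (w (z + \<sigma> * t))\<^sup>2)"
        using bspec[OF R p(1)] schroedinger_affine[OF ode piece_square[OF p(1)], of z] E p
        unfolding R_def by auto
      also have "\<dots> \<le> C * integral {0..2*T} (\<lambda>x. (w x)\<^sup>2)"
        using C by (intro mult_left_mono piece_integral_le[OF p(1), of "\<lambda>x. (w x)\<^sup>2"] continuous_intros
            schroedinger_continuous[OF ode]) auto
      finally show "(w x)\<^sup>2 * (sqrt h * ln (1/h)) \<le> C * integral {0..2*T} (\<lambda>x. (w x)\<^sup>2)" .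
    qed
  qed
qed

text \<open>The maximum principle moves the point to one with \<open>E \<le> a\<close>, as
  \<open>half_sup_bound\<close> requires. The virial identity then bounds the kinetic mass by the
  potential mass, hence the factor 2.\<close>

lemma below_barrier:
  "\<exists>C>0. \<forall>\<^sub>F h in at_right 0. periodic_sup_bound a (2 * T) C h" (is "\<exists>C>0. \<forall>\<^sub>F h in at_right 0. ?P C h")
proof -
  define R where "R = (\<lambda>C (z, \<sigma>) h. half_sup_bound (\<lambda>x. a (z + \<sigma> * x)) (T / 2) C h)"
  have "\<exists>C>0. \<forall>\<^sub>F h in at_right 0. \<forall>p\<in>pieces. R C p h"
  proof (rule finite_uniform_constant)
    show "finite pieces" by (simp add: pieces_def)
    fix p assume p: "p \<in> pieces"
    obtain z \<sigma> where z: "p = (z, \<sigma>)" by fastforce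
    obtain c C d where hw: "half_well (\<lambda>t. a (z + \<sigma> * t)) (\<lambda>t. \<sigma> * a1 (z + \<sigma> * t)) (\<lambda>t. a2 (z + \<sigma> * t)) (T / 2) c C d"
      using piece_well p z by blast
    show "\<exists>C>0. \<forall>\<^sub>F h in at_right 0. R C p h"
      unfolding R_def z using half_well.below_barrier_bound[OF hw] by simp
  next
    fix C C' :: real and p h assume C: "0 < C" "C \<le> C'" "R C p h"
    obtain z \<sigma> where z: "p = (z, \<sigma>)" by fastforce
    show "R C' p h" unfolding R_def z
    proof (clarify)
      fix E x w w1 assume *: "0 \<le> E" "E \<le> h powr (1/8)" "0 \<le> x" "x \<le> T/2" "E \<le> a (z + \<sigma> * x)"
        "schroedinger h (\<lambda>x. a (z + \<sigma> * x) - E) w w1"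
      have "(w x)\<^sup>2 * sqrt h \<le> C * integral {0..T/2} (\<lambda>x. a (z + \<sigma> * x) * (w x)\<^sup>2 + h\<^sup>2 * (w1 x)\<^sup>2)"
        using C(3) * unfolding R_def z by blast
      also have "\<dots> \<le> C' * integral {0..T/2} (\<lambda>x. a (z + \<sigma> * x) * (w x)\<^sup>2 + h\<^sup>2 * (w1 x)\<^sup>2)"
        using C nonneg by (intro mult_right_mono integral_nonneg integrable_continuous_real continuous_intros
            schroedinger_continuous[OF *(6)] continuous_on_compose2[OF a_cont[of UNIV]]) auto
      finally show "(w x)\<^sup>2 * sqrt h \<le> C' * integral {0..T/2} (\<lambda>x. a (z + \<sigma> * x) * (w x)\<^sup>2 + h\<^sup>2 * (w1 x)\<^sup>2)" .
    qed
  qed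
  then obtain C where C: "C > 0" and ev: "\<forall>\<^sub>F h in at_right 0. \<forall>p\<in>pieces. R C p h" by blast
  have evp: "\<forall>\<^sub>F h in at_right (0::real). 0 < h" by real_asymp
  show ?thesis
  proof (rule exI[of _ "2 * C"], intro conjI)
    show "2 * C > 0" using C by simp
    show "\<forall>\<^sub>F h in at_right 0. ?P (2 * C) h"
      using ev evp
    proof (eventually_elim, intro allI impI)
      fix h E x w w1
      assume R: "\<forall>p\<in>pieces. R C p h" and h: "0 < h" and E: "0 \<le> E" "E \<le> h powr (1/8)"
        and x: "0 \<le> x" "x \<le> 2 * T"
        and ode: "schroedinger h (\<lambda>x. a x - E) w w1" and per: "\<forall>x. w (x + 2 * T) = w x"
      define F where "F = (\<lambda>x. a x * (w x)\<^sup>2 + h\<^sup>2 * (w1 x)\<^sup>2)"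
      note cw = schroedinger_continuous[OF ode]
      have cF: "continuous_on UNIV F" unfolding F_def by (intro continuous_intros cw a_cont)
      have F0: "0 \<le> F x" for x using nonneg by (simp add: F_def)
      have T2: "0 < 2 * T" using T by simp
      have per': "w (x + 2 * T) = w x" for x using per by blast
      obtain y where y: "0 \<le> y" "y \<le> 2 * T" "\<And>x. 0 \<le> x \<Longrightarrow> x \<le> 2 * T \<Longrightarrow> (w x)\<^sup>2 \<le> (w y)\<^sup>2"
        "w y = 0 \<or> 0 \<le> a y - E"
        using schroedinger_max[OF ode h T2 per'] by blast
      have "(w y)\<^sup>2 * sqrt h \<le> C * integral {0..2*T} F"
      proof (cases "w y = 0")
        case True
        then show ?thesis using C F0 cF
          by (simp add: integral_nonneg integrable_continuous_real continuous_on_subset[OF cF])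
      next
        case False
        obtain z \<sigma> t where p: "(z, \<sigma>) \<in> pieces" "0 \<le> t" "t \<le> T / 2" "y = z + \<sigma> * t"
          using piece_cases[OF y(1,2)] by blast
        have s: "\<sigma>\<^sup>2 = 1" using piece_square[OF p(1)] by (simp add: power2_eq_square)
        have "(w y)\<^sup>2 * sqrt h \<le> C * integral {0..T/2} (\<lambda>t. a (z + \<sigma> * t) * (w (z + \<sigma> * t))\<^sup>2 + h\<^sup>2 * (\<sigma> * w1 (z + \<sigma> * t))\<^sup>2)"
          using bspec[OF R p(1)] schroedinger_affine[OF ode piece_square[OF p(1)], of z] E p y(4) False
          unfolding R_def by auto
        also have "\<dots> = C * integral {0..T/2} (\<lambda>t. F (z + \<sigma> * t))"
          by (simp add: F_def power_mult_distrib s)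
        also have "\<dots> \<le> C * integral {0..2*T} F"
          using C F0 cF by (intro mult_left_mono piece_integral_le[OF p(1)]) auto
        finally show ?thesis .
      qed
      also have "integral {0..2*T} F = integral {0..2*T} (\<lambda>x. a x * (w x)\<^sup>2) + integral {0..2*T} (\<lambda>x. h\<^sup>2 * (w1 x)\<^sup>2)"
        unfolding F_def by (intro integral_add integrable_continuous_real continuous_intros cw a_cont)
      also have "integral {0..2*T} (\<lambda>x. h\<^sup>2 * (w1 x)\<^sup>2) = integral {0..2*T} (\<lambda>x. (a x - E) * (w x)\<^sup>2)"
        by (rule schroedinger_virial[OF ode h]) (use T per in \<open>auto intro!: continuous_intros a_cont\<close>)
      also have "\<dots> \<le> integral {0..2*T} (\<lambda>x. a x * (w x)\<^sup>2)"
        by (intro integral_le integrable_continuous_real continuous_intros cw a_cont mult_right_mono) (use E in auto)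
      finally have "(w y)\<^sup>2 * sqrt h \<le> 2 * C * integral {0..2*T} (\<lambda>x. a x * (w x)\<^sup>2)"
        using C by (simp add: mult_ac)
      moreover have "(w x)\<^sup>2 * sqrt h \<le> (w y)\<^sup>2 * sqrt h" using y(3)[OF x] h by (intro mult_right_mono) auto
      ultimately show "(w x)\<^sup>2 * sqrt h \<le> 2 * C * integral {0..2*T} (\<lambda>x. a x * (w x)\<^sup>2)" by simp
    qed
  qed
qed

text \<open>The kinetic side of the virial identity is nonnegative. For energies that are not small
  this turns plain mass into mass weighted by the potential at the cost of
  \<open>1 / E\<close>.\<close>

lemma energy_le_potential:
  assumes h: "h > 0" and ode: "schroedinger h (\<lambda>x. a x - E) w w1" and per: "\<And>x. w (x + 2 * T) = w x"
  shows "E * integral {0..2*T} (\<lambda>x. (w x)\<^sup>2) \<le> integral {0..2*T} (\<lambda>x. a x * (w x)\<^sup>2)"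
proof -
  note cw = schroedinger_continuous[OF ode]
  have "0 \<le> integral {0..2*T} (\<lambda>x. h\<^sup>2 * (w1 x)\<^sup>2)"
    by (intro integral_nonneg integrable_continuous_real continuous_intros cw) auto
  also have "\<dots> = integral {0..2*T} (\<lambda>x. (a x - E) * (w x)\<^sup>2)"
    by (rule schroedinger_virial[OF ode h]) (use T per in \<open>auto intro!: continuous_intros a_cont\<close>)
  also have "\<dots> = integral {0..2*T} (\<lambda>x. a x * (w x)\<^sup>2 - E * (w x)\<^sup>2)" by (simp add: algebra_simps)
  also have "\<dots> = integral {0..2*T} (\<lambda>x. a x * (w x)\<^sup>2) - E * integral {0..2*T} (\<lambda>x. (w x)\<^sup>2)"
    by (subst integral_diff) (auto intro!: integrable_continuous_real continuous_intros cw a_cont)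
  finally show ?thesis by simp
qed

section \<open>Cruder bounds, for energies away from the barrier top\<close>

lemma derivative_bound:
  obtains A where "A > 0" "\<And>x. 0 \<le> x \<Longrightarrow> x \<le> 2 * T \<Longrightarrow> \<bar>a1 x\<bar> \<le> A" "\<And>x. 0 \<le> x \<Longrightarrow> x \<le> 2 * T \<Longrightarrow> a x \<le> A"
proof -
  have "compact (a1 ` {0..2*T})" "compact (a ` {0..2*T})"
    by (intro compact_continuous_image a_cont a1_cont compact_Icc)+
  then obtain A B where "\<forall>y\<in>a1 ` {0..2*T}. \<bar>y\<bar> \<le> A" "\<forall>y\<in>a ` {0..2*T}. \<bar>y\<bar> \<le> B"
    using compact_imp_bounded bounded_real by metis
  then show ?thesis by (intro that[of "\<bar>A\<bar> + \<bar>B\<bar> + 1"]) force+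
qed

text \<open>\<open>a \<ge> 0\<close> makes \<open>E * w^2\<close> a part of the energy, which the
  mass controls. Only a factor \<open>1 / E\<close> is lost and no power of
  \<open>h\<close>.\<close>

lemma above_barrier_large:
  "\<exists>C>0. \<forall>h E x w w1. 0 < h \<longrightarrow> 0 \<le> E \<longrightarrow> 0 \<le> x \<longrightarrow> x \<le> 2 * T \<longrightarrow>
     schroedinger h (\<lambda>x. a x + E) w w1 \<longrightarrow> (\<forall>x. w (x + 2 * T) = w x) \<longrightarrow>
     E * (w x)\<^sup>2 \<le> C * (1 + E) * integral {0..2*T} (\<lambda>x. (w x)\<^sup>2)"
proof -
  obtain A where A: "A > 0" "\<And>x. 0 \<le> x \<Longrightarrow> x \<le> 2 * T \<Longrightarrow> \<bar>a1 x\<bar> \<le> A" "\<And>x. 0 \<le> x \<Longrightarrow> x \<le> 2 * T \<Longrightarrow> a x \<le> A"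
    using derivative_bound by metis
  define C where "C = (A + 1) / T + A"
  have C: "C > 0" using A T by (simp add: C_def add_pos_pos)
  show ?thesis
  proof (rule exI[of _ C], intro conjI C allI impI)
    fix h E x :: real and w w1
    assume h: "0 < h" and E: "0 \<le> E" and x: "0 \<le> x" "x \<le> 2 * T"
      and ode: "schroedinger h (\<lambda>x. a x + E) w w1" and per: "\<forall>x. w (x + 2 * T) = w x"
    note cw = schroedinger_continuous[OF ode]
    define N where "N = integral {0..2*T} (\<lambda>x. (w x)\<^sup>2)"
    have N: "0 \<le> N" unfolding N_def by (intro integral_nonneg integrable_continuous_real continuous_intros cw) auto
    have L: "0 < 2 * T" using T by simp
    have per': "w (x + 2 * T) = w x" for x using per by blast
    have dq: "((\<lambda>x. a x + E) has_real_derivative a1 x) (at x)" for x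
      using a_deriv by (auto intro!: derivative_eq_intros)
    have "E * (w x)\<^sup>2 \<le> energy h (\<lambda>x. a x + E) w w1 x"
      unfolding energy_def using nonneg[of x] by (simp add: distrib_right)
    also have "\<dots> \<le> 2 / (2 * T) * integral {0..2*T} (\<lambda>x. (a x + E) * (w x)\<^sup>2) + A * N"
      unfolding N_def by (rule periodic_energy_bound[OF ode h L per' dq a1_cont A(2) x])
    also have "integral {0..2*T} (\<lambda>x. (a x + E) * (w x)\<^sup>2) \<le> integral {0..2*T} (\<lambda>x. (A + E) * (w x)\<^sup>2)"
      by (intro integral_le integrable_continuous_real continuous_intros cw a_cont) (use A in \<open>auto intro!: mult_right_mono\<close>)
    also have "\<dots> = (A + E) * N" by (simp add: N_def)
    finally have "E * (w x)\<^sup>2 \<le> 2 / (2 * T) * ((A + E) * N) + A * N" using T by (simp add: divide_right_mono)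
    also have "\<dots> = ((A + E) / T + A) * N" by (simp add: add_divide_distrib algebra_simps)
    also have "\<dots> \<le> (C * (1 + E)) * N"
    proof (intro mult_right_mono N)
      have "(A + E) / T \<le> (A + 1) * (1 + E) / T" using A E T by (intro divide_right_mono) (auto simp: algebra_simps)
      moreover have "A \<le> A * (1 + E)" using A E by simp
      ultimately show "(A + E) / T + A \<le> C * (1 + E)" by (simp add: C_def distrib_right)
    qed
    finally show "E * (w x)\<^sup>2 \<le> C * (1 + E) * integral {0..2*T} (\<lambda>x. (w x)\<^sup>2)" by (simp add: N_def)
  qed
qed


text \<open>At the maximum \<open>p\<close> of \<open>w^2\<close> the potential \<open>a - E\<close>
  is nonnegative, so at distance at most \<open>r\<close> it is at least \<open>- A * r\<close>, and
  the energy bounds \<open>w1\<close>. For \<open>r\<close> of the Airy scale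
  \<open>h powr (2/3)\<close> this keeps \<open>w^2\<close> above a quarter of its maximum on an
  interval of length \<open>r\<close>, whose mass gives the estimate.\<close>

lemma below_barrier_crude:
  "\<exists>C>0. \<forall>h E x w w1. 0 < h \<longrightarrow> h < 1 \<longrightarrow> 0 \<le> E \<longrightarrow> 0 \<le> x \<longrightarrow> x \<le> 2 * T \<longrightarrow>
     schroedinger h (\<lambda>x. a x - E) w w1 \<longrightarrow> (\<forall>x. w (x + 2 * T) = w x) \<longrightarrow>
     (w x)\<^sup>2 * h powr (2/3) \<le> C * integral {0..2*T} (\<lambda>x. (w x)\<^sup>2)"
proof -
  obtain A where A: "A > 0" "\<And>x. 0 \<le> x \<Longrightarrow> x \<le> 2 * T \<Longrightarrow> \<bar>a1 x\<bar> \<le> A" "\<And>x. 0 \<le> x \<Longrightarrow> x \<le> 2 * T \<Longrightarrow> a x \<le> A"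
    using derivative_bound by metis
  \<comment> \<open>\<open>\<epsilon> \<le> 1\<close> reduces
    \<open>A * \<epsilon>^3 \<le> 1/8\<close> to a bound on \<open>\<epsilon>\<close>;
    \<open>\<epsilon> \<le> T\<close> leaves room within the period for an interval of length
    \<open>r\<close> on one side of \<open>p\<close>.\<close>
  define \<epsilon> where "\<epsilon> = min T (min 1 (1 / (8 * A)))"
  have \<epsilon>: "0 < \<epsilon>" "\<epsilon> \<le> T" "\<epsilon> \<le> 1" "\<epsilon> \<le> 1 / (8 * A)" using A T unfolding \<epsilon>_def by simp_all
  have \<epsilon>3: "A * \<epsilon>^3 \<le> 1 / 8"
  proof -
    have "\<epsilon>^3 \<le> \<epsilon>" using \<epsilon> power_decreasing[of 1 3 \<epsilon>] by simp
    also have "\<dots> \<le> 1 / (8 * A)" by (rule \<epsilon>)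
    finally show ?thesis using A by (simp add: field_simps)
  qed
  define D where "D = A / T + A"
  have D: "D > 0" using A T by (simp add: D_def add_pos_pos)
  define C where "C = 4 / \<epsilon> + 8 * \<epsilon>\<^sup>2 * D"
  have C: "C > 0" "4 / \<epsilon> \<le> C" "8 * \<epsilon>\<^sup>2 * D \<le> C" using \<epsilon> D by (auto simp: C_def add_pos_pos)
  show ?thesis
  proof (rule exI[of _ C], intro conjI C(1) allI impI)
    fix h E x :: real and w w1
    assume h: "0 < h" "h < 1" and E: "0 \<le> E" and x: "0 \<le> x" "x \<le> 2 * T"
      and ode: "schroedinger h (\<lambda>x. a x - E) w w1" and per: "\<forall>x. w (x + 2 * T) = w x"
    note cw = schroedinger_continuous[OF ode]
    define N where "N = integral {0..2*T} (\<lambda>x. (w x)\<^sup>2)"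
    have N: "0 \<le> N" unfolding N_def by (intro integral_nonneg integrable_continuous_real continuous_intros cw) auto
    have L: "0 < 2 * T" using T by simp
    have per': "w (x + 2 * T) = w x" for x using per by blast
    have dq: "((\<lambda>x. a x - E) has_real_derivative a1 x) (at x)" for x
      using a_deriv by (auto intro!: derivative_eq_intros)
    have e: "energy h (\<lambda>x. a x - E) w w1 y \<le> D * N" if y: "0 \<le> y" "y \<le> 2 * T" for y
    proof -
      have "energy h (\<lambda>x. a x - E) w w1 y \<le> 2 / (2 * T) * integral {0..2*T} (\<lambda>x. (a x - E) * (w x)\<^sup>2) + A * N"
        unfolding N_def by (rule periodic_energy_bound[OF ode h(1) L per' dq a1_cont A(2) y])
      also have "integral {0..2*T} (\<lambda>x. (a x - E) * (w x)\<^sup>2) \<le> integral {0..2*T} (\<lambda>x. A * (w x)\<^sup>2)"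
      proof (intro integral_le integrable_continuous_real continuous_intros cw a_cont mult_right_mono)
        fix x assume "x \<in> {0..2*T}"
        then show "a x - E \<le> A" using A(3)[of x] E by simp
      qed auto
      also have "\<dots> = A * N" by (simp add: N_def)
      finally show ?thesis using T by (simp add: D_def divide_right_mono algebra_simps)
    qed
    obtain p where p: "0 \<le> p" "p \<le> 2 * T" "\<And>y. 0 \<le> y \<Longrightarrow> y \<le> 2 * T \<Longrightarrow> (w y)\<^sup>2 \<le> (w p)\<^sup>2"
      "w p = 0 \<or> 0 \<le> a p - E"
      using schroedinger_max[OF ode h(1) L per'] by blast
    define M where "M = (w p)\<^sup>2"
    have M: "0 \<le> M" by (simp add: M_def)
    define k where "k = h powr (2/3)"
    have k: "0 < k" "k \<le> 1" using h by (auto simp: k_def powr_le1)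
    have "k^3 = k powr (real 3)" by (rule powr_realpow[OF k(1), symmetric])
    also have "\<dots> = h powr (real 2)" by (simp add: k_def powr_powr)
    also have "\<dots> = h\<^sup>2" by (rule powr_realpow[OF h(1)])
    finally have k3: "k^3 = h\<^sup>2" .
    \<comment> \<open>If the mass dominates the maximum already, nothing is left to show. Otherwise
      the term \<open>D * N\<close> in the bound for \<open>w1\<close> contributes at most
      \<open>M / 8\<close> to the change of \<open>w\<close>, squared.\<close>
    have "M * k \<le> C * N"
    proof (cases "w p = 0 \<or> M * k \<le> 8 * \<epsilon>\<^sup>2 * D * N")
      case True
      then show ?thesis
      proof
        assume "w p = 0" then show ?thesis using C N by (simp add: M_def)
      next
        assume "M * k \<le> 8 * \<epsilon>\<^sup>2 * D * N"
        also have "\<dots> \<le> C * N" by (rule mult_right_mono[OF C(3) N])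
        finally show ?thesis .
      qed
    next
      case False
      then have Ep: "E \<le> a p" and big: "8 * \<epsilon>\<^sup>2 * D * N \<le> M * k" using p(4) by auto
      define r where "r = \<epsilon> * k"
      have "\<epsilon> * k \<le> T * 1" using \<epsilon> k by (intro mult_mono) auto
      then have r: "0 < r" "r \<le> T" using \<epsilon> k by (auto simp: r_def)
      have bound: "(w1 y)\<^sup>2 \<le> (D * N + A * r * M) / h\<^sup>2" if y: "0 \<le> y" "y \<le> 2 * T" "\<bar>y - p\<bar> \<le> r" for y
      proof -
        have "(E - a y) * (w y)\<^sup>2 \<le> A * r * M"
        proof (cases "E \<le> a y")
          case True
          then have "(E - a y) * (w y)\<^sup>2 \<le> 0" by (simp add: mult_nonpos_nonneg)
          also have "0 \<le> A * r * M" using A r M by simp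
          finally show ?thesis .
        next
          case False
          have "norm (a p - a y) \<le> A * norm (p - y)"
            by (rule field_differentiable_bound[of "{0..2*T}" a a1])
              (use a_deriv A y p in \<open>auto intro: has_field_derivative_at_within\<close>)
          then have "a p - a y \<le> A * \<bar>y - p\<bar>" by (simp add: abs_minus_commute)
          also have "\<dots> \<le> A * r" using A y by (intro mult_left_mono) auto
          finally have "E - a y \<le> A * r" using Ep by simp
          then show ?thesis using p(3)[OF y(1,2)] False M A r unfolding M_def by (intro mult_mono) auto
        qed
        then have "h\<^sup>2 * (w1 y)\<^sup>2 \<le> D * N + A * r * M"
          using e[OF y(1,2)] unfolding energy_def by (simp add: algebra_simps)
        then show ?thesis using h by (simp add: field_simps)
      qed
      have close: "(w p - w y)\<^sup>2 \<le> M / 4" if y: "0 \<le> y" "y \<le> 2 * T" "\<bar>y - p\<bar> \<le> r" for y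
      proof -
        have "(w p - w y)\<^sup>2 \<le> \<bar>y - p\<bar>\<^sup>2 * ((D * N + A * r * M) / h\<^sup>2)"
        proof (cases "p \<le> y")
          case True
          have "(w p - w y)\<^sup>2 \<le> (y - p)\<^sup>2 * ((D * N + A * r * M) / h\<^sup>2)"
            by (rule mvt_square_bound[OF schroedingerD(1)[OF ode] True]) (use bound y p in auto)
          then show ?thesis by simp
        next
          case False
          have "(w y - w p)\<^sup>2 \<le> (p - y)\<^sup>2 * ((D * N + A * r * M) / h\<^sup>2)"
            by (rule mvt_square_bound[OF schroedingerD(1)[OF ode]]) (use bound y p False in auto)
          then show ?thesis by (simp add: power2_commute)
        qed
        also have "\<dots> \<le> r\<^sup>2 * ((D * N + A * r * M) / h\<^sup>2)"
          using y D N A r M by (intro mult_right_mono power_mono) auto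
        \<comment> \<open>The origin of the exponent 2/3: \<open>k^3 = h\<^sup>2\<close> turns
          \<open>r^3 / h\<^sup>2\<close> into \<open>\<epsilon>^3\<close>, free of
          \<open>h\<close>.\<close>
        also have "\<dots> = \<epsilon>\<^sup>2 * D * N / k + A * \<epsilon>^3 * M"
          unfolding k3[symmetric] r_def using k by (simp add: field_simps power2_eq_square power3_eq_cube)
        also have "\<dots> \<le> M / 8 + 1/8 * M"
          using big k \<epsilon>3 M by (intro add_mono mult_right_mono) (auto simp: field_simps)
        finally show ?thesis by simp
      qed
      have low: "M / 4 \<le> (w y)\<^sup>2" if "0 \<le> y" "y \<le> 2 * T" "\<bar>y - p\<bar> \<le> r" for y
        using close[OF that] square_le_twice[of "w p" "w y"] by (simp add: M_def)
      define u where "u = (if p \<le> T then p else p - r)"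
      have u: "0 \<le> u" "u + r \<le> 2 * T" "\<And>y. u \<le> y \<Longrightarrow> y \<le> u + r \<Longrightarrow> \<bar>y - p\<bar> \<le> r"
        using r p(1,2) by (auto simp: u_def abs_le_iff split: if_splits)
      have "r * (M / 4) = integral {u..u + r} (\<lambda>_. M / 4)" using r by simp
      also have "\<dots> \<le> integral {u..u + r} (\<lambda>y. (w y)\<^sup>2)"
        by (intro integral_le integrable_continuous_real continuous_intros cw) (use low u in auto)
      also have "\<dots> \<le> N" unfolding N_def
        using u by (intro integral_subset_le integrable_continuous_real continuous_intros cw) auto
      finally have "M * k \<le> 4 / \<epsilon> * N" using \<epsilon> by (simp add: r_def field_simps)
      also have "\<dots> \<le> C * N" by (rule mult_right_mono[OF C(2) N])
      finally show ?thesis .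
    qed
    moreover have "(w x)\<^sup>2 * k \<le> M * k" using p(3)[OF x] k by (simp add: M_def)
    ultimately show "(w x)\<^sup>2 * h powr (2/3) \<le> C * integral {0..2*T} (\<lambda>x. (w x)\<^sup>2)"
      by (simp add: N_def k_def)
  qed
qed

end

section \<open>Separated functions on the torus\<close>

lemma continuous_on_section:
  fixes g :: "real \<Rightarrow> real \<Rightarrow> real"
  assumes "continuous_on UNIV (\<lambda>(x, y). g x y)"
  shows "continuous_on S (\<lambda>x. g x y)" "continuous_on S (g x)"
proof -
  have "continuous_on S (\<lambda>x. (\<lambda>(x, y). g x y) (x, y))"
    by (rule continuous_on_compose2[OF assms]) (auto intro!: continuous_intros)
  moreover have "continuous_on S (\<lambda>y. (\<lambda>(x, y). g x y) (x, y))"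
    by (rule continuous_on_compose2[OF assms]) (auto intro!: continuous_intros)
  ultimately show "continuous_on S (\<lambda>x. g x y)" "continuous_on S (g x)" by simp_all
qed

lemma continuous_on_swap_args:
  fixes g :: "real \<Rightarrow> real \<Rightarrow> real"
  assumes "continuous_on UNIV (\<lambda>(x, y). g x y)"
  shows "continuous_on UNIV (\<lambda>(y, x). g x y)"
proof -
  have "continuous_on UNIV (\<lambda>p. (\<lambda>(x, y). g x y) (snd p, fst p))"
    by (rule continuous_on_compose2[OF assms]) (auto intro!: continuous_intros)
  then show ?thesis by (simp add: case_prod_beta)
qed

lemma continuous_on_partial_integral:
  fixes g :: "real \<Rightarrow> real \<Rightarrow> real"
  assumes "continuous_on UNIV (\<lambda>(x, y). g x y)"
  shows "continuous_on S (\<lambda>y. integral {u..v} (\<lambda>x. g x y))"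
  using integral_continuous_on_param[of S u v "\<lambda>y x. g x y"]
    continuous_on_subset[OF continuous_on_swap_args[OF assms]] by simp

lemma integral_swap:
  fixes g :: "real \<Rightarrow> real \<Rightarrow> real"
  assumes "continuous_on UNIV (\<lambda>(x, y). g x y)"
  shows "integral {s..t} (\<lambda>y. integral {u..v} (\<lambda>x. g x y)) = integral {u..v} (\<lambda>x. integral {s..t} (g x))"
  using integral_swap_continuous[of u s v t g] continuous_on_subset[OF assms] by simp

lemma continuous_on_weighted:
  fixes a b :: "real \<Rightarrow> real" and f :: "real \<Rightarrow> real \<Rightarrow> real"
  assumes "continuous_on UNIV a" "continuous_on UNIV b" "continuous_on UNIV (\<lambda>(x, y). f x y)"
  shows "continuous_on UNIV (\<lambda>(x, y). (a x + b y) * (f x y)\<^sup>2)"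
proof -
  have "continuous_on UNIV (\<lambda>p. (a (fst p) + b (snd p)) * (case p of (x, y) \<Rightarrow> f x y)\<^sup>2)"
    by (intro continuous_intros assms continuous_on_compose2[OF assms(1)] continuous_on_compose2[OF assms(2)]) auto
  then show ?thesis by (simp add: case_prod_beta)
qed

text \<open>The equations are imposed on sections, which covers sums of products belonging to the
  same pair of eigenvalues. \<open>E\<close> enters with opposite signs, so exchanging the variables
  replaces \<open>E\<close> by \<open>- E\<close>.\<close>

definition separated ::
  "(real \<Rightarrow> real) \<Rightarrow> (real \<Rightarrow> real) \<Rightarrow> real \<Rightarrow> real \<Rightarrow> real \<Rightarrow> real \<Rightarrow> (real \<Rightarrow> real \<Rightarrow> real) \<Rightarrow> bool" where
  "separated a b T1 T2 h E f \<longleftrightarrow> continuous_on UNIV (\<lambda>(x, y). f x y) \<and>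
     (\<forall>x y. f (x + 2 * T1) y = f x y) \<and> (\<forall>x y. f x (y + 2 * T2) = f x y) \<and>
     (\<forall>y. \<exists>f1. schroedinger h (\<lambda>x. a x + E) (\<lambda>x. f x y) f1) \<and>
     (\<forall>x. \<exists>f2. schroedinger h (\<lambda>y. b y - E) (f x) f2)"

abbreviation weighted_mass where
  "weighted_mass a b T1 T2 f \<equiv>
     integral {0..2*T2} (\<lambda>y. integral {0..2*T1} (\<lambda>x. (a x + b y) * (f x y)\<^sup>2))"

abbreviation nonneg_torus_sup_bound where
  "nonneg_torus_sup_bound a b T1 T2 C h \<equiv>
     \<forall>E f x y. 0 \<le> E \<longrightarrow> separated a b T1 T2 h E f \<longrightarrow> 0 \<le> x \<longrightarrow> x \<le> 2 * T1 \<longrightarrow> 0 \<le> y \<longrightarrow> y \<le> 2 * T2 \<longrightarrow>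
     (f x y)\<^sup>2 * (h * ln (1/h)) \<le> C * weighted_mass a b T1 T2 f"

abbreviation torus_sup_bound where
  "torus_sup_bound a b T1 T2 C h \<equiv>
     \<forall>E f x y. separated a b T1 T2 h E f \<longrightarrow> 0 \<le> x \<longrightarrow> x \<le> 2 * T1 \<longrightarrow> 0 \<le> y \<longrightarrow> y \<le> 2 * T2 \<longrightarrow>
     (f x y)\<^sup>2 * (h * ln (1/h)) \<le> C * weighted_mass a b T1 T2 f"

section \<open>Sup bounds for separated functions\<close>

lemma separated_swap:
  assumes "separated a b T1 T2 h E f"
  shows "separated b a T2 T1 h (- E) (\<lambda>y x. f x y)"
  using assms continuous_on_swap_args[of f] unfolding separated_def by auto

lemma separated_bound_nonneg:
  assumes a: "periodic_well a a1 a2 T1" and b: "periodic_well b b1 b2 T2"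
  shows "\<exists>C>0. \<forall>\<^sub>F h in at_right 0. nonneg_torus_sup_bound a b T1 T2 C h" (is "\<exists>C>0. \<forall>\<^sub>F h in at_right 0. ?P C h")
proof -
  interpret a: periodic_well a a1 a2 T1 by (rule a)
  interpret b: periodic_well b b1 b2 T2 by (rule b)
  obtain C1 where C1: "C1 > 0" and ev1: "\<forall>\<^sub>F h in at_right 0. log_sup_bound a (2 * T1) C1 h"
    using a.above_barrier by blast
  obtain C2 where C2: "C2 > 0" and ev2: "\<forall>\<^sub>F h in at_right 0. periodic_sup_bound b (2 * T2) C2 h"
    using b.below_barrier by blast
  obtain C3 where C3: "C3 > 0" and l3: "\<And>h E x w w1. 0 < h \<Longrightarrow> 0 \<le> E \<Longrightarrow> 0 \<le> x \<Longrightarrow> x \<le> 2 * T1 \<Longrightarrow>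
     schroedinger h (\<lambda>x. a x + E) w w1 \<Longrightarrow> (\<forall>x. w (x + 2 * T1) = w x) \<Longrightarrow>
     E * (w x)\<^sup>2 \<le> C3 * (1 + E) * integral {0..2*T1} (\<lambda>x. (w x)\<^sup>2)"
    using a.above_barrier_large by blast
  obtain C4 where C4: "C4 > 0" and l4: "\<And>h E x w w1. 0 < h \<Longrightarrow> h < 1 \<Longrightarrow> 0 \<le> E \<Longrightarrow> 0 \<le> x \<Longrightarrow> x \<le> 2 * T2 \<Longrightarrow>
     schroedinger h (\<lambda>x. b x - E) w w1 \<Longrightarrow> (\<forall>x. w (x + 2 * T2) = w x) \<Longrightarrow>
     (w x)\<^sup>2 * h powr (2/3) \<le> C4 * integral {0..2*T2} (\<lambda>x. (w x)\<^sup>2)"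
    using b.below_barrier_crude by blast
  have ev3: "\<forall>\<^sub>F h in at_right (0::real). 0 < h \<and> h < 1 \<and> h * ln (1/h) \<le> h powr (2/3) * h powr (1/4)"
    by (intro eventually_conj; real_asymp)
  define C where "C = C1 * C2 + 2 * C3 * C4"
  have C: "C > 0" "C1 * C2 \<le> C" "2 * C3 * C4 \<le> C" using C1 C2 C3 C4 by (auto simp: C_def add_pos_pos)
  show ?thesis
  proof (rule exI[of _ C], intro conjI C(1))
    show "\<forall>\<^sub>F h in at_right 0. ?P C h"
      using ev1 ev2 ev3
    proof (eventually_elim, intro allI impI, elim conjE)
      fix h E :: real and f and x y :: real
      assume e1: "log_sup_bound a (2 * T1) C1 h"
        and e2: "periodic_sup_bound b (2 * T2) C2 h"
        and h: "0 < h" "h < 1" and hl: "h * ln (1/h) \<le> h powr (2/3) * h powr (1/4)"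
        and E: "0 \<le> E" and sep: "separated a b T1 T2 h E f"
        and x: "0 \<le> x" "x \<le> 2 * T1" and y: "0 \<le> y" "y \<le> 2 * T2"
      have cf: "continuous_on UNIV (\<lambda>(x, y). f x y)"
        and per1: "\<forall>x. f (x + 2 * T1) y = f x y" and per2: "\<forall>y. f x (y + 2 * T2) = f x y" for x y
        using sep by (auto simp: separated_def)
      obtain f1 where f1: "\<And>y. schroedinger h (\<lambda>x. a x + E) (\<lambda>x. f x y) (f1 y)"
        using sep unfolding separated_def by metis
      obtain f2 where f2: "\<And>x. schroedinger h (\<lambda>y. b y - E) (f x) (f2 x)"
        using sep unfolding separated_def by metis
      have cf2: "continuous_on UNIV (\<lambda>(x, y). (f x y)\<^sup>2)"
        using continuous_on_power[OF cf, of 2] by (simp add: case_prod_beta)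
      have cbf: "continuous_on UNIV (\<lambda>(x, y). b y * (f x y)\<^sup>2)"
        using continuous_on_weighted[OF continuous_on_const[of _ 0] b.a_cont cf] by simp
      have cabf: "continuous_on UNIV (\<lambda>(x, y). (a x + b y) * (f x y)\<^sup>2)"
        by (rule continuous_on_weighted[OF a.a_cont b.a_cont cf])
      note sec = continuous_on_section[OF cf2] and int = continuous_on_partial_integral
      define N where "N = (\<lambda>y. integral {0..2*T1} (\<lambda>x. (f x y)\<^sup>2))"
      have cN: "continuous_on S N" for S unfolding N_def by (rule int[OF cf2])
      define J where "J = integral {0..2*T2} (\<lambda>y. b y * N y)"
      define I where "I = weighted_mass a b T1 T2 f"
      have N0: "0 \<le> N y" for y unfolding N_def
        by (intro integral_nonneg integrable_continuous_real sec) auto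
      have J0: "0 \<le> J" unfolding J_def
        by (intro integral_nonneg integrable_continuous_real continuous_intros b.a_cont cN) (use b.nonneg N0 in auto)
      have bN: "b y * N y = integral {0..2*T1} (\<lambda>x. b y * (f x y)\<^sup>2)" for y by (simp add: N_def)
      have JI: "J \<le> I" unfolding J_def I_def bN
      proof (intro integral_le integrable_continuous_real int[OF cbf] int[OF cabf] continuous_on_section[OF cbf] continuous_on_section[OF cabf])
        show "b y * (f x y)\<^sup>2 \<le> (a x + b y) * (f x y)\<^sup>2" for x y
          using a.nonneg by (intro mult_right_mono) auto
      qed
      have "(f x y)\<^sup>2 * (h * ln (1/h)) \<le> C * J"
      proof (cases "E \<le> h powr (1/8)")
        case True
        have l: "0 \<le> sqrt h * ln (1/h)" using h by simp
        have "(f x y)\<^sup>2 * (h * ln (1/h)) = ((f x y)\<^sup>2 * sqrt h) * (sqrt h * ln (1/h))" using h by simp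
        also have "\<dots> \<le> (C2 * integral {0..2*T2} (\<lambda>y. b y * (f x y)\<^sup>2)) * (sqrt h * ln (1/h))"
          using e2 E True y f2 per2 by (intro mult_right_mono l) blast
        \<comment> \<open>The factor that contains the logarithm moves under the integral over
          \<open>y\<close>, where the estimate above the barrier applies to the section in
          \<open>x\<close>.\<close>
        also have "\<dots> = C2 * integral {0..2*T2} (\<lambda>y. b y * ((f x y)\<^sup>2 * (sqrt h * ln (1/h))))"
          by (simp add: mult.assoc[symmetric])
        also have "\<dots> \<le> C2 * integral {0..2*T2} (\<lambda>y. b y * (C1 * N y))"
        proof (intro mult_left_mono integral_le integrable_continuous_real continuous_intros b.a_cont cN sec b.nonneg)
          show "(f x y)\<^sup>2 * (sqrt h * ln (1/h)) \<le> C1 * N y" for y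
            unfolding N_def using e1 E True x f1 by blast
        qed (use C2 continuous_on_section[OF cf] in auto)
        also have "\<dots> = (C1 * C2) * J" by (simp add: J_def mult.left_commute[of _ C1])
        also have "\<dots> \<le> C * J" by (rule mult_right_mono[OF C(2) J0])
        finally show ?thesis .
      next
        case False
        \<comment> \<open>Away from the barrier top the loss is at most \<open>h powr (- 2 / 3) * E powr (- 2)\<close>; any threshold
          exponent below \<open>1 / 6\<close> would do.\<close>
        define s where "s = h powr (1/8)"
        have s: "0 < s" "s < E" "s\<^sup>2 = h powr (1/4)" "s \<le> 1" using h False
          by (auto simp: s_def power2_eq_square powr_add[symmetric] powr_le1)
        have E0: "0 < E" using s by simp
        \<comment> \<open>The virial inequality holds in \<open>y\<close> for each fixed
          \<open>x\<close>, whereas \<open>N\<close> integrates over \<open>x\<close> first; hence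
          an exchange of integrals before and after.\<close>
        have EN: "E * integral {0..2*T2} N \<le> J"
        proof -
          have "E * integral {0..2*T2} N = integral {0..2*T1} (\<lambda>x. E * integral {0..2*T2} (\<lambda>y. (f x y)\<^sup>2))"
            unfolding N_def by (subst integral_swap[OF cf2]) simp
          also have "\<dots> \<le> integral {0..2*T1} (\<lambda>x. integral {0..2*T2} (\<lambda>y. b y * (f x y)\<^sup>2))"
          proof (intro integral_le integrable_continuous_real continuous_intros)
            show "E * integral {0..2*T2} (\<lambda>y. (f x y)\<^sup>2) \<le> integral {0..2*T2} (\<lambda>y. b y * (f x y)\<^sup>2)" for x
              by (rule b.energy_le_potential[OF h(1) f2]) (use per2 in blast)
          qed (use int[OF continuous_on_swap_args[OF cf2]] int[OF continuous_on_swap_args[OF cbf]] in auto)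
          also have "\<dots> = J" unfolding J_def bN by (rule integral_swap[OF cbf, symmetric])
          finally show ?thesis .
        qed
        have "E * ((f x y)\<^sup>2 * h powr (2/3)) \<le> E * (C4 * integral {0..2*T2} (\<lambda>y. (f x y)\<^sup>2))"
          using l4[OF h E y f2 per2] E by (intro mult_left_mono) auto
        also have "\<dots> = C4 * integral {0..2*T2} (\<lambda>y. E * (f x y)\<^sup>2)" by simp
        also have "\<dots> \<le> C4 * integral {0..2*T2} (\<lambda>y. C3 * (1 + E) * N y)"
        proof (intro mult_left_mono integral_le integrable_continuous_real continuous_intros cN sec)
          show "E * (f x y)\<^sup>2 \<le> C3 * (1 + E) * N y" for y
            unfolding N_def by (rule l3[OF h(1) E x f1 per1])
        qed (use C4 continuous_on_section[OF cf] in auto)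
        also have "\<dots> = C3 * C4 * (1 + E) * integral {0..2*T2} N" by simp
        finally have 1: "E * ((f x y)\<^sup>2 * h powr (2/3)) \<le> C3 * C4 * (1 + E) * integral {0..2*T2} N" .
        have "E\<^sup>2 * ((f x y)\<^sup>2 * h powr (2/3)) = E * (E * ((f x y)\<^sup>2 * h powr (2/3)))"
          by (simp add: power2_eq_square)
        also have "\<dots> \<le> E * (C3 * C4 * (1 + E) * integral {0..2*T2} N)" by (rule mult_left_mono[OF 1 E])
        also have "\<dots> = C3 * C4 * (1 + E) * (E * integral {0..2*T2} N)" by simp
        also have "\<dots> \<le> C3 * C4 * (1 + E) * J" using EN C3 C4 E by (intro mult_left_mono) auto
        finally have 2: "E\<^sup>2 * ((f x y)\<^sup>2 * h powr (2/3)) \<le> C3 * C4 * (1 + E) * J" .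
        \<comment> \<open>\<open>E\<close> has no upper bound here, so both summands are compared
          with \<open>E\<^sup>2\<close>: \<open>s\<^sup>2\<close> by \<open>s < E\<close>, and
          \<open>E * s\<^sup>2\<close> by \<open>s\<^sup>2 \<le> s < E\<close>.\<close>
        have "(1 + E) * s\<^sup>2 \<le> 2 * E\<^sup>2"
        proof -
          have "s\<^sup>2 \<le> E\<^sup>2" using s by (intro power_mono) auto
          moreover have "E * s\<^sup>2 \<le> E * E"
          proof (rule mult_left_mono)
            have "s * s \<le> s * 1" using s(1,4) by (intro mult_left_mono) auto
            then show "s\<^sup>2 \<le> E" using s(2) unfolding power2_eq_square by linarith
          qed (rule E)
          ultimately show ?thesis by (simp add: power2_eq_square distrib_right)
        qed
        then have "C3 * C4 * J * ((1 + E) * s\<^sup>2) \<le> C3 * C4 * J * (2 * E\<^sup>2)"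
          using C3 C4 J0 by (intro mult_left_mono) auto
        moreover have "E\<^sup>2 * ((f x y)\<^sup>2 * h powr (2/3)) * s\<^sup>2 \<le> C3 * C4 * (1 + E) * J * s\<^sup>2"
          using 2 by (rule mult_right_mono) simp
        ultimately have "E\<^sup>2 * ((f x y)\<^sup>2 * h powr (2/3) * s\<^sup>2) \<le> E\<^sup>2 * (2 * C3 * C4 * J)"
          by (simp add: mult_ac)
        then have "(f x y)\<^sup>2 * h powr (2/3) * s\<^sup>2 \<le> 2 * C3 * C4 * J"
          by (rule mult_left_le_imp_le) (use E0 in simp)
        moreover have "(f x y)\<^sup>2 * (h * ln (1/h)) \<le> (f x y)\<^sup>2 * (h powr (2/3) * s\<^sup>2)"
          using hl s by (intro mult_left_mono) auto
        moreover have "2 * C3 * C4 * J \<le> C * J" by (rule mult_right_mono[OF C(3) J0])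
        ultimately show ?thesis by (simp add: mult_ac)
      qed
      also have "\<dots> \<le> C * I" using JI C by simp
      finally show "(f x y)\<^sup>2 * (h * ln (1/h)) \<le>
         C * weighted_mass a b T1 T2 f" by (simp add: I_def)
    qed
  qed
qed

lemma separated_bound:
  assumes a: "periodic_well a a1 a2 T1" and b: "periodic_well b b1 b2 T2"
  shows "\<exists>C>0. \<forall>\<^sub>F h in at_right 0. torus_sup_bound a b T1 T2 C h" (is "\<exists>C>0. \<forall>\<^sub>F h in at_right 0. ?P C h")
proof -
  obtain C1 where C1: "C1 > 0" and ev1: "\<forall>\<^sub>F h in at_right 0. nonneg_torus_sup_bound a b T1 T2 C1 h"
    using separated_bound_nonneg[OF a b] by blast
  obtain C2 where C2: "C2 > 0" and ev2: "\<forall>\<^sub>F h in at_right 0. nonneg_torus_sup_bound b a T2 T1 C2 h"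
    using separated_bound_nonneg[OF b a] by blast
  interpret a: periodic_well a a1 a2 T1 by (rule a)
  interpret b: periodic_well b b1 b2 T2 by (rule b)
  show ?thesis
  proof (rule exI[of _ "C1 + C2"], intro conjI)
    show "C1 + C2 > 0" using C1 C2 by simp
    show "\<forall>\<^sub>F h in at_right 0. ?P (C1 + C2) h"
      using ev1 ev2
    proof (eventually_elim, intro allI impI)
      fix h E f x y
      assume e1: "nonneg_torus_sup_bound a b T1 T2 C1 h"
        and e2: "nonneg_torus_sup_bound b a T2 T1 C2 h"
        and sep: "separated a b T1 T2 h E f" and x: "0 \<le> x" "x \<le> 2 * T1" and y: "0 \<le> y" "y \<le> 2 * T2"
      define I where "I = weighted_mass a b T1 T2 f"
      have cf: "continuous_on UNIV (\<lambda>(x, y). f x y)" using sep by (auto simp: separated_def)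
      have cabf: "continuous_on UNIV (\<lambda>(x, y). (a x + b y) * (f x y)\<^sup>2)"
        by (rule continuous_on_weighted[OF a.a_cont b.a_cont cf])
      have I0: "0 \<le> I" unfolding I_def using a.nonneg b.nonneg
        by (intro integral_nonneg integrable_continuous_real continuous_on_partial_integral[OF cabf] continuous_on_section[OF cabf]) auto
      have sw: "integral {0..2*T1} (\<lambda>x. integral {0..2*T2} (\<lambda>y. (b y + a x) * (f x y)\<^sup>2)) = I"
        unfolding I_def integral_swap[OF cabf] by (simp add: add.commute)
      have "(f x y)\<^sup>2 * (h * ln (1/h)) \<le> C1 * I \<or> (f x y)\<^sup>2 * (h * ln (1/h)) \<le> C2 * I"
      proof (cases "0 \<le> E")
        case True
        then show ?thesis using e1 sep x y unfolding I_def by blast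
      next
        case False
        have "(f x y)\<^sup>2 * (h * ln (1/h)) \<le>
          C2 * integral {0..2*T1} (\<lambda>x. integral {0..2*T2} (\<lambda>y. (b y + a x) * (f x y)\<^sup>2))"
          using e2[rule_format, of "- E" "\<lambda>y x. f x y" y x] separated_swap[OF sep] False x y by simp
        then show ?thesis unfolding sw by simp
      qed
      then show "(f x y)\<^sup>2 * (h * ln (1/h)) \<le>
       (C1 + C2) * weighted_mass a b T1 T2 f"
        unfolding I_def[symmetric] using C1 C2 I0 by (auto simp: distrib_right intro: order_trans)
    qed
  qed
qed

section \<open>Separation of variables on the ellipsoid\<close>

lemma real_analytic_deriv:
  assumes "real_analytic f"
  shows "(f has_real_derivative deriv f x) (at x)" and "real_analytic (deriv f)"
proof -
  have main: "\<exists>r>0. \<exists>c. \<forall>x. \<bar>x - x0\<bar> < r \<longrightarrow>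
     (f has_real_derivative deriv f x) (at x) \<and> (\<lambda>n. c n * (x - x0) ^ n) sums deriv f x" for x0
  proof -
    obtain r c where r: "r > 0" and c: "\<And>x. \<bar>x - x0\<bar> < r \<Longrightarrow> (\<lambda>n. c n * (x - x0) ^ n) sums f x"
      using assms unfolding real_analytic_def by metis
    have sm: "summable (\<lambda>n. c n * z ^ n)" if "norm z < r" for z
      using c[of "x0 + z"] that by (auto simp: sums_iff)
    have "(f has_real_derivative (\<Sum>n. diffs c n * (x - x0) ^ n)) (at x)"
      and "(\<lambda>n. diffs c n * (x - x0) ^ n) sums (\<Sum>n. diffs c n * (x - x0) ^ n)"
      if x: "\<bar>x - x0\<bar> < r" for x
    proof -
      have "((\<lambda>z. \<Sum>n. c n * z ^ n) has_real_derivative (\<Sum>n. diffs c n * (x - x0) ^ n)) (at (x - x0))"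
        by (rule termdiffs_strong'[OF sm]) (use x in auto)
      then have "((\<lambda>y. \<Sum>n. c n * (y - x0) ^ n) has_real_derivative (\<Sum>n. diffs c n * (x - x0) ^ n)) (at x)"
        using DERIV_shift[of "\<lambda>y. \<Sum>n. c n * y ^ n" _ x "- x0"] by simp
      then show "(f has_real_derivative (\<Sum>n. diffs c n * (x - x0) ^ n)) (at x)"
      proof (rule has_field_derivative_transform_within_open)
        show "open {y. \<bar>y - x0\<bar> < r}" by (intro open_Collect_less continuous_intros)
      qed (use x c in \<open>auto simp: sums_iff\<close>)
      show "(\<lambda>n. diffs c n * (x - x0) ^ n) sums (\<Sum>n. diffs c n * (x - x0) ^ n)"
        by (rule summable_sums[OF termdiff_converges[of _ r]]) (use x sm in auto)
    qed
    then have "\<forall>x. \<bar>x - x0\<bar> < r \<longrightarrow>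
     (f has_real_derivative deriv f x) (at x) \<and> (\<lambda>n. diffs c n * (x - x0) ^ n) sums deriv f x"
      by (metis DERIV_imp_deriv)
    then show ?thesis using r by blast
  qed
  show "(f has_real_derivative deriv f x) (at x)" using main[of x] by auto
  show "real_analytic (deriv f)" unfolding real_analytic_def using main by meson
qed

lemma of_int_mult_between:
  fixes T x :: real
  assumes "0 < T" "0 < x" "x < 2 * T" "x = of_int k * T"
  shows "x = T"
proof -
  have "0 < real_of_int k" using assms by (metis zero_less_mult_pos2)
  moreover have "real_of_int k < 2" using assms by (metis mult_less_cancel_right_pos)
  ultimately have "k = 1" by linarith
  then show ?thesis using assms by simp
qed

lemma analytic_periodic_well:
  assumes f: "real_analytic f" and T: "0 < T" and per: "\<And>x. f (x + 2 * T) = f x"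
    and pos: "\<And>x. (\<And>k::int. x \<noteq> of_int k * T) \<Longrightarrow> 0 < f x"
    and zero: "\<And>k::int. f (of_int k * T) = 0" "\<And>k::int. deriv f (of_int k * T) = 0"
      "\<And>k::int. deriv (deriv f) (of_int k * T) \<noteq> 0"
  shows "periodic_well f (deriv f) (deriv (deriv f)) T"
proof
  note d = real_analytic_deriv[OF f]
  note d2 = real_analytic_deriv[OF d(2)]
  show "T > 0" "f (x + 2 * T) = f x" for x by (rule T per)+
  show "(f has_real_derivative deriv f x) (at x)" "(deriv f has_real_derivative deriv (deriv f) x) (at x)" for x
    by (rule d(1) d2(1))+
  show "continuous_on UNIV (deriv (deriv f))"
    using real_analytic_deriv(1)[OF d2(2)] by (meson DERIV_isCont continuous_at_imp_continuous_on)
  show "f 0 = 0" "deriv f 0 = 0" "deriv (deriv f) 0 \<noteq> 0"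
    using zero(1)[of 0] zero(2)[of 0] zero(3)[of 0] by simp_all
  show "f T = 0" "deriv f T = 0" "deriv (deriv f) T \<noteq> 0"
    using zero(1)[of 1] zero(2)[of 1] zero(3)[of 1] by simp_all
  show "0 < f x" if "0 < x" "x < 2 * T" "x \<noteq> T" for x
    by (rule pos) (use of_int_mult_between[OF T that(1,2)] that(3) in blast)
  show "0 \<le> f x" for x using pos[of x] zero(1) by (cases "\<exists>k::int. x = of_int k * T") (auto intro: less_imp_le)
qed

text \<open>The separated equations involve two derivatives only, so closure under composition is
  proved at this order instead of for \<open>Ck_on\<close> at every order.\<close>

definition twice_differentiable :: "('a::euclidean_space \<Rightarrow> 'b::real_normed_vector) \<Rightarrow> 'a set \<Rightarrow> bool" where
  "twice_differentiable f S \<longleftrightarrow>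
     (\<forall>x\<in>S. f differentiable at x) \<and> (\<forall>x\<in>S. \<forall>v. (\<lambda>x. frechet_derivative f (at x) v) differentiable at x)"

lemma smooth_on_imp_twice_differentiable:
  assumes "smooth_on S f" shows "twice_differentiable f S"
proof -
  have "Ck_on (Suc (Suc 0)) S f" using assms by (simp add: smooth_on_def)
  then show ?thesis by (auto simp: twice_differentiable_def)
qed

text \<open>The derivative of \<open>F\<close> is known to be differentiable only in a fixed
  direction, but the chain rule evaluates it in the moving direction \<open>d\<Phi> v\<close>.
  Expanding that direction in the basis leaves fixed directions with differentiable scalar
  coefficients.\<close>

lemma twice_differentiable_compose:
  fixes \<Phi> :: "'a::euclidean_space \<Rightarrow> 'b::euclidean_space" and F :: "'b \<Rightarrow> 'c::real_normed_vector"
  assumes \<Phi>: "twice_differentiable \<Phi> W" and F: "twice_differentiable F U" and W: "open W"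
    and img: "\<And>z. z \<in> W \<Longrightarrow> \<Phi> z \<in> U" and eq: "\<And>z. z \<in> W \<Longrightarrow> f z = F (\<Phi> z)"
  shows "twice_differentiable f W"
proof -
  have d: "(f has_derivative (\<lambda>v. frechet_derivative F (at (\<Phi> z)) (frechet_derivative \<Phi> (at z) v))) (at z)" if z: "z \<in> W" for z
  proof -
    have "(\<Phi> has_derivative frechet_derivative \<Phi> (at z)) (at z)"
      using \<Phi> z by (intro frechet_derivative_works[THEN iffD1]) (simp add: twice_differentiable_def)
    moreover have "(F has_derivative frechet_derivative F (at (\<Phi> z))) (at (\<Phi> z))"
      using F img[OF z] by (intro frechet_derivative_works[THEN iffD1]) (simp add: twice_differentiable_def)
    ultimately have "((\<lambda>x. F (\<Phi> x)) has_derivative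
        (\<lambda>v. frechet_derivative F (at (\<Phi> z)) (frechet_derivative \<Phi> (at z) v))) (at z)"
      by (rule has_derivative_compose)
    then show ?thesis
      by (rule has_derivative_transform_within_open[OF _ W z]) (simp add: eq)
  qed
  have fd: "frechet_derivative f (at z) v =
     (\<Sum>e\<in>Basis. (frechet_derivative \<Phi> (at z) v \<bullet> e) *\<^sub>R frechet_derivative F (at (\<Phi> z)) e)" if z: "z \<in> W" for z v
  proof -
    have lin: "linear (frechet_derivative F (at (\<Phi> z)))"
      using F img[OF z] by (intro linear_frechet_derivative) (simp add: twice_differentiable_def)
    have "frechet_derivative f (at z) v = frechet_derivative F (at (\<Phi> z)) (frechet_derivative \<Phi> (at z) v)"
      using frechet_derivative_at[OF d[OF z]] by metis
    also have "\<dots> = frechet_derivative F (at (\<Phi> z)) (\<Sum>e\<in>Basis. (frechet_derivative \<Phi> (at z) v \<bullet> e) *\<^sub>R e)"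
      by (simp add: euclidean_representation)
    also have "\<dots> = (\<Sum>e\<in>Basis. (frechet_derivative \<Phi> (at z) v \<bullet> e) *\<^sub>R frechet_derivative F (at (\<Phi> z)) e)"
      using lin by (simp add: linear_sum linear_scale)
    finally show ?thesis .
  qed
  have "(\<lambda>x. frechet_derivative f (at x) v) differentiable at z" if z: "z \<in> W" for z v
  proof -
    have 1: "(\<lambda>x. frechet_derivative \<Phi> (at x) v) differentiable at z"
      using \<Phi> z by (simp add: twice_differentiable_def)
    have 2: "(\<lambda>x. frechet_derivative F (at (\<Phi> x)) e) differentiable at z" for e
    proof (rule differentiable_compose[where f = "\<lambda>y. frechet_derivative F (at y) e" and g = \<Phi>])
      show "(\<lambda>y. frechet_derivative F (at y) e) differentiable at (\<Phi> z)"
        using F img[OF z] by (simp add: twice_differentiable_def)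
      show "\<Phi> differentiable at z" using \<Phi> z by (simp add: twice_differentiable_def)
    qed
    have "(\<lambda>x. \<Sum>e\<in>Basis. (frechet_derivative \<Phi> (at x) v \<bullet> e) *\<^sub>R frechet_derivative F (at (\<Phi> x)) e) differentiable at z"
    proof (intro differentiable_sum ballI)
      fix e :: 'b
      from 1 2[of e] obtain D1 D2 where "((\<lambda>x. frechet_derivative \<Phi> (at x) v) has_derivative D1) (at z)"
        "((\<lambda>x. frechet_derivative F (at (\<Phi> x)) e) has_derivative D2) (at z)"
        unfolding differentiable_def by blast
      from has_derivative_scaleR[OF has_derivative_inner_left[OF this(1)] this(2)]
      show "(\<lambda>x. (frechet_derivative \<Phi> (at x) v \<bullet> e) *\<^sub>R frechet_derivative F (at (\<Phi> x)) e) differentiable at z"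
        unfolding differentiable_def by blast
    qed auto
    then obtain D where "((\<lambda>x. \<Sum>e\<in>Basis. (frechet_derivative \<Phi> (at x) v \<bullet> e) *\<^sub>R frechet_derivative F (at (\<Phi> x)) e) has_derivative D) (at z)"
      by (auto simp: differentiable_def)
    then have "((\<lambda>x. frechet_derivative f (at x) v) has_derivative D) (at z)"
      by (rule has_derivative_transform_within_open[OF _ W z]) (simp add: fd)
    then show ?thesis by (auto simp: differentiable_def)
  qed
  then show ?thesis using d unfolding twice_differentiable_def differentiable_def by blast
qed

lemma Ck_on_subset: "Ck_on k S f \<Longrightarrow> V \<subseteq> S \<Longrightarrow> Ck_on k V f"
  by (induction k arbitrary: f) (auto intro: continuous_on_subset)

lemma det_mat_2: "det (mat c :: real ^ 2 ^ 2) = c\<^sup>2"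
  by (simp add: det_2 mat_def power2_eq_square)

lemma matrix_inv_mat_2:
  assumes "c \<noteq> 0" shows "matrix_inv (mat c :: real ^ 2 ^ 2) = mat (1 / c)"
proof -
  define M where "M = (mat c :: real ^ 2 ^ 2)"
  define N where "N = (mat (1 / c) :: real ^ 2 ^ 2)"
  have N: "M ** N = mat 1 \<and> N ** M = mat 1"
    using assms by (simp add: M_def N_def matrix_matrix_mult_def mat_def vec_eq_iff forall_2 sum_2)
  \<comment> \<open>\<open>matrix_inv\<close> is a choice among inverses, so \<open>N\<close> only
    proves that it is one; uniqueness then identifies it with \<open>N\<close>.\<close>
  then have inv: "M ** matrix_inv M = mat 1 \<and> matrix_inv M ** M = mat 1"
    unfolding matrix_inv_def by (rule someI)
  have "matrix_inv M = matrix_inv M ** (M ** N)" using N by simp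
  also have "\<dots> = (matrix_inv M ** M) ** N" by (simp only: matrix_mul_assoc)
  also have "\<dots> = N" using inv by simp
  finally show ?thesis by (simp add: M_def N_def)
qed

lemma partial_transform_within_open:
  assumes "f differentiable at z" "open V" "z \<in> V" "\<And>x. x \<in> V \<Longrightarrow> f x = g x"
  shows "partial i g z = partial i f z"
proof -
  have "(g has_derivative frechet_derivative f (at z)) (at z)"
    by (rule has_derivative_transform_within_open[OF frechet_derivative_works[THEN iffD1, OF assms(1)] assms(2,3)])
      (rule assms(4))
  then show ?thesis unfolding partial_def using frechet_derivative_at by metis
qed

lemma vector_2_eq_axis: "(vector [x, y] :: real ^ 2) = x *\<^sub>R axis 1 1 + y *\<^sub>R axis 2 1"
  by (simp add: vec_eq_iff forall_2 axis_def)

lemma continuous_on_vector_2: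
  "continuous_on S f \<Longrightarrow> continuous_on S g \<Longrightarrow> continuous_on S (\<lambda>p. vector [f p, g p] :: real ^ 2)"
  unfolding vector_2_eq_axis by (intro continuous_intros)

lemma has_vector_derivative_along_axis:
  fixes F :: "real ^ 2 \<Rightarrow> 'b::real_normed_vector"
  assumes F: "F differentiable at (p t)" and p: "(p has_derivative (\<lambda>s. s *\<^sub>R axis i 1)) (at t)"
  shows "((\<lambda>t. F (p t)) has_vector_derivative partial i F (p t)) (at t)"
proof -
  have "((\<lambda>t. F (p t)) has_derivative (\<lambda>s. frechet_derivative F (at (p t)) (s *\<^sub>R axis i 1))) (at t)"
    by (rule has_derivative_compose[OF p frechet_derivative_works[THEN iffD1, OF F]])
  then show ?thesis unfolding has_vector_derivative_def partial_def
    by (simp add: linear_scale[OF linear_frechet_derivative[OF F]])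
qed

text \<open>Extends the separated equations to the points of the lattice, where the operator \<open>P2\<close> is not
  defined.\<close>

lemma deriv_eq_limit:
  fixes p r :: "real \<Rightarrow> real"
  assumes p: "\<And>x. (p has_real_derivative p' x) (at x)"
    and eq: "\<forall>\<^sub>F x in at_right x0. p' x = r x" and r: "isCont r x0"
  shows "p' x0 = r x0"
proof -
  have "isCont p x0" using p DERIV_isCont by blast
  then have "(p \<longlongrightarrow> p x0) (at_right x0)" using isContD tendsto_within_subset by blast
  then have num: "((\<lambda>x. p x - p x0) \<longlongrightarrow> 0) (at_right x0)" by (rule LIM_zero)
  have "((\<lambda>x. x) \<longlongrightarrow> x0) (at_right x0)" by (rule tendsto_ident_at)
  then have den: "((\<lambda>x. x - x0) \<longlongrightarrow> 0) (at_right x0)" by (rule LIM_zero)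
  have "(r \<longlongrightarrow> r x0) (at_right x0)" using isContD[OF r] tendsto_within_subset by blast
  then have quot: "((\<lambda>x. p' x / 1) \<longlongrightarrow> r x0) (at_right x0)"
  proof (rule Lim_transform_eventually)
    show "\<forall>\<^sub>F x in at_right x0. r x = p' x / 1" using eq by (rule eventually_mono) simp
  qed
  have "((\<lambda>x. (p x - p x0) / (x - x0)) \<longlongrightarrow> r x0) (at_right x0)"
  proof (rule lhopital_right[OF num den _ _ _ _ quot])
    show "\<forall>\<^sub>F x in at_right x0. x - x0 \<noteq> 0" by (auto simp: eventually_at_filter)
    show "\<forall>\<^sub>F x in at_right x0. ((\<lambda>x. p x - p x0) has_real_derivative p' x) (at x)"
      using DERIV_diff[OF p DERIV_const] by (intro always_eventually allI) simp
    show "\<forall>\<^sub>F x in at_right x0. ((\<lambda>x. x - x0) has_real_derivative 1) (at x)"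
      using DERIV_diff[OF DERIV_ident DERIV_const] by (intro always_eventually allI) simp
  qed simp
  moreover have "((\<lambda>x. (p x - p x0) / (x - x0)) \<longlongrightarrow> p' x0) (at_right x0)"
    using p[of x0] unfolding has_field_derivative_iff by (rule tendsto_within_subset) simp
  ultimately show ?thesis by (meson tendsto_unique trivial_limit_at_right_real)
qed

section \<open>The lattice, and integration over the coordinate plane\<close>

lemma closed_lattice:
  assumes "L1 > 0" "L2 > 0" shows "closed (lattice L1 L2)"
proof -
  have "lattice L1 L2 = {z. z $ 1 / L1 \<in> \<int>} \<inter> {z. z $ 2 / L2 \<in> \<int>}"
    using assms by (fastforce simp: lattice_def vec_eq_iff forall_2 Ints_def field_simps)
  also have "closed \<dots>"
    by (intro closed_Int continuous_closed_vimage[OF closed_Ints, unfolded vimage_def] continuous_intros)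
      (use assms in auto)
  finally show ?thesis .
qed

text \<open>The norm on the surface integrates over \<open>real ^ 2\<close>, iterated integrals live
  on \<open>real \<times> real\<close>; agreement on boxes identifies the two Lebesgue
  measures.\<close>

lemma lborel_vector_2: "distr lborel borel (\<lambda>p. vector [fst p, snd p]) = (lborel :: (real ^ 2) measure)"
proof (rule lborel_eqI[symmetric])
  let ?\<tau> = "\<lambda>p :: real \<times> real. vector [fst p, snd p] :: real ^ 2"
  have "continuous_on UNIV ?\<tau>" by (intro continuous_on_vector_2 continuous_intros)
  then have m: "?\<tau> \<in> borel_measurable lborel" by (simp add: borel_measurable_continuous_onI)
  show "sets (distr lborel borel ?\<tau>) = sets borel" by simp
  fix l u :: "real ^ 2" assume le: "\<And>b. b \<in> Basis \<Longrightarrow> l \<bullet> b \<le> u \<bullet> b"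
  have le': "l $ 1 \<le> u $ 1" "l $ 2 \<le> u $ 2"
    using le[of "axis 1 1"] le[of "axis 2 1"] by (auto simp: cart_eq_inner_axis Basis_vec_def)
  have "emeasure (distr lborel borel ?\<tau>) (box l u) = emeasure lborel (?\<tau> -` box l u)"
    using m by (subst emeasure_distr) auto
  also have "?\<tau> -` box l u = box (l $ 1, l $ 2) (u $ 1, u $ 2)"
    by (auto simp: mem_box_cart forall_2 box_prod)
  also have "emeasure lborel \<dots> = (\<Prod>b\<in>Basis. ((u $ 1, u $ 2) - (l $ 1, l $ 2)) \<bullet> b)"
    using le' by (intro emeasure_lborel_box) (auto simp: Basis_prod_def)
  also have "(\<Prod>b\<in>Basis. ((u $ 1, u $ 2) - (l $ 1, l $ 2)) \<bullet> b) = (u $ 1 - l $ 1) * (u $ 2 - l $ 2)"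
    by (simp add: Basis_prod_def)
  also have "\<dots> = (\<Prod>b\<in>Basis. (u - l) \<bullet> b)"
    by (simp add: Basis_vec_def UNIV_2 inner_axis axis_eq_axis)
  finally show "emeasure (distr lborel borel ?\<tau>) (box l u) = (\<Prod>b\<in>Basis. (u - l) \<bullet> b)" .
qed

lemma set_integral_vector_2:
  fixes g :: "real ^ 2 \<Rightarrow> real"
  assumes g: "continuous_on UNIV g" and V: "V \<in> sets borel"
    and sub: "\<And>x y. vector [x, y] \<in> V \<Longrightarrow> 0 \<le> x \<and> x \<le> L1 \<and> 0 \<le> y \<and> y \<le> L2"
    and rest: "negligible {(x, y). 0 \<le> x \<and> x \<le> L1 \<and> 0 \<le> y \<and> y \<le> L2 \<and> vector [x, y] \<notin> V}"
  shows "(LINT z:V|lborel. g z) = integral {0..L2} (\<lambda>y. integral {0..L1} (\<lambda>x. g (vector [x, y])))"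
proof -
  let ?\<tau> = "\<lambda>p :: real \<times> real. vector [fst p, snd p] :: real ^ 2"
  let ?R = "cbox (0, 0) (L1, L2)"
  have c\<tau>: "continuous_on UNIV ?\<tau>" by (intro continuous_on_vector_2 continuous_intros)
  then have m: "?\<tau> \<in> borel_measurable borel" by (rule borel_measurable_continuous_onI)
  have cg: "continuous_on UNIV (\<lambda>p. g (?\<tau> p))"
    by (rule continuous_on_compose2[OF g c\<tau>]) simp
  have V': "?\<tau> -` V \<in> sets borel" using measurable_sets[OF m V] by simp
  have VR: "?\<tau> -` V \<subseteq> ?R" using sub by (auto simp: cbox_Pair_eq)
  have gm: "g \<in> borel_measurable borel" using g by (rule borel_measurable_continuous_onI)
  have "(LINT z:V|lborel. g z) = (LINT z|distr lborel borel ?\<tau>. indicator V z *\<^sub>R g z)"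
    by (simp add: lborel_vector_2 set_lebesgue_integral_def)
  also have "\<dots> = (LINT p|lborel. indicator V (?\<tau> p) *\<^sub>R g (?\<tau> p))"
    using m V gm by (intro integral_distr) auto
  also have "\<dots> = (LINT p:(?\<tau> -` V)|lborel. g (?\<tau> p))"
    by (simp add: set_lebesgue_integral_def indicator_vimage)
  also have "\<dots> = integral (?\<tau> -` V) (\<lambda>p. g (?\<tau> p))"
  proof (rule set_borel_integral_eq_integral)
    have "set_integrable lborel ?R (\<lambda>p. g (?\<tau> p))"
      unfolding set_integrable_def
      by (intro borel_integrable_compact compact_cbox continuous_on_subset[OF cg]) simp
    then show "set_integrable lborel (?\<tau> -` V) (\<lambda>p. g (?\<tau> p))"
      by (rule set_integrable_subset) (use V' VR in auto)
  qed
  also have "\<dots> = integral ?R (\<lambda>p. g (?\<tau> p))"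
  proof (rule integral_spike_set)
    have "{p \<in> ?\<tau> -` V - ?R. g (?\<tau> p) \<noteq> 0} = {}" using VR by blast
    then show "negligible {p \<in> ?\<tau> -` V - ?R. g (?\<tau> p) \<noteq> 0}" by (simp only: negligible_empty)
    show "negligible {p \<in> ?R - ?\<tau> -` V. g (?\<tau> p) \<noteq> 0}"
      by (rule negligible_subset[OF rest]) (auto simp: cbox_Pair_eq)
  qed
  also have "\<dots> = integral {0..L1} (\<lambda>x. integral {0..L2} (\<lambda>y. g (vector [x, y])))"
    using integral_prod_continuous[of 0 0 L1 L2 "\<lambda>p. g (?\<tau> p)"] continuous_on_subset[OF cg] by simp
  also have "\<dots> = integral {0..L2} (\<lambda>y. integral {0..L1} (\<lambda>x. g (vector [x, y])))"
    by (rule integral_swap[symmetric]) (use cg in \<open>simp add: case_prod_beta\<close>)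
  finally show ?thesis .
qed

lemma integral_reflect_interval:
  fixes f :: "real \<Rightarrow> real"
  shows "integral {0..L} (\<lambda>x. f (L - x)) = integral {0..L} f"
proof -
  have "integral {0..L} (\<lambda>x. f (L - x)) = integral {-L..-0} (\<lambda>x. f (L - (- x)))"
    using Henstock_Kurzweil_Integration.integral_reflect_real[of L 0 "\<lambda>x. f (L - x)"] by simp
  also have "\<dots> = integral {0 - L..L - L} (\<lambda>x. f (x + L))" by (simp add: add.commute)
  also have "\<dots> = integral {0..L} f" by (rule integral_shift_real_ivl)
  finally show ?thesis .
qed

section \<open>The covering map: pullback, symmetries and local charts\<close>

context liouville_coordinates begin

lemma \<Phi>_twice: "twice_differentiable \<Phi> UNIV"
  using smooth by (rule smooth_on_imp_twice_differentiable)

lemma \<Phi>_differentiable: "\<Phi> differentiable at z"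
  using \<Phi>_twice by (simp add: twice_differentiable_def)

lemma \<Phi>_continuous: "continuous_on A \<Phi>"
  using \<Phi>_differentiable by (meson continuous_at_imp_continuous_on differentiable_imp_continuous_within)

lemma pullback_twice_differentiable:
  assumes "smooth_on_subset (ellipsoid \<alpha>) u"
  shows "twice_differentiable (u \<circ> \<Phi>) UNIV"
proof -
  have "(u \<circ> \<Phi>) differentiable at z \<and> (\<forall>v. (\<lambda>x. frechet_derivative (u \<circ> \<Phi>) (at x) v) differentiable at z)" for z
  proof -
    have z: "\<Phi> z \<in> ellipsoid \<alpha>" for z using surj by blast
    obtain U F where U: "open U" "\<Phi> z \<in> U" "smooth_on U F" "\<And>x. x \<in> ellipsoid \<alpha> \<inter> U \<Longrightarrow> F x = u x"
      using assms z[of z] unfolding smooth_on_subset_def by meson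
    have W: "open (\<Phi> -` U)" by (rule open_vimage[OF U(1) \<Phi>_continuous])
    have "twice_differentiable (u \<circ> \<Phi>) (\<Phi> -` U)"
    proof (rule twice_differentiable_compose[OF _ smooth_on_imp_twice_differentiable[OF U(3)] W])
      show "twice_differentiable \<Phi> (\<Phi> -` U)" using \<Phi>_twice by (simp add: twice_differentiable_def)
    qed (use U z in auto)
    then show ?thesis using U(2) by (auto simp: twice_differentiable_def)
  qed
  then show ?thesis by (simp add: twice_differentiable_def)
qed

lemma \<Phi>_symmetric:
  assumes "c \<in> lattice (2 * T1) (2 * T2)"
  shows "\<Phi> (c - z) = \<Phi> z"
  using fibres[of z "c - z"] assms by simp

lemma conformal_factor: "a (z $ 1) + b (z $ 2) = (norm (partial i \<Phi> z))\<^sup>2"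
proof -
  have "metric \<Phi> z $ i $ i = a (z $ 1) + b (z $ 2)" by (simp add: liouville_metric mat_def)
  then show ?thesis by (simp add: metric_def power2_norm_eq_inner)
qed

text \<open>\<open>\<Phi>\<close> is invariant under the isometry \<open>z \<mapsto> c - z\<close>
  of the plane, so its partial derivatives have the same length at both points. This is the source
  of the evenness and periodicity of \<open>a\<close> and \<open>b\<close>, which are not among the
  axioms.\<close>

lemma conformal_factor_symmetric:
  assumes "c \<in> lattice (2 * T1) (2 * T2)"
  shows "a ((c - z) $ 1) + b ((c - z) $ 2) = a (z $ 1) + b (z $ 2)"
proof -
  have "((\<lambda>z. c - z) has_derivative (\<lambda>v. - v)) (at z)" by (auto intro!: derivative_eq_intros)
  from has_derivative_compose[OF this frechet_derivative_works[THEN iffD1, OF \<Phi>_differentiable]]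
  have "(\<Phi> has_derivative (\<lambda>v. frechet_derivative \<Phi> (at (c - z)) (- v))) (at z)"
    by (simp add: \<Phi>_symmetric[OF assms])
  then have "partial 1 \<Phi> z = frechet_derivative \<Phi> (at (c - z)) (- axis 1 1)"
    unfolding partial_def using frechet_derivative_at by metis
  also have "\<dots> = - partial 1 \<Phi> (c - z)"
    unfolding partial_def using linear_frechet_derivative[OF \<Phi>_differentiable] by (simp add: linear_neg)
  finally have "norm (partial 1 \<Phi> z) = norm (partial 1 \<Phi> (c - z))" by simp
  then show ?thesis using conformal_factor[of z 1] conformal_factor[of "c - z" 1] by metis
qed

lemma vector_in_lattice_iff:
  "vector [x, y] \<in> lattice L1 L2 \<longleftrightarrow> (\<exists>k::int. x = of_int k * L1) \<and> (\<exists>l::int. y = of_int l * L2)"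
  by (auto simp: lattice_def vec_eq_iff forall_2)

lemma a_0: "a 0 = 0" and b_0: "b 0 = 0"
  using a_zero[of 0] b_zero[of 0] by simp_all

text \<open>On the axis where the second coordinate is 0, \<open>b\<close> vanishes before and after
  the reflection, which isolates \<open>a\<close>. Two of these reflections compose to the
  translation by \<open>2 * T1\<close>.\<close>

lemma a_reflect: "a (2 * T1 * of_int k - x) = a x"
  using conformal_factor_symmetric[of "vector [2 * T1 * of_int k, 0]" "vector [x, 0]"] b_0
  by (auto simp: vector_in_lattice_iff mult.commute intro: exI[of _ 0] exI[of _ k])

lemma b_reflect: "b (2 * T2 * of_int k - y) = b y"
  using conformal_factor_symmetric[of "vector [0, 2 * T2 * of_int k]" "vector [0, y]"] a_0
  by (auto simp: vector_in_lattice_iff mult.commute intro: exI[of _ 0] exI[of _ k])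

lemma nonneg: "0 \<le> a x + b y"
  using conformal_factor[of "vector [x, y]" 1] by simp

lemma a_well: "periodic_well a (deriv a) (deriv (deriv a)) T1"
proof (rule analytic_periodic_well[OF a_analytic T1_pos])
  show "a (x + 2 * T1) = a x" for x using a_reflect[of 1 "- x"] a_reflect[of 0 x] by (simp add: add.commute)
  show "0 < a x" if "\<And>k::int. x \<noteq> of_int k * T1" for x
    using liouville_pos[of "vector [x, 0]"] b_0 that by (simp add: vector_in_lattice_iff)
qed (rule a_zero a_deriv a_deriv2)+

lemma b_well: "periodic_well b (deriv b) (deriv (deriv b)) T2"
proof (rule analytic_periodic_well[OF b_analytic T2_pos])
  show "b (x + 2 * T2) = b x" for x using b_reflect[of 1 "- x"] b_reflect[of 0 x] by (simp add: add.commute)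
  show "0 < b x" if "\<And>k::int. x \<noteq> of_int k * T2" for x
    using liouville_pos[of "vector [0, x]"] a_0 that by (simp add: vector_in_lattice_iff)
qed (rule b_zero b_deriv b_deriv2)+

text \<open>The Laplace equation is available in injective charts only. Two points with the same
  image have their sum or their difference in the period lattice. Close to \<open>z\<close> the sum
  is close to \<open>2 z\<close>, which is not a period off \<open>lattice T1 T2\<close>, and the
  difference is too short to be a nonzero period.\<close>

lemma locally_injective:
  assumes z: "z \<notin> lattice T1 T2"
  obtains V where "open V" "z \<in> V" "inj_on \<Phi> V" "V \<inter> lattice T1 T2 = {}"
proof -
  let ?L = "lattice (2 * T1) (2 * T2)"
  have "2 *\<^sub>R z \<notin> ?L" using z by (auto simp: lattice_def vec_eq_iff forall_2)
  moreover have "closed ?L" using T1_pos T2_pos by (intro closed_lattice) auto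
  ultimately obtain e where e: "e > 0" "ball (2 *\<^sub>R z) e \<subseteq> - ?L"
    by (metis Compl_iff open_Compl open_contains_ball_eq)
  define d where "d = min (e / 2) (min T1 T2)"
  have d: "d > 0" "2 * d \<le> e" "d \<le> T1" "d \<le> T2" using e T1_pos T2_pos by (auto simp: d_def)
  define V where "V = ball z d \<inter> - lattice T1 T2"
  show ?thesis
  proof (rule that)
    show "open V" unfolding V_def using closed_lattice[OF T1_pos T2_pos] by auto
    show "z \<in> V" using z d by (simp add: V_def)
    show "V \<inter> lattice T1 T2 = {}" by (auto simp: V_def)
    show "inj_on \<Phi> V"
    proof (rule inj_onI)
      fix x y assume xy: "x \<in> V" "y \<in> V" "\<Phi> x = \<Phi> y"
      then have n: "norm (x - z) < d" "norm (y - z) < d" by (auto simp: V_def dist_norm norm_minus_commute)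
      have "y + x \<notin> ?L"
      proof -
        have "norm ((x - z) + (y - z)) < 2 * d" using norm_triangle_ineq[of "x - z" "y - z"] n by linarith
        then have "y + x \<in> ball (2 *\<^sub>R z) e" using d
          by (simp add: dist_norm norm_minus_commute scaleR_2 algebra_simps)
        then show ?thesis using e by blast
      qed
      then have "y - x \<in> ?L" using fibres[of x y] xy by simp
      then obtain k l :: int where kl: "y $ 1 - x $ 1 = of_int k * (2 * T1)" "y $ 2 - x $ 2 = of_int l * (2 * T2)"
        by (auto simp: lattice_def vec_eq_iff forall_2)
      have "norm ((y - z) - (x - z)) < 2 * d" using norm_triangle_ineq4[of "y - z" "x - z"] n by linarith
      then have "norm (y - x) < 2 * d" by simp
      then have "\<bar>y $ 1 - x $ 1\<bar> < 2 * T1" "\<bar>y $ 2 - x $ 2\<bar> < 2 * T2"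
        using component_le_norm_cart[of "y - x" 1] component_le_norm_cart[of "y - x" 2] d by auto
      then have "k = 0" "l = 0" unfolding kl using T1_pos T2_pos by (auto simp: abs_mult)
      then show "x = y" using kl by (simp add: vec_eq_iff forall_2)
    qed
  qed
qed

text \<open>In dimension two the square root of the determinant and the inverse of a conformal
  metric cancel, so the conformal factor survives only in front.\<close>

lemma chart_laplacian_eq:
  assumes f: "twice_differentiable f UNIV" and z: "z \<notin> lattice T1 T2"
  shows "chart_laplacian \<Phi> f z =
    (1 / (a (z $ 1) + b (z $ 2))) *\<^sub>R (partial 1 (partial 1 f) z + partial 2 (partial 2 f) z)"
proof -
  define W where "W = - lattice T1 T2"
  have W: "open W" "z \<in> W" using closed_lattice[OF T1_pos T2_pos] z by (auto simp: W_def)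
  have pos: "0 < a (x $ 1) + b (x $ 2)" if "x \<in> W" for x using liouville_pos that by (simp add: W_def)
  have sq: "sqrt (det (metric \<Phi> x)) = a (x $ 1) + b (x $ 2)" if "x \<in> W" for x
    using pos[OF that] by (simp add: liouville_metric det_mat_2)
  have eq: "partial i f x = sqrt (det (metric \<Phi> x)) *\<^sub>R
           (\<Sum>j\<in>UNIV. (matrix_inv (metric \<Phi> x) $ i $ j) *\<^sub>R partial j f x)" if "x \<in> W" for x and i :: 2
  proof -
    have "matrix_inv (metric \<Phi> x) = mat (1 / (a (x $ 1) + b (x $ 2)))"
      unfolding liouville_metric using pos[OF that] by (intro matrix_inv_mat_2) simp
    moreover have "i = 1 \<or> i = 2" using exhaust_2 by blast
    ultimately show ?thesis using sq[OF that] pos[OF that] by (auto simp: sum_2 mat_def)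
  qed
  have "partial i (\<lambda>x. sqrt (det (metric \<Phi> x)) *\<^sub>R
           (\<Sum>j\<in>UNIV. (matrix_inv (metric \<Phi> x) $ i $ j) *\<^sub>R partial j f x)) z = partial i (partial i f) z" for i :: 2
    by (rule partial_transform_within_open[OF _ W eq])
      (use f in \<open>auto simp: twice_differentiable_def partial_def[abs_def]\<close>)
  then show ?thesis unfolding chart_laplacian_def by (simp add: sum_2 sq[OF W(2)])
qed

text \<open>For \<open>X\<close> and \<open>Y\<close> the two eigenvalue equations are the linear
  system \<open>X + Y = - \<mu> f\<close>, \<open>b X - a Y = - \<mu> E f\<close>, whose determinant
  \<open>- (a + b) = - \<mu>\<close> does not vanish off the lattice.\<close>

lemma separation:
  assumes joint: "joint_eigenfunction \<alpha> T1 T2 \<Phi> a b h E u" and z: "z \<notin> lattice T1 T2"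
  defines "f \<equiv> u \<circ> \<Phi>"
  shows "h\<^sup>2 *\<^sub>R partial 1 (partial 1 f) z = - ((a (z $ 1) + E) *\<^sub>R f z)"
    and "h\<^sup>2 *\<^sub>R partial 2 (partial 2 f) z = - ((b (z $ 2) - E) *\<^sub>R f z)"
proof -
  define \<mu> where "\<mu> = a (z $ 1) + b (z $ 2)"
  have \<mu>: "\<mu> > 0" using liouville_pos[OF z] by (simp add: \<mu>_def)
  define X where "X = h\<^sup>2 *\<^sub>R partial 1 (partial 1 f) z"
  define Y where "Y = h\<^sup>2 *\<^sub>R partial 2 (partial 2 f) z"
  have f: "twice_differentiable f UNIV"
    unfolding f_def using joint by (intro pullback_twice_differentiable) (simp add: joint_eigenfunction_def)
  obtain w where w: "laplace_beltrami_eq (ellipsoid \<alpha>) u w" "\<And>p. p \<in> ellipsoid \<alpha> \<Longrightarrow> - (h\<^sup>2 *\<^sub>R w p) - u p = 0"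
    using joint by (auto simp: joint_eigenfunction_def P1_eq_zero_def)
  obtain V where V: "open V" "z \<in> V" "inj_on \<Phi> V" "V \<inter> lattice T1 T2 = {}"
    using locally_injective[OF z] .
  have "regular_parametrization (ellipsoid \<alpha>) V \<Phi>"
    unfolding regular_parametrization_def
  proof (intro conjI V ballI)
    show "smooth_on V \<Phi>" using smooth Ck_on_subset[of _ UNIV \<Phi> V] unfolding smooth_on_def by simp
    show "\<Phi> ` V \<subseteq> ellipsoid \<alpha>" using surj by blast
    show "det (metric \<Phi> x) \<noteq> 0" if "x \<in> V" for x
    proof -
      have "x \<notin> lattice T1 T2" using V(4) that by blast
      then show ?thesis using liouville_pos[of x] by (simp add: liouville_metric det_mat_2)
    qed
  qed
  then have "chart_laplacian \<Phi> f z = w (\<Phi> z)"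
    using w(1) V(2) unfolding laplace_beltrami_eq_def f_def by blast
  moreover have "f z = - (h\<^sup>2 *\<^sub>R w (\<Phi> z))"
    using w(2)[of "\<Phi> z"] surj unfolding f_def by (metis comp_apply eq_iff_diff_eq_0 rangeI)
  ultimately have "f z = - (h\<^sup>2 *\<^sub>R ((1 / \<mu>) *\<^sub>R (partial 1 (partial 1 f) z + partial 2 (partial 2 f) z)))"
    unfolding \<mu>_def chart_laplacian_eq[OF f z, symmetric] by simp
  also have "\<dots> = - ((1 / \<mu>) *\<^sub>R (X + Y))" by (simp add: X_def Y_def scaleR_add_right)
  finally have "\<mu> *\<^sub>R f z = \<mu> *\<^sub>R (- ((1 / \<mu>) *\<^sub>R (X + Y)))" by simp
  then have 1: "X + Y = - (\<mu> *\<^sub>R f z)" using \<mu> by simp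
  have "P2 a b h f z = E *\<^sub>R f z" using joint z by (simp add: joint_eigenfunction_def f_def)
  then have "- (inverse \<mu> *\<^sub>R (b (z $ 2) *\<^sub>R X - a (z $ 1) *\<^sub>R Y)) = E *\<^sub>R f z"
    by (simp add: P2_def X_def Y_def \<mu>_def)
  then have "\<mu> *\<^sub>R (- (inverse \<mu> *\<^sub>R (b (z $ 2) *\<^sub>R X - a (z $ 1) *\<^sub>R Y))) = \<mu> *\<^sub>R (E *\<^sub>R f z)" by simp
  then have "a (z $ 1) *\<^sub>R Y - b (z $ 2) *\<^sub>R X = \<mu> *\<^sub>R E *\<^sub>R f z" using \<mu> by simp
  then have 2: "b (z $ 2) *\<^sub>R X - a (z $ 1) *\<^sub>R Y = - (\<mu> *\<^sub>R E *\<^sub>R f z)" by (metis minus_diff_eq)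
  have "\<mu> *\<^sub>R X = (b (z $ 2) *\<^sub>R X - a (z $ 1) *\<^sub>R Y) + a (z $ 1) *\<^sub>R (X + Y)"
    by (simp add: \<mu>_def algebra_simps)
  also have "\<dots> = \<mu> *\<^sub>R (- ((a (z $ 1) + E) *\<^sub>R f z))" unfolding 1 2 by (simp add: algebra_simps)
  finally have X: "X = - ((a (z $ 1) + E) *\<^sub>R f z)" using \<mu> by (metis less_irrefl scaleR_left_imp_eq)
  then show "h\<^sup>2 *\<^sub>R partial 1 (partial 1 f) z = - ((a (z $ 1) + E) *\<^sub>R f z)" by (simp add: X_def)
  have "Y = - (\<mu> *\<^sub>R f z) - X" using 1 by (simp add: algebra_simps)
  then have "Y = - ((b (z $ 2) - E) *\<^sub>R f z)" unfolding X by (simp add: \<mu>_def algebra_simps)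
  then show "h\<^sup>2 *\<^sub>R partial 2 (partial 2 f) z = - ((b (z $ 2) - E) *\<^sub>R f z)" by (simp add: Y_def)
qed

section \<open>The mass and the separated equations on the whole torus\<close>

lemma conformal_factor_continuous: "continuous_on UNIV (\<lambda>z :: real ^ 2. a (z $ 1) + b (z $ 2))"
proof -
  have "continuous_on UNIV (\<lambda>z :: real ^ 2. a (z $ 1))"
    by (rule continuous_on_compose2[OF periodic_well.a_cont[OF a_well, of UNIV]]) (intro continuous_intros, simp)
  moreover have "continuous_on UNIV (\<lambda>z :: real ^ 2. b (z $ 2))"
    by (rule continuous_on_compose2[OF periodic_well.a_cont[OF b_well, of UNIV]]) (intro continuous_intros, simp)
  ultimately show ?thesis by (rule continuous_on_add)
qed

lemma pullback_continuous:
  assumes "smooth_on_subset (ellipsoid \<alpha>) u"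
  shows "continuous_on UNIV (u \<circ> \<Phi>)"
  using pullback_twice_differentiable[OF assms] unfolding twice_differentiable_def
  by (meson continuous_at_imp_continuous_on differentiable_imp_continuous_within)

text \<open>The torus covers the ellipsoid twice. Up to a null set the two rectangles fill the half
  \<open>0 \<le> y \<le> T2\<close> of a period cell, and the point reflection in the centre of the
  cell carries this half to the other one.\<close>

lemma torus_mass:
  assumes u: "smooth_on_subset (ellipsoid \<alpha>) u" and norm: "L2_normalized T1 T2 \<Phi> u"
  shows "integral {0..2*T2} (\<lambda>y. integral {0..2*T1} (\<lambda>x. (a x + b y) * (cmod (u (\<Phi> (vector [x, y]))))\<^sup>2)) = 2"
proof -
  define g where "g = (\<lambda>z. (cmod (u (\<Phi> z)))\<^sup>2 * (a (z $ 1) + b (z $ 2)))"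
  have cg: "continuous_on UNIV g"
    unfolding g_def using pullback_continuous[OF u]
    by (intro continuous_on_mult conformal_factor_continuous continuous_intros) (simp add: o_def)
  have cg': "continuous_on UNIV (\<lambda>(x, y). g (vector [x, y]))"
    unfolding case_prod_beta
    by (rule continuous_on_compose2[OF cg continuous_on_vector_2]) (auto intro!: continuous_intros)
  define V where "V = rect_pos T1 T2 \<union> rect_neg T1 T2"
  have "open V"
    unfolding V_def rect_pos_def rect_neg_def
    by (intro open_Un open_Collect_conj open_Collect_less continuous_intros)
  then have V: "V \<in> sets borel" by simp
  have "sqrt (LINT z:V|lborel. g z) = 1"
    using norm by (simp add: L2_normalized_def L2_norm_param_def V_def g_def liouville_metric det_mat_2 nonneg)
  then have "1 = (LINT z:V|lborel. g z)" by simp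
  also have "\<dots> = integral {0..T2} (\<lambda>y. integral {0..2*T1} (\<lambda>x. g (vector [x, y])))"
  proof (rule set_integral_vector_2[OF cg V])
    show "0 \<le> x \<and> x \<le> 2 * T1 \<and> 0 \<le> y \<and> y \<le> T2" if "vector [x, y] \<in> V" for x y
      using that T1_pos by (auto simp: V_def rect_pos_def rect_neg_def)
    have B: "(1 :: real, 0 :: real) \<in> Basis" "(0 :: real, 1 :: real) \<in> Basis" by (auto simp: Basis_prod_def)
    note line = negligible_standard_hyperplane[OF B(1)] negligible_standard_hyperplane[OF B(2)]
    have "negligible ({p :: real \<times> real. p \<bullet> (1, 0) = 0} \<union> {p. p \<bullet> (1, 0) = T1} \<union> {p. p \<bullet> (1, 0) = 2 * T1} \<union>
        {p. p \<bullet> (0, 1) = 0} \<union> {p. p \<bullet> (0, 1) = T2})"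
      by (intro negligible_Un line)
    then show "negligible {(x, y). 0 \<le> x \<and> x \<le> 2 * T1 \<and> 0 \<le> y \<and> y \<le> T2 \<and> vector [x, y] \<notin> V}"
      by (rule negligible_subset) (auto simp: V_def rect_pos_def rect_neg_def)
  qed
  finally have half: "integral {0..T2} (\<lambda>y. integral {0..2*T1} (\<lambda>x. g (vector [x, y]))) = 1" ..
  define J where "J = (\<lambda>y. integral {0..2*T1} (\<lambda>x. g (vector [x, y])))"
  have cJ: "continuous_on S J" for S unfolding J_def by (rule continuous_on_partial_integral[OF cg'])
  have gsym: "g (vector [2 * T1 - x, 2 * T2 - y]) = g (vector [x, y])" for x y
  proof -
    have c: "vector [2 * T1, 2 * T2] \<in> lattice (2 * T1) (2 * T2)"
      by (auto simp: vector_in_lattice_iff intro: exI[of _ 1])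
    have "vector [2 * T1 - x, 2 * T2 - y] = vector [2 * T1, 2 * T2] - (vector [x, y] :: real ^ 2)"
      by (simp add: vec_eq_iff forall_2)
    then show ?thesis unfolding g_def
      using conformal_factor_symmetric[OF c, of "vector [x, y]"] \<Phi>_symmetric[OF c] by simp
  qed
  have Jsym: "J (2 * T2 - y) = J y" for y
  proof -
    have "J (2 * T2 - y) = integral {0..2*T1} (\<lambda>x. g (vector [2 * T1 - x, 2 * T2 - y]))"
      unfolding J_def by (rule integral_reflect_interval[symmetric])
    then show ?thesis by (simp add: gsym J_def)
  qed
  have "integral {0..2*T2} J = integral {0..T2} J + integral {T2..2*T2} J"
    using T2_pos by (intro Henstock_Kurzweil_Integration.integral_combine[symmetric] integrable_continuous_real cJ) auto
  also have "integral {T2..2*T2} J = integral {0..T2} (\<lambda>y. J (y + T2))"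
    using integral_shift_real_ivl[of T2 T2 "2 * T2" J] by simp
  also have "\<dots> = integral {0..T2} (\<lambda>y. J (T2 - y + T2))"
    by (rule integral_reflect_interval[symmetric])
  also have "\<dots> = integral {0..T2} J"
    using Jsym by (simp add: algebra_simps)
  finally have "integral {0..2*T2} J = 2" using half by (simp add: J_def)
  then show ?thesis by (simp add: J_def g_def mult.commute)
qed

lemma eventually_not_lattice:
  fixes L x0 :: real
  assumes "0 < L"
  shows "\<forall>\<^sub>F x in at_right x0. \<forall>k::int. x \<noteq> of_int k * L"
proof -
  define k where "k = \<lfloor>x0 / L\<rfloor>"
  have k: "of_int k * L \<le> x0" "x0 < (of_int k + 1) * L"
    using of_int_floor_le[of "x0 / L"] real_of_int_floor_add_one_gt[of "x0 / L"] unfolding k_def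
    by (simp_all only: pos_le_divide_eq[OF assms] pos_divide_less_eq[OF assms])
  show ?thesis
    using eventually_at_right_real[OF k(2)]
  proof eventually_elim
    case (elim x)
    show ?case
    proof
      fix j :: int
      show "x \<noteq> of_int j * L"
      proof
        assume "x = of_int j * L"
        then have "of_int k * L < of_int j * L" "of_int j * L < (of_int k + 1) * L" using elim k by auto
        then have "real_of_int k < of_int j" "of_int j < real_of_int k + 1"
          using assms by (metis mult_less_cancel_right_pos)+
        then have "k < j" "real_of_int j < real_of_int (k + 1)" by simp_all
        then show False by (simp only: of_int_less_iff)
      qed
    qed
  qed
qed

text \<open>\<open>R\<close> stands for the real or the imaginary part, since the estimates for the
  ordinary differential equations concern real solutions.\<close>

lemma separated_component:
  assumes joint: "joint_eigenfunction \<alpha> T1 T2 \<Phi> a b h E u" and h: "h > 0" and R: "bounded_linear (R :: complex \<Rightarrow> real)"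
  shows "separated a b T1 T2 h E (\<lambda>x y. R (u (\<Phi> (vector [x, y]))))"
proof -
  define f where "f = u \<circ> \<Phi>"
  have u: "smooth_on_subset (ellipsoid \<alpha>) u" using joint by (simp add: joint_eigenfunction_def)
  have f: "twice_differentiable f UNIV" unfolding f_def by (rule pullback_twice_differentiable[OF u])
  have d0: "f differentiable at z" for z using f by (simp add: twice_differentiable_def)
  have d1: "partial i f differentiable at z" for i z
    using f by (simp add: twice_differentiable_def partial_def[abs_def])
  have RR: "R (c *\<^sub>R z) = c * R z" "R (- z) = - R z" for c z
    using R by (simp_all add: linear_scale linear_neg bounded_linear.linear)
  have axis: "((\<lambda>x. vector [x, y] :: real ^ 2) has_derivative (\<lambda>s. s *\<^sub>R axis 1 1)) (at x)"
    "((\<lambda>y. vector [x, y] :: real ^ 2) has_derivative (\<lambda>s. s *\<^sub>R axis 2 1)) (at y)" for x y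
    unfolding vector_2_eq_axis by (auto intro!: derivative_eq_intros)
  have x1: "((\<lambda>x. R (f (vector [x, y]))) has_real_derivative R (partial 1 f (vector [x, y]))) (at x)"
    "((\<lambda>x. R (partial 1 f (vector [x, y]))) has_real_derivative R (partial 1 (partial 1 f) (vector [x, y]))) (at x)"
    "((\<lambda>y. R (f (vector [x, y]))) has_real_derivative R (partial 2 f (vector [x, y]))) (at y)"
    "((\<lambda>y. R (partial 2 f (vector [x, y]))) has_real_derivative R (partial 2 (partial 2 f) (vector [x, y]))) (at y)"
    for x y
    unfolding has_real_derivative_iff_has_vector_derivative
    by (intro bounded_linear.has_vector_derivative[OF R] has_vector_derivative_along_axis[OF _ axis(1)]
        has_vector_derivative_along_axis[OF _ axis(2)] d0 d1)+
  have off: "R (partial 1 (partial 1 f) (vector [x, y])) = - ((a x + E) / h\<^sup>2) * R (f (vector [x, y]))"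
    "R (partial 2 (partial 2 f) (vector [x, y])) = - ((b y - E) / h\<^sup>2) * R (f (vector [x, y]))"
    if "vector [x, y] \<notin> lattice T1 T2" for x y
  proof -
    have "h\<^sup>2 * R (partial 1 (partial 1 f) (vector [x, y])) = - ((a x + E) * R (f (vector [x, y])))"
      "h\<^sup>2 * R (partial 2 (partial 2 f) (vector [x, y])) = - ((b y - E) * R (f (vector [x, y])))"
      using separation[OF joint that] unfolding f_def[symmetric]
      by (metis RR vector_2)+
    then show "R (partial 1 (partial 1 f) (vector [x, y])) = - ((a x + E) / h\<^sup>2) * R (f (vector [x, y]))"
      "R (partial 2 (partial 2 f) (vector [x, y])) = - ((b y - E) / h\<^sup>2) * R (f (vector [x, y]))"
      using h by (simp_all add: field_simps)
  qed
  have ca: "isCont a x" "isCont b x" for x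
    using real_analytic_deriv(1)[OF a_analytic] real_analytic_deriv(1)[OF b_analytic] DERIV_isCont by blast+
  \<comment> \<open>Just to the right of \<open>x0\<close> the first coordinate is no multiple of
    \<open>T1\<close>, so these points are off the lattice whatever \<open>y\<close> is, and the
    equation at \<open>x0\<close> follows as a limit.\<close>
  have on1: "R (partial 1 (partial 1 f) (vector [x0, y])) = - ((a x0 + E) / h\<^sup>2) * R (f (vector [x0, y]))" for x0 y
  proof (rule deriv_eq_limit[OF x1(2)])
    show "\<forall>\<^sub>F x in at_right x0. R (partial 1 (partial 1 f) (vector [x, y])) = - ((a x + E) / h\<^sup>2) * R (f (vector [x, y]))"
      using eventually_not_lattice[OF T1_pos] by (rule eventually_mono) (rule off, simp add: vector_in_lattice_iff)
    show "isCont (\<lambda>x. - ((a x + E) / h\<^sup>2) * R (f (vector [x, y]))) x0"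
      using h by (intro continuous_intros ca DERIV_isCont[OF x1(1)]) auto
  qed
  have on2: "R (partial 2 (partial 2 f) (vector [x, y0])) = - ((b y0 - E) / h\<^sup>2) * R (f (vector [x, y0]))" for x y0
  proof (rule deriv_eq_limit[OF x1(4)])
    show "\<forall>\<^sub>F y in at_right y0. R (partial 2 (partial 2 f) (vector [x, y])) = - ((b y - E) / h\<^sup>2) * R (f (vector [x, y]))"
      using eventually_not_lattice[OF T2_pos] by (rule eventually_mono) (rule off, simp add: vector_in_lattice_iff)
    show "isCont (\<lambda>y. - ((b y - E) / h\<^sup>2) * R (f (vector [x, y]))) y0"
      using h by (intro continuous_intros ca DERIV_isCont[OF x1(3)]) auto
  qed
  have per: "f (vector [x + 2 * T1, y]) = f (vector [x, y])" "f (vector [x, y + 2 * T2]) = f (vector [x, y])" for x y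
  proof -
    have "vector [x + 2 * T1, y] - vector [x, y] = (vector [2 * T1, 0] :: real ^ 2)"
      "vector [x, y + 2 * T2] - vector [x, y] = (vector [0, 2 * T2] :: real ^ 2)"
      by (simp_all add: vec_eq_iff forall_2)
    moreover have "vector [2 * T1, 0] \<in> lattice (2 * T1) (2 * T2)" "vector [0, 2 * T2] \<in> lattice (2 * T1) (2 * T2)"
      by (auto simp: vector_in_lattice_iff intro: exI[of _ 0] exI[of _ 1])
    ultimately have "\<Phi> (vector [x, y]) = \<Phi> (vector [x + 2 * T1, y])" "\<Phi> (vector [x, y]) = \<Phi> (vector [x, y + 2 * T2])"
      using fibres by metis+
    then show "f (vector [x + 2 * T1, y]) = f (vector [x, y])" "f (vector [x, y + 2 * T2]) = f (vector [x, y])"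
      by (simp_all add: f_def)
  qed
  have "continuous_on UNIV (\<lambda>p. f (vector [fst p, snd p]))"
    by (rule continuous_on_compose2[OF pullback_continuous[OF u, folded f_def] continuous_on_vector_2])
      (auto intro!: continuous_intros)
  then have cont: "continuous_on UNIV (\<lambda>(x, y). R (f (vector [x, y])))"
    unfolding case_prod_beta by (rule bounded_linear.continuous_on[OF R])
  have "separated a b T1 T2 h E (\<lambda>x y. R (f (vector [x, y])))"
    unfolding separated_def
  proof (intro conjI allI cont)
    show "R (f (vector [x + 2 * T1, y])) = R (f (vector [x, y]))"
      "R (f (vector [x, y + 2 * T2])) = R (f (vector [x, y]))" for x y by (simp_all add: per)
    show "\<exists>f1. schroedinger h (\<lambda>x. a x + E) (\<lambda>x. R (f (vector [x, y]))) f1" for y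
      unfolding schroedinger_def using x1(1) x1(2)[unfolded on1]
      by (intro exI[of _ "\<lambda>x. R (partial 1 f (vector [x, y]))"]) blast
    show "\<exists>f2. schroedinger h (\<lambda>y. b y - E) (\<lambda>y. R (f (vector [x, y]))) f2" for x
      unfolding schroedinger_def using x1(3) x1(4)[unfolded on2]
      by (intro exI[of _ "\<lambda>y. R (partial 2 f (vector [x, y]))"]) blast
  qed
  then show ?thesis by (simp add: f_def)
qed

section \<open>The sup norm on the ellipsoid\<close>

lemma fundamental_domain:
  assumes "p \<in> ellipsoid \<alpha>"
  obtains x y where "0 \<le> x" "x \<le> 2 * T1" "0 \<le> y" "y \<le> 2 * T2" "p = \<Phi> (vector [x, y])"
proof -
  obtain z where z: "p = \<Phi> z" using assms surj by blast
  define k where "k = \<lfloor>z $ 1 / (2 * T1)\<rfloor>"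
  define l where "l = \<lfloor>z $ 2 / (2 * T2)\<rfloor>"
  define x where "x = z $ 1 - of_int k * (2 * T1)"
  define y where "y = z $ 2 - of_int l * (2 * T2)"
  have "of_int k \<le> z $ 1 / (2 * T1)" "z $ 1 / (2 * T1) \<le> of_int k + 1"
    "of_int l \<le> z $ 2 / (2 * T2)" "z $ 2 / (2 * T2) \<le> of_int l + 1"
    unfolding k_def l_def by linarith+
  then have "0 \<le> x" "x \<le> 2 * T1" "0 \<le> y" "y \<le> 2 * T2"
    using T1_pos T2_pos by (simp_all add: x_def y_def field_simps)
  moreover have "z - vector [x, y] = vector [of_int k * (2 * T1), of_int l * (2 * T2)]"
    by (simp add: vec_eq_iff forall_2 x_def y_def)
  then have "z - vector [x, y] \<in> lattice (2 * T1) (2 * T2)" by (auto simp: vector_in_lattice_iff)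
  then have "p = \<Phi> (vector [x, y])" unfolding z using fibres by metis
  ultimately show ?thesis by (rule that)
qed

text \<open>The squared bounds for real and imaginary part add up, and so do their masses, to the
  mass 2 of \<open>u\<close> on the torus; hence the constant \<open>sqrt (2 * C)\<close>.\<close>

lemma sup_norm_bound:
  "\<exists>C>0. \<forall>\<^sub>F h in at_right 0. \<forall>E u.
    joint_eigenfunction \<alpha> T1 T2 \<Phi> a b h E u \<and> L2_normalized T1 T2 \<Phi> u \<longrightarrow>
    sup_norm_on (ellipsoid \<alpha>) u \<le> C * h powr (- 1 / 2) * \<bar>ln h\<bar> powr (- 1 / 2)" (is "\<exists>C>0. \<forall>\<^sub>F h in at_right 0. ?P C h")
proof -
  obtain C where C: "C > 0" and ev: "\<forall>\<^sub>F h in at_right 0. torus_sup_bound a b T1 T2 C h"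
    using separated_bound[OF a_well b_well] by blast
  have ev01: "\<forall>\<^sub>F h in at_right (0::real). 0 < h \<and> h < 1" by (intro eventually_conj; real_asymp)
  show ?thesis
  proof (rule exI[of _ "sqrt (2 * C)"], intro conjI)
    show "sqrt (2 * C) > 0" using C by simp
    show "\<forall>\<^sub>F h in at_right 0. ?P (sqrt (2 * C)) h"
      using ev ev01
    proof (eventually_elim, intro allI impI, elim conjE)
      fix h E u
      assume bound: "torus_sup_bound a b T1 T2 C h"
        and h: "0 < h" "h < 1" and joint: "joint_eigenfunction \<alpha> T1 T2 \<Phi> a b h E u"
        and norm: "L2_normalized T1 T2 \<Phi> u"
      have u: "smooth_on_subset (ellipsoid \<alpha>) u" using joint by (simp add: joint_eigenfunction_def)
      define f where "f = (\<lambda>x y. u (\<Phi> (vector [x, y])))"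
      define I where "I = (\<lambda>g :: real \<Rightarrow> real \<Rightarrow> real. weighted_mass a b T1 T2 g)"
      have re: "separated a b T1 T2 h E (\<lambda>x y. Re (f x y))" and im: "separated a b T1 T2 h E (\<lambda>x y. Im (f x y))"
        unfolding f_def using separated_component[OF joint h(1)] bounded_linear_Re bounded_linear_Im by blast+
      have c: "continuous_on UNIV (\<lambda>(x, y). (a x + b y) * (g x y)\<^sup>2)" if "separated a b T1 T2 h E g" for g
        using that unfolding separated_def
        by (intro continuous_on_weighted periodic_well.a_cont[OF a_well] periodic_well.a_cont[OF b_well]) simp
      have "I (\<lambda>x y. Re (f x y)) + I (\<lambda>x y. Im (f x y)) =
        integral {0..2*T2} (\<lambda>y. integral {0..2*T1} (\<lambda>x. (a x + b y) * (Re (f x y))\<^sup>2 + (a x + b y) * (Im (f x y))\<^sup>2))"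
        unfolding I_def
        by (simp add: integral_add integrable_continuous_real continuous_on_partial_integral[OF c[OF re]]
            continuous_on_partial_integral[OF c[OF im]] continuous_on_section[OF c[OF re]] continuous_on_section[OF c[OF im]])
      also have "\<dots> = 2"
        using torus_mass[OF u norm] by (simp add: f_def cmod_power2 distrib_left)
      finally have mass: "I (\<lambda>x y. Re (f x y)) + I (\<lambda>x y. Im (f x y)) = 2" .
      have pt: "cmod (u p) \<le> sqrt (2 * C) * h powr (- 1 / 2) * \<bar>ln h\<bar> powr (- 1 / 2)" if p: "p \<in> ellipsoid \<alpha>" for p
      proof -
        obtain x y where xy: "0 \<le> x" "x \<le> 2 * T1" "0 \<le> y" "y \<le> 2 * T2" and px: "p = \<Phi> (vector [x, y])"
          using fundamental_domain[OF p] .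
        have L: "0 < ln (1/h)" using h by simp
        have "(cmod (f x y))\<^sup>2 * (h * ln (1/h)) = (Re (f x y))\<^sup>2 * (h * ln (1/h)) + (Im (f x y))\<^sup>2 * (h * ln (1/h))"
          by (simp add: cmod_power2 distrib_right)
        also have "\<dots> \<le> C * I (\<lambda>x y. Re (f x y)) + C * I (\<lambda>x y. Im (f x y))"
          using bound re im xy unfolding I_def by (intro add_mono) blast+
        also have "\<dots> = 2 * C" using mass by (simp add: distrib_left[symmetric])
        finally have "(cmod (f x y))\<^sup>2 \<le> 2 * C / (h * ln (1/h))" using h L by (simp add: field_simps)
        then have "cmod (f x y) \<le> sqrt (2 * C / (h * ln (1/h)))" by (rule real_le_rsqrt)
        also have "\<dots> = sqrt (2 * C) * h powr (- 1 / 2) * \<bar>ln h\<bar> powr (- 1 / 2)"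
        proof -
          have "\<bar>ln h\<bar> = ln (1/h)" using h by (simp add: ln_div)
          moreover have "x powr (- 1 / 2) = 1 / sqrt x" if "0 < x" for x :: real
            using that powr_minus_divide[of x "1 / 2"] by (simp add: powr_half_sqrt)
          ultimately show ?thesis using h L by (simp only: real_sqrt_divide real_sqrt_mult) simp
        qed
        finally show ?thesis by (simp add: f_def px)
      qed
      have "ellipsoid \<alpha> \<noteq> {}" using surj by blast
      then show "sup_norm_on (ellipsoid \<alpha>) u \<le> sqrt (2 * C) * h powr (- 1 / 2) * \<bar>ln h\<bar> powr (- 1 / 2)"
        unfolding sup_norm_on_def by (intro cSUP_least pt)
    qed
  qed
qed

end

theorem theorem2:
  fixes \<alpha> :: "real ^ 3"
    and T1 T2 :: real
    and \<Phi> :: "real ^ 2 \<Rightarrow> real ^ 3"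
    and a b :: "real \<Rightarrow> real"
  assumes "0 < \<alpha> $ 3" and "\<alpha> $ 3 < \<alpha> $ 2" and "\<alpha> $ 2 < \<alpha> $ 1"
    and "liouville_coordinates \<alpha> T1 T2 \<Phi> a b"
  shows "\<exists>C>0. \<forall>\<^sub>F h in at_right 0. \<forall>(E2::real) (u :: real ^ 3 \<Rightarrow> complex).
    joint_eigenfunction \<alpha> T1 T2 \<Phi> a b h E2 u \<and> L2_normalized T1 T2 \<Phi> u \<longrightarrow>
    sup_norm_on (ellipsoid \<alpha>) u \<le> C * h powr (- 1 / 2) * \<bar>ln h\<bar> powr (- 1 / 2)"
proof -
  interpret liouville_coordinates \<alpha> T1 T2 \<Phi> a b by (rule assms(4))
  show ?thesis by (rule sup_norm_bound)
qed

end
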